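(* Let $D \subset \mathbb{R}^m$, $m \geq 2$, be a bounded domain, let $\lambda > 0$, and let $u \in C^0(D)$ be real-valued. If the equality $$m \, J_{m/2}(\lambda r) \, M^\circ(u,x,r) = \lambda r \, J_{(m-2)/2}(\lambda r) \, M^\bullet(u,x,r)$$ holds for all $x \in D$ and all $r \in (0, r(x))$, where $r(x) > 0$ is such that the ball $B_{r(x)}(x)$ is admissible, then $u$ is metaharmonic in $D$, that is, $u$ satisfies $\nabla^2 u + \lambda^2 u = 0$ in $D$.
   Context: A domain is an open connected subset of $\mathbb{R}^m$. $B_r(x) = \{ y : |y-x| < r\}$; the ball is called admissible if $\overline{B_r(x)} \subset D$. The mean values over spheres and balls are $$M^\circ(u,x,r) = \frac{1}{|\partial B_r|} \int_{\partial B_r(x)} u(y) \, dS_y, \qquad M^\bullet(u,x,r) = \frac{1}{|B_r|} \int_{B_r(x)} u(y) \, dy,$$ where $|\partial B_r|$ is the area of the sphere of radius $r$ and $|B_r|$ the volume of the ball of radius $r$ in $\mathbb{R}^m$. $J_\nu$ is the Bessel function of the first kind of order $\nu$. *)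

theory Defs
  imports "HOL-Analysis.Analysis"
begin

(* The usual power series. Because 0 powr 0 = 0, this is meant for x > 0 only. *)
definition bessel_J :: "real \<Rightarrow> real \<Rightarrow> real" where
  "bessel_J \<nu> x =
     (\<Sum>k. (-1) ^ k / fact k * rGamma (\<nu> + real k + 1) * (x / 2) powr (2 * real k + \<nu>))"

(* Lebesgue measure of dimension DIM('a) - 1 on the hyperplane orthogonal to the basis vector b,
   viewed as a measure on the whole space; compare lborel_eq. *)
definition hyperplane_lborel :: "'a::euclidean_space \<Rightarrow> 'a measure" where
  "hyperplane_lborel b =
     distr (\<Pi>\<^sub>M i\<in>Basis - {b}. lborel) borel (\<lambda>f. \<Sum>i\<in>Basis - {b}. f i *\<^sub>R i)"

(* Surface integral over the sphere, as the sum of the integrals over the two open hemispheres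
   that are the graphs of h and -h, h p = sqrt (r^2 - |p|^2), over the disc |p| < r in the
   hyperplane orthogonal to a coordinate direction b; the equator is a null set. The weight is the
   area element of a graph, sqrt (1 + |grad h|^2) = r / sqrt (r^2 - |p|^2).
   The value does not depend on which basis vector b is chosen. *)
definition sphere_integral :: "('a::euclidean_space \<Rightarrow> real) \<Rightarrow> 'a \<Rightarrow> real \<Rightarrow> real" where
  "sphere_integral f x r =
     (let b = (SOME b. b \<in> Basis); h = (\<lambda>p. sqrt (r\<^sup>2 - (norm p)\<^sup>2))
      in LINT p:ball 0 r|hyperplane_lborel b.
           (f (x + p + h p *\<^sub>R b) + f (x + p - h p *\<^sub>R b)) * (r / h p))"

definition sphere_mean :: "('a::euclidean_space \<Rightarrow> real) \<Rightarrow> 'a \<Rightarrow> real \<Rightarrow> real" where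
  "sphere_mean u x r = sphere_integral u x r / sphere_integral (\<lambda>_. 1) x r"

definition ball_mean :: "('a::euclidean_space \<Rightarrow> real) \<Rightarrow> 'a \<Rightarrow> real \<Rightarrow> real" where
  "ball_mean u x r = (LINT y:ball x r|lborel. u y) / measure lborel (ball x r)"

definition partial_deriv :: "'a::euclidean_space \<Rightarrow> ('a \<Rightarrow> real) \<Rightarrow> 'a \<Rightarrow> real" where
  "partial_deriv b f x = frechet_derivative f (at x) b"

definition C1_on :: "'a::euclidean_space set \<Rightarrow> ('a \<Rightarrow> real) \<Rightarrow> bool" where
  "C1_on D f \<longleftrightarrow>
     (\<forall>x\<in>D. f differentiable (at x)) \<and> (\<forall>b\<in>Basis. continuous_on D (partial_deriv b f))"

definition C2_on :: "'a::euclidean_space set \<Rightarrow> ('a \<Rightarrow> real) \<Rightarrow> bool" where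
  "C2_on D f \<longleftrightarrow> C1_on D f \<and> (\<forall>b\<in>Basis. C1_on D (partial_deriv b f))"

definition laplacian :: "('a::euclidean_space \<Rightarrow> real) \<Rightarrow> 'a \<Rightarrow> real" where
  "laplacian f x = (\<Sum>b\<in>Basis. partial_deriv b (partial_deriv b f) x)"

definition metaharmonic_on :: "real \<Rightarrow> 'a::euclidean_space set \<Rightarrow> ('a \<Rightarrow> real) \<Rightarrow> bool" where
  "metaharmonic_on \<mu> D u \<longleftrightarrow> C2_on D u \<and> (\<forall>x\<in>D. laplacian u x + \<mu>\<^sup>2 * u x = 0)"

definition admissible_ball :: "'a::euclidean_space set \<Rightarrow> 'a \<Rightarrow> real \<Rightarrow> bool" where
  "admissible_ball D x r \<longleftrightarrow> closure (ball x r) \<subseteq> D"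

end

theory Submission
  imports Defs
begin

text \<open>
  Since the ball integral \<open>A r\<close> of \<open>u\<close> around \<open>x\<close> has the sphere integral as its derivative, the
  hypothesis is the first order equation \<open>F A' = F' A\<close> with \<open>F r = r powr (m/2) * J\<^bsub>m/2\<^esub> (\<mu> r)\<close>.
  Hence \<open>A\<close> is a multiple of \<open>F\<close> near \<open>0\<close>, and the ball means satisfy
  \<open>M r = u x - \<mu>\<^sup>2 u x r\<^sup>2 / (2 (m + 2)) + o(r\<^sup>2)\<close> at every point, but with no uniformity in \<open>x\<close>.

  To pass to the weak form of the equation, replace \<open>u\<close> by its sup-convolutions, for which the
  difference quotients \<open>(M r - u x) / r\<^sup>2\<close> are bounded below, so that a Fatou argument gives
  \<open>\<integral> u (\<Delta>\<phi> + \<mu>\<^sup>2 \<phi>) \<ge> 0\<close>; apply this to \<open>u\<close> and to \<open>- u\<close>. The only test functions needed are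
  the translates of \<open>\<phi> = (R\<^sup>2 - |y|\<^sup>2)\<^sub>+\<^sup>3\<close>. As a function of \<open>w = R\<^sup>2\<close>, the convolution of \<open>u\<close> with
  \<open>\<phi>\<close> then solves a Bessel equation, whence it equals \<open>u\<close> times a constant that does not depend
  on the point. So \<open>u\<close> is locally a multiple of its convolution with a twice continuously
  differentiable kernel, and the weak equation becomes the pointwise one.
\<close>

subsection \<open>Bessel series\<close>

text \<open>The obstacle is that the radius \<open>\<rho>\<close> is an arbitrary function of the
  point: the quotients (M r - u x) / r^2 cannot be dominated, and a mollification of u has no common
  radius on which it could inherit the identity. A sup-convolution w does inherit something. If the
  supremum at z is attained at y, then the increments of w at z dominate those of u at y, so a lower
  bound known at y for uncontrolled small radii passes to w, while semiconvexity bounds the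
  quotients of w from below uniformly. Only inequalities survive this, hence the use of both u and
  -u.

  The constant 2 (m + 2) is half a second difference together with the second moment 1 / (m + 2) of
  the normalised unit ball. The exponent 3 is the least one that makes the kernel twice continuously
  differentiable. Its Laplacian involves only the exponents 1 and 2, whose moments are derivatives
  in w of the moment with exponent 3; so the weak equation is a second order linear equation in w,
  of Bessel type with order m/2 + 3. The moments vanish at w = 0, which leaves one free factor, and
  this factor is read off as w tends to 0.\<close>

definition bessel_series :: "real \<Rightarrow> real \<Rightarrow> real" where
  "bessel_series \<nu> z = (\<Sum>k. (-1) ^ k * rGamma (\<nu> + real k + 1) / fact k * z ^ k)"

lemma rGamma_real_pos: "rGamma x > 0" if "x > (0::real)"
  using that Gamma_real_pos[of x] by (simp add: rGamma_inverse_Gamma)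

lemma summable_bessel_series:
  assumes "\<nu> > -1"
  shows "summable (\<lambda>k. (-1) ^ k * rGamma (\<nu> + real k + 1) / fact k * z ^ k)"
proof -
  \<comment> \<open>Consecutive terms have quotient |z| / ((n + 1) (\<nu> + n + 1)) in absolute
    value; this N makes it at most 1/2 from N on.\<close>
  obtain N where N: "2 * \<bar>z\<bar> / (\<nu> + 1) \<le> real N" using real_arch_simple by blast
  show ?thesis
  proof (rule summable_ratio_test[of "1/2" N])
    fix n assume n: "N \<le> n"
    have pos: "\<nu> + real n + 1 > 0" using assms by linarith
    have G: "rGamma (\<nu> + real n + 1) = (\<nu> + real n + 1) * rGamma (\<nu> + real (Suc n) + 1)"
      using rGamma_plus1[of "\<nu> + real n + 1"] by (simp add: algebra_simps)
    have "2 * \<bar>z\<bar> \<le> real N * (\<nu> + 1)" using N assms by (simp add: field_simps)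
    also have "\<dots> \<le> real (Suc n) * (\<nu> + real n + 1)"
      using n assms by (intro mult_mono) auto
    finally have *: "2 * \<bar>z\<bar> \<le> real (Suc n) * (\<nu> + real n + 1)" .
    have z: "\<bar>z\<bar> / (real (Suc n) * (\<nu> + real n + 1)) \<le> 1 / 2"
    proof -
      have "real (Suc n) * (\<nu> + real n + 1) > 0" using pos by simp
      with * show ?thesis by (subst pos_divide_le_eq) linarith+
    qed
    let ?c = "rGamma (\<nu> + real n + 1) / fact n * \<bar>z\<bar> ^ n"
    have c: "?c \<ge> 0" using rGamma_real_pos[OF pos] by simp
    have p2: "rGamma (\<nu> + real (Suc n) + 1) > 0" using pos by (intro rGamma_real_pos) simp
    have "norm ((-1) ^ Suc n * rGamma (\<nu> + real (Suc n) + 1) / fact (Suc n) * z ^ Suc n)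
        = rGamma (\<nu> + real (Suc n) + 1) / fact (Suc n) * \<bar>z\<bar> ^ Suc n"
      using p2 by (simp add: norm_mult norm_power abs_mult power_abs)
    also have "\<dots> = rGamma (\<nu> + real n + 1) / (\<nu> + real n + 1) / fact (Suc n) * \<bar>z\<bar> ^ Suc n"
      unfolding G using pos by simp
    also have "rGamma (\<nu> + real n + 1) / (\<nu> + real n + 1) / fact (Suc n) * \<bar>z\<bar> ^ Suc n
       = \<bar>z\<bar> / (real (Suc n) * (\<nu> + real n + 1)) * ?c"
      by (simp add: field_simps)
    also have "\<dots> \<le> 1 / 2 * ?c" using z c by (rule mult_right_mono)
    also have "1 / 2 * ?c = 1 / 2 * norm ((-1) ^ n * rGamma (\<nu> + real n + 1) / fact n * z ^ n)"
      using rGamma_real_pos[OF pos] by (simp add: abs_mult power_abs)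
    finally show "norm ((-1) ^ Suc n * rGamma (\<nu> + real (Suc n) + 1) / fact (Suc n) * z ^ Suc n)
      \<le> 1 / 2 * norm ((-1) ^ n * rGamma (\<nu> + real n + 1) / fact n * z ^ n)" .
  qed simp
qed

text \<open>\<open>bessel_series\<close> is the Bessel-Clifford function at -z. Splitting it off
  isolates the \<open>powr\<close> factor: what remains is entire in z = x^2/4, can be evaluated and
  differentiated at 0, and its derivative only raises the order.\<close>

lemma bessel_J_eq_series:
  assumes "\<nu> > -1" "x > 0"
  shows "bessel_J \<nu> x = (x / 2) powr \<nu> * bessel_series \<nu> (x\<^sup>2 / 4)"
proof -
  have "(x / 2) powr (2 * real k + \<nu>) = (x / 2) powr \<nu> * (x\<^sup>2 / 4) ^ k" for k
  proof -
    have "(x / 2) powr (2 * real k + \<nu>) = (x / 2) powr real (2 * k) * (x / 2) powr \<nu>"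
      by (simp add: powr_add)
    also have "(x / 2) powr real (2 * k) = (x / 2) ^ (2 * k)"
      using assms(2) by (subst powr_realpow) auto
    also have "\<dots> = (x\<^sup>2 / 4) ^ k" by (simp add: power_mult power_divide)
    finally show ?thesis by simp
  qed
  then have "bessel_J \<nu> x = (\<Sum>k. (x / 2) powr \<nu> *
      ((-1) ^ k * rGamma (\<nu> + real k + 1) / fact k * (x\<^sup>2 / 4) ^ k))"
    unfolding bessel_J_def by (simp add: mult_ac)
  also have "\<dots> = (x / 2) powr \<nu> * bessel_series \<nu> (x\<^sup>2 / 4)"
    unfolding bessel_series_def by (rule suminf_mult[OF summable_bessel_series[OF assms(1)]])
  finally show ?thesis .
qed

lemma bessel_series_0: "bessel_series \<nu> 0 = rGamma (\<nu> + 1)"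
  unfolding bessel_series_def using powser_zero[of "\<lambda>k. (-1) ^ k * rGamma (\<nu> + real k + 1) / fact k"]
  by simp

lemma has_real_derivative_bessel_series:
  assumes "\<nu> > -1"
  shows "(bessel_series \<nu> has_real_derivative - bessel_series (\<nu> + 1) z) (at z)"
proof -
  let ?c = "\<lambda>k. (-1) ^ k * rGamma (\<nu> + real k + 1) / fact k"
  have "((\<lambda>x. \<Sum>k. ?c k * x ^ k) has_real_derivative (\<Sum>k. diffs ?c k * z ^ k)) (at z)"
    by (rule termdiffs_strong_converges_everywhere) (rule summable_bessel_series[OF assms])
  moreover have "diffs ?c k * z ^ k
      = - ((-1) ^ k * rGamma (\<nu> + 1 + real k + 1) / fact k * z ^ k)" for k
  proof -
    have "rGamma (\<nu> + real (Suc k) + 1) = rGamma (\<nu> + 1 + real k + 1)" by (simp add: algebra_simps)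
    then show ?thesis
      by (simp add: diffs_def fact_Suc del: of_nat_Suc)
  qed
  moreover have "(\<Sum>k. - ((-1) ^ k * rGamma (\<nu> + 1 + real k + 1) / fact k * z ^ k)) = - bessel_series (\<nu> + 1) z"
    unfolding bessel_series_def using assms by (intro suminf_minus summable_bessel_series) simp
  moreover have "(\<lambda>x. \<Sum>k. ?c k * x ^ k) = bessel_series \<nu>"
    by (simp add: bessel_series_def fun_eq_iff)
  ultimately show ?thesis by (simp only:)
qed

lemma isCont_bessel_series: "\<nu> > -1 \<Longrightarrow> isCont (bessel_series \<nu>) z"
  using has_real_derivative_bessel_series DERIV_isCont by blast

text \<open>With z = x^2/4 this is the classical J_(\<nu>-1)(x) + J_(\<nu>+1)(x) = (2 \<nu> / x)
  J_\<nu>(x). Coefficients are compared: the constant terms cancel by the recursion of Gamma, and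
  the others carry a factor -(k + 1) that turns \<open>fact (Suc k)\<close> into
  \<open>fact k\<close>.\<close>

lemma bessel_series_recurrence:
  assumes "\<nu> > 0"
  shows "\<nu> * bessel_series \<nu> z - z * bessel_series (\<nu> + 1) z = bessel_series (\<nu> - 1) z"
proof -
  let ?c = "\<lambda>\<nu> k. (-1) ^ k * rGamma (\<nu> + real k + 1) / fact k * z ^ k :: real"
  have s: "summable (?c \<nu>)" "summable (?c (\<nu> + 1))" "summable (?c (\<nu> - 1))"
    using assms by (intro summable_bessel_series; simp)+
  have "summable (\<lambda>k. \<nu> * ?c \<nu> k - ?c (\<nu> - 1) k)"
    using s by (intro summable_diff summable_mult)
  then have "(\<Sum>k. \<nu> * ?c \<nu> k - ?c (\<nu> - 1) k)
      = (\<nu> * ?c \<nu> 0 - ?c (\<nu> - 1) 0) + (\<Sum>k. \<nu> * ?c \<nu> (Suc k) - ?c (\<nu> - 1) (Suc k))"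
    by (subst suminf_split_head) auto
  also have "\<nu> * ?c \<nu> 0 - ?c (\<nu> - 1) 0 = 0"
    using rGamma_plus1[of \<nu>] by simp
  also have "(\<lambda>k. \<nu> * ?c \<nu> (Suc k) - ?c (\<nu> - 1) (Suc k)) = (\<lambda>k. z * ?c (\<nu> + 1) k)"
  proof
    fix k
    define g where "g = rGamma (\<nu> + real k + 2)"
    have a: "rGamma (\<nu> - 1 + real (Suc k) + 1) = (\<nu> + real k + 1) * g"
      using rGamma_plus1[of "\<nu> + real k + 1"] by (simp add: g_def algebra_simps)
    have b: "rGamma (\<nu> + real (Suc k) + 1) = g" "rGamma (\<nu> + 1 + real k + 1) = g"
      by (simp_all add: g_def algebra_simps)
    have "\<nu> * ?c \<nu> (Suc k) - ?c (\<nu> - 1) (Suc k) = (-1) ^ Suc k * g * (\<nu> - (\<nu> + real k + 1)) / fact (Suc k) * z ^ Suc k"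
      unfolding a b by (simp only: diff_divide_distrib right_diff_distrib left_diff_distrib) (simp add: mult_ac)
    also have "\<nu> - (\<nu> + real k + 1) = - real (Suc k)" by simp
    also have "(-1) ^ Suc k * g * - real (Suc k) / fact (Suc k) * z ^ Suc k = z * ?c (\<nu> + 1) k"
      unfolding b by (simp add: fact_Suc del: of_nat_Suc)
    finally show "\<nu> * ?c \<nu> (Suc k) - ?c (\<nu> - 1) (Suc k) = z * ?c (\<nu> + 1) k" .
  qed
  also have "(\<Sum>k. z * ?c (\<nu> + 1) k) = z * bessel_series (\<nu> + 1) z"
    unfolding bessel_series_def by (rule suminf_mult[OF s(2)])
  also have "(\<Sum>k. \<nu> * ?c \<nu> k - ?c (\<nu> - 1) k) = \<nu> * bessel_series \<nu> z - bessel_series (\<nu> - 1) z"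
    unfolding bessel_series_def
    by (subst suminf_diff[OF summable_mult[OF s(1)] s(3), symmetric], subst suminf_mult[OF s(1), symmetric]) simp
  finally show ?thesis by simp
qed

text \<open>The classical rule that x^\<nu> J_\<nu> has derivative x^\<nu> J_(\<nu>-1), in a
  variable proportional to x^2. It differentiates the comparison function \<open>H\<close> in
  \<open>radial_moment_3_eq_bessel\<close>.\<close>

lemma has_real_derivative_powr_bessel_series:
  assumes "\<nu> > 0" "w > 0" "c > 0"
  shows "((\<lambda>w. w powr \<nu> * bessel_series \<nu> (c * w)) has_real_derivative
    w powr (\<nu> - 1) * bessel_series (\<nu> - 1) (c * w)) (at w)"
proof -
  have e: "w powr \<nu> = w * w powr (\<nu> - 1)"
    using assms(2) powr_mult_base[of w "\<nu> - 1"] by simp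
  have 1: "((\<lambda>w. bessel_series \<nu> (c * w)) has_real_derivative - bessel_series (\<nu> + 1) (c * w) * c) (at w)"
    using assms(1) by (intro DERIV_chain2[OF has_real_derivative_bessel_series]) (auto intro!: derivative_eq_intros)
  show ?thesis
    apply (rule DERIV_cong[OF DERIV_mult[OF has_real_derivative_powr[OF assms(2)] 1]])
    unfolding bessel_series_recurrence[OF assms(1), of "c * w", symmetric]
    by (simp add: e algebra_simps)
qed

subsection \<open>Integration in polar coordinates\<close>

lemma nn_integral_lborel_split_coordinate:
  fixes g :: "'a::euclidean_space \<Rightarrow> ennreal"
  assumes b: "b \<in> Basis" and [measurable]: "g \<in> borel_measurable borel"
  shows "(\<integral>\<^sup>+y. g y \<partial>lborel) =
    (\<integral>\<^sup>+f. \<integral>\<^sup>+t. g ((\<Sum>i\<in>Basis - {b}. f i *\<^sub>R i) + t *\<^sub>R b) \<partial>lborel \<partial>(\<Pi>\<^sub>M i\<in>Basis - {b}. lborel))"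
proof -
  interpret product_sigma_finite "\<lambda>_::'a. lborel :: real measure" by standard
  have m[measurable]: "(\<lambda>f. g (\<Sum>i\<in>Basis. f i *\<^sub>R i)) \<in> borel_measurable (\<Pi>\<^sub>M i\<in>Basis. lborel)"
    by measurable
  have ins: "insert b (Basis - {b}) = Basis" using b by auto
  have "(\<integral>\<^sup>+y. g y \<partial>lborel) = (\<integral>\<^sup>+f. g (\<Sum>i\<in>Basis. f i *\<^sub>R i) \<partial>(\<Pi>\<^sub>M i\<in>insert b (Basis - {b}). lborel))"
    unfolding ins by (subst lborel_eq) (simp add: nn_integral_distr)
  also have "\<dots> = (\<integral>\<^sup>+f. \<integral>\<^sup>+t. g (\<Sum>i\<in>Basis. (f(b := t)) i *\<^sub>R i) \<partial>lborel \<partial>(\<Pi>\<^sub>M i\<in>Basis - {b}. lborel))"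
    using m by (subst product_nn_integral_insert) (auto simp: ins)
  also have "(\<lambda>f t. \<Sum>i\<in>Basis. (f(b := t)) i *\<^sub>R i) = (\<lambda>f t. (\<Sum>i\<in>Basis - {b}. f i *\<^sub>R i) + t *\<^sub>R b)"
  proof (intro ext)
    fix f :: "'a \<Rightarrow> real" and t
    have "(\<Sum>i\<in>Basis. (f(b := t)) i *\<^sub>R i) = t *\<^sub>R b + (\<Sum>i\<in>Basis - {b}. (f(b := t)) i *\<^sub>R i)"
      using b by (subst sum.remove[of _ b]) auto
    also have "(\<Sum>i\<in>Basis - {b}. (f(b := t)) i *\<^sub>R i) = (\<Sum>i\<in>Basis - {b}. f i *\<^sub>R i)"
      by (intro sum.cong) auto
    finally show "(\<Sum>i\<in>Basis. (f(b := t)) i *\<^sub>R i) = (\<Sum>i\<in>Basis - {b}. f i *\<^sub>R i) + t *\<^sub>R b" by simp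
  qed
  finally show ?thesis by (simp add: fun_eq_iff)
qed

lemma nn_integral_lborel_even:
  fixes G :: "real \<Rightarrow> ennreal"
  assumes [measurable]: "G \<in> borel_measurable borel"
  shows "(\<integral>\<^sup>+t. G t \<partial>lborel) = (\<integral>\<^sup>+t. (G t + G (-t)) * indicator {0<..} t \<partial>lborel)"
proof -
  have "(\<integral>\<^sup>+t. G t \<partial>lborel) = (\<integral>\<^sup>+t. G t * indicator {0<..} t + G t * indicator {..<0} t \<partial>lborel)"
    by (rule nn_integral_cong_AE, use AE_lborel_singleton[of "0::real"] in eventually_elim)
      (auto split: split_indicator)
  also have "\<dots> = (\<integral>\<^sup>+t. G t * indicator {0<..} t \<partial>lborel) + (\<integral>\<^sup>+t. G t * indicator {..<0} t \<partial>lborel)"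
    by (rule nn_integral_add) auto
  also have "(\<integral>\<^sup>+t. G t * indicator {..<0} t \<partial>lborel) = (\<integral>\<^sup>+t. G (-t) * indicator {0<..} t \<partial>lborel)"
    by (subst lborel_distr_uminus[symmetric], subst nn_integral_distr)
      (auto intro!: nn_integral_cong split: split_indicator)
  also have "(\<integral>\<^sup>+t. G t * indicator {0<..} t \<partial>lborel) + \<dots> =
     (\<integral>\<^sup>+t. G t * indicator {0<..} t + G (-t) * indicator {0<..} t \<partial>lborel)"
    by (rule nn_integral_add[symmetric]) auto
  finally show ?thesis by (simp add: distrib_right)
qed

text \<open>The substitution is made in the direction \<open>s = sqrt (p\<^sup>2 + t\<^sup>2)\<close>, whose derivative stays bounded.\<close>
lemma nn_integral_chord:
  fixes G :: "real \<Rightarrow> ennreal"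
  assumes [measurable]: "G \<in> borel_measurable borel" and p: "p \<ge> 0" and r: "r > 0"
  shows "(\<integral>\<^sup>+t. G t * indicator {t. p\<^sup>2 + t\<^sup>2 < r\<^sup>2} t \<partial>lborel) =
    (\<integral>\<^sup>+s. (G (sqrt (s\<^sup>2 - p\<^sup>2)) + G (- sqrt (s\<^sup>2 - p\<^sup>2))) * ennreal (s / sqrt (s\<^sup>2 - p\<^sup>2))
        * indicator {p<..<r} s \<partial>lborel)"
proof (cases "p < r")
  case False
  then have "r\<^sup>2 \<le> p\<^sup>2 + t\<^sup>2" for t
    using r power_mono[of r p 2] by (smt (verit) zero_le_power2)
  then have "{t. p\<^sup>2 + t\<^sup>2 < r\<^sup>2} = {}" "{p<..<r} = {}"
    using False by (auto simp: not_less)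
  then show ?thesis by simp
next
  case True
  define T where "T = sqrt (r\<^sup>2 - p\<^sup>2)"
  have "p\<^sup>2 < r\<^sup>2" using True p by (simp add: power_strict_mono)
  then have T: "T > 0" "T\<^sup>2 = r\<^sup>2 - p\<^sup>2" by (simp_all add: T_def)
  \<comment> \<open>At p = 0 the root is |t|, which has no two-sided derivative at t = 0; on
    \<open>{0..T}\<close> it agrees with t.\<close>
  define g where "g t = (if p = 0 then t else sqrt (p\<^sup>2 + t\<^sup>2))" for t
  define g' where "g' t = (if p = 0 then 1 else t / sqrt (p\<^sup>2 + t\<^sup>2))" for t
  define F where "F s = (G (sqrt (s\<^sup>2 - p\<^sup>2)) + G (- sqrt (s\<^sup>2 - p\<^sup>2))) * ennreal (s / sqrt (s\<^sup>2 - p\<^sup>2))" for s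
  have [measurable]: "F \<in> borel_measurable borel" unfolding F_def by measurable
  have g0: "g 0 = p" using p by (simp add: g_def)
  have gT: "g T = r" using T r by (auto simp: g_def intro: power2_eq_imp_eq)
  have F: "F (g t) * ennreal (g' t) = G t + G (-t)" if "t > 0" for t
  proof -
    have 1: "sqrt ((g t)\<^sup>2 - p\<^sup>2) = t" using that p by (simp add: g_def)
    have 2: "g t > 0" using that by (auto simp: g_def sum_power2_gt_zero_iff)
    have "g t / t * g' t = 1" using that 2 by (auto simp: g_def g'_def)
    then have "ennreal (g t / t) * ennreal (g' t) = 1"
      using that 2 by (simp add: ennreal_mult'[symmetric])
    then show ?thesis unfolding F_def 1 by (simp add: mult.assoc)
  qed
  have "(\<integral>\<^sup>+t. G t * indicator {t. p\<^sup>2 + t\<^sup>2 < r\<^sup>2} t \<partial>lborel) =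
     (\<integral>\<^sup>+t. (G t * indicator {t. p\<^sup>2 + t\<^sup>2 < r\<^sup>2} t + G (-t) * indicator {t. p\<^sup>2 + t\<^sup>2 < r\<^sup>2} (-t)) * indicator {0<..} t \<partial>lborel)"
    by (rule nn_integral_lborel_even) measurable
  also have "\<dots> = (\<integral>\<^sup>+t. F (g t) * ennreal (g' t) * indicator {0..T} t \<partial>lborel)"
  proof (rule nn_integral_cong_AE)
    show "AE t in lborel. (G t * indicator {t. p\<^sup>2 + t\<^sup>2 < r\<^sup>2} t + G (-t) * indicator {t. p\<^sup>2 + t\<^sup>2 < r\<^sup>2} (-t)) * indicator {0<..} t
       = F (g t) * ennreal (g' t) * indicator {0..T} t"
      using AE_lborel_singleton[of "0::real"] AE_lborel_singleton[of T]
    proof eventually_elim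
      case (elim t)
      show ?case
      proof (cases "t > 0")
        case True
        have "p\<^sup>2 + t\<^sup>2 < r\<^sup>2 \<longleftrightarrow> t\<^sup>2 < T\<^sup>2" using T by auto
        also have "\<dots> \<longleftrightarrow> t < T" using True T(1) by (auto intro: power2_less_imp_less power_strict_mono)
        finally show ?thesis using F[OF True] True elim by (auto split: split_indicator)
      qed (use elim in \<open>auto split: split_indicator\<close>)
    qed
  qed
  also have "\<dots> = (\<integral>\<^sup>+s. F s * indicator {g 0..g T} s \<partial>lborel)"
  proof (rule nn_integral_substitution_aux[symmetric])
    fix t assume t: "t \<in> {0..T}"
    show "(g has_real_derivative g' t) (at t)"
    proof (cases "p = 0")
      case False
      then have "p\<^sup>2 + t\<^sup>2 > 0" by (simp add: sum_power2_gt_zero_iff)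
      then show ?thesis using False unfolding g_def g'_def
        by (auto intro!: derivative_eq_intros simp: field_simps)
    qed (simp add: g_def[abs_def] g'_def)
    show "0 \<le> g' t" using t by (simp add: g'_def)
  next
    have "p \<noteq> 0 \<Longrightarrow> p\<^sup>2 + t\<^sup>2 \<noteq> 0" for t by (simp add: sum_power2_eq_zero_iff)
    then show "continuous_on {0..T} g'"
      by (cases "p = 0") (auto simp: g'_def intro!: continuous_intros)
  qed (use T in auto)
  also have "\<dots> = (\<integral>\<^sup>+s. F s * indicator {p<..<r} s \<partial>lborel)"
    unfolding g0 gT
    by (rule nn_integral_cong_AE, use AE_lborel_singleton[of p] AE_lborel_singleton[of r] in eventually_elim)
      (auto split: split_indicator)
  finally show ?thesis unfolding F_def .
qed

section \<open>Coordinates on a hyperplane and their scaling\<close>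

abbreviation hyperplane_coords :: "'a::euclidean_space \<Rightarrow> ('a \<Rightarrow> real) measure" where
  "hyperplane_coords b \<equiv> \<Pi>\<^sub>M i\<in>Basis - {b}. lborel"

abbreviation hyperplane_point :: "'a::euclidean_space \<Rightarrow> ('a \<Rightarrow> real) \<Rightarrow> 'a" where
  "hyperplane_point b f \<equiv> \<Sum>i\<in>Basis - {b}. f i *\<^sub>R i"

lemma inner_hyperplane_point: "b \<in> Basis \<Longrightarrow> hyperplane_point b f \<bullet> b = 0"
  by (auto simp: inner_sum_left inner_Basis intro!: sum.neutral)

lemma norm_hyperplane_point_add:
  assumes "b \<in> Basis"
  shows "(norm (hyperplane_point b f + t *\<^sub>R b))\<^sup>2 = (norm (hyperplane_point b f))\<^sup>2 + t\<^sup>2"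
proof -
  have "(norm (hyperplane_point b f + t *\<^sub>R b))\<^sup>2 = (norm (hyperplane_point b f))\<^sup>2 + (norm (t *\<^sub>R b))\<^sup>2"
    by (rule norm_add_Pythagorean) (use inner_hyperplane_point[OF assms] in \<open>simp add: orthogonal_def\<close>)
  then show ?thesis using assms by simp
qed

lemma norm_hyperplane_point_sphere:
  assumes b: "b \<in> Basis" and q: "norm (hyperplane_point b q) < s"
  defines "t \<equiv> sqrt (s\<^sup>2 - (norm (hyperplane_point b q))\<^sup>2)"
  shows "norm (hyperplane_point b q + t *\<^sub>R b) = s" and "norm (hyperplane_point b q - t *\<^sub>R b) = s"
proof -
  have s: "s \<ge> 0" using norm_ge_zero[of "hyperplane_point b q"] q by linarith
  have t: "t\<^sup>2 = s\<^sup>2 - (norm (hyperplane_point b q))\<^sup>2"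
    unfolding t_def using q by (simp add: power_mono)
  have "(norm (hyperplane_point b q + c *\<^sub>R b))\<^sup>2 = s\<^sup>2" if "c\<^sup>2 = t\<^sup>2" for c
    unfolding norm_hyperplane_point_add[OF b] that t by simp
  then have c: "norm (hyperplane_point b q + c *\<^sub>R b) = s" if "c\<^sup>2 = t\<^sup>2" for c
    using that s power2_eq_imp_eq norm_ge_zero by blast
  show "norm (hyperplane_point b q + t *\<^sub>R b) = s" by (rule c) (rule refl)
  have "norm (hyperplane_point b q + (- t) *\<^sub>R b) = s" by (rule c) (rule power2_minus)
  then show "norm (hyperplane_point b q - t *\<^sub>R b) = s"
    by (simp only: scaleR_minus_left add_uminus_conv_diff)
qed

text \<open>Thickening the hyperplane to a slab of height s expresses the hyperplane integral
  through \<open>lborel\<close>, whose scaling law can then be carried over.\<close>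

lemma nn_integral_hyperplane:
  fixes F :: "'a::euclidean_space \<Rightarrow> ennreal"
  assumes b: "b \<in> Basis" and [measurable]: "F \<in> borel_measurable borel" and s: "s > 0"
  shows "(\<integral>\<^sup>+y. F (y - (y \<bullet> b) *\<^sub>R b) * indicator {0<..<s} (y \<bullet> b) \<partial>lborel)
    = ennreal s * (\<integral>\<^sup>+f. F (hyperplane_point b f) \<partial>hyperplane_coords b)"
proof -
  have e: "(hyperplane_point b f + t *\<^sub>R b) \<bullet> b = t" for f t
    using inner_hyperplane_point[OF b, of f] b by (simp add: inner_add_left)
  have "(\<integral>\<^sup>+y. F (y - (y \<bullet> b) *\<^sub>R b) * indicator {0<..<s} (y \<bullet> b) \<partial>lborel)
    = (\<integral>\<^sup>+f. \<integral>\<^sup>+t. F (hyperplane_point b f) * indicator {0<..<s} t \<partial>lborel \<partial>hyperplane_coords b)"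
    by (subst nn_integral_lborel_split_coordinate[OF b]) (simp_all add: e)
  also have "\<dots> = (\<integral>\<^sup>+f. F (hyperplane_point b f) * ennreal s \<partial>hyperplane_coords b)"
    using s by (simp add: nn_integral_cmult)
  also have "\<dots> = ennreal s * (\<integral>\<^sup>+f. F (hyperplane_point b f) \<partial>hyperplane_coords b)"
    by (subst mult.commute, rule nn_integral_cmult) measurable
  finally show ?thesis .
qed

lemma nn_integral_lborel_scale:
  fixes F :: "'a::euclidean_space \<Rightarrow> ennreal"
  assumes [measurable]: "F \<in> borel_measurable borel" and s: "s > 0"
  shows "(\<integral>\<^sup>+y. F y \<partial>lborel) = ennreal (s ^ DIM('a)) * (\<integral>\<^sup>+y. F (x + s *\<^sub>R y) \<partial>lborel)"
proof -
  have "(\<integral>\<^sup>+y. F y \<partial>lborel) = (\<integral>\<^sup>+y. F y \<partial>density (distr lborel borel (\<lambda>y. x + s *\<^sub>R y)) (\<lambda>_. ennreal (\<bar>s\<bar> ^ DIM('a))))"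
    using s by (subst lborel_affine[of s x]) auto
  also have "\<dots> = (\<integral>\<^sup>+y. ennreal (s ^ DIM('a)) * F (x + s *\<^sub>R y) \<partial>lborel)"
    using s by (simp add: nn_integral_density nn_integral_distr)
  also have "\<dots> = ennreal (s ^ DIM('a)) * (\<integral>\<^sup>+y. F (x + s *\<^sub>R y) \<partial>lborel)"
    by (rule nn_integral_cmult) measurable
  finally show ?thesis .
qed

text \<open>The slab of height s is the slab of height 1 dilated by s. Of the factor s^m that
  \<open>lborel\<close> contributes, one s cancels against the height.\<close>

lemma nn_integral_hyperplane_scale:
  fixes F :: "'a::euclidean_space \<Rightarrow> ennreal"
  assumes b: "b \<in> Basis" and [measurable]: "F \<in> borel_measurable borel" and s: "s > 0"
  shows "(\<integral>\<^sup>+f. F (hyperplane_point b f) \<partial>hyperplane_coords b)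
    = ennreal (s ^ (DIM('a) - 1)) * (\<integral>\<^sup>+f. F (s *\<^sub>R hyperplane_point b f) \<partial>hyperplane_coords b)"
    (is "?L = _ * ?R")
proof -
  have D: "s ^ DIM('a) = s * s ^ (DIM('a) - 1)"
    using power_minus_mult[OF DIM_positive[where 'a='a], of s] by (simp add: mult.commute)
  have "ennreal s * ?L = (\<integral>\<^sup>+y. F (y - (y \<bullet> b) *\<^sub>R b) * indicator {0<..<s} (y \<bullet> b) \<partial>lborel)"
    using nn_integral_hyperplane[OF b assms(2) s] by simp
  also have "\<dots> = ennreal (s ^ DIM('a)) *
      (\<integral>\<^sup>+y. F (0 + s *\<^sub>R y - ((0 + s *\<^sub>R y) \<bullet> b) *\<^sub>R b) * indicator {0<..<s} ((0 + s *\<^sub>R y) \<bullet> b) \<partial>lborel)"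
    by (rule nn_integral_lborel_scale[OF _ s]) measurable
  also have "(\<integral>\<^sup>+y. F (0 + s *\<^sub>R y - ((0 + s *\<^sub>R y) \<bullet> b) *\<^sub>R b) * indicator {0<..<s} ((0 + s *\<^sub>R y) \<bullet> b) \<partial>lborel)
      = (\<integral>\<^sup>+y. F (s *\<^sub>R (y - (y \<bullet> b) *\<^sub>R b)) * indicator {0<..<1} (y \<bullet> b) \<partial>lborel)"
    using s by (intro nn_integral_cong) (auto simp: scaleR_diff_right zero_less_mult_iff split: split_indicator)
  also have "\<dots> = ennreal 1 * ?R"
    by (rule nn_integral_hyperplane[OF b, of "\<lambda>y. F (s *\<^sub>R y)"]) auto
  also have "ennreal (s ^ DIM('a)) * (ennreal 1 * ?R) = ennreal s * (ennreal (s ^ (DIM('a) - 1)) * ?R)"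
    unfolding D using s by (simp add: ennreal_mult mult.assoc)
  finally show ?thesis using s by (simp add: ennreal_mult_cancel_left)
qed

text \<open>The counterpart of \<open>sphere_integral\<close> for nonnegative functions, centred at
  0, to which Tonelli and the scaling laws apply even for infinite values. It is taken over the
  coordinates instead of \<open>hyperplane_lborel\<close>, because the product measure is
  sigma-finite at once.\<close>

definition nn_sphere_integral :: "('a::euclidean_space \<Rightarrow> ennreal) \<Rightarrow> real \<Rightarrow> ennreal" where
  "nn_sphere_integral f s = (let b = (SOME b. b \<in> Basis); h = (\<lambda>p. sqrt (s\<^sup>2 - (norm p)\<^sup>2)) in
     \<integral>\<^sup>+q. (\<lambda>p. (f (p + h p *\<^sub>R b) + f (p - h p *\<^sub>R b)) * ennreal (s / h p) * indicator (ball 0 s) p)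
        (hyperplane_point b q) \<partial>hyperplane_coords b)"

lemma some_Basis: "(SOME b. b \<in> (Basis :: 'a::euclidean_space set)) \<in> Basis"
  using some_in_eq nonempty_Basis by blast

lemma sigma_finite_hyperplane_coords: "sigma_finite_measure (hyperplane_coords (b :: 'a::euclidean_space))"
proof -
  interpret product_sigma_finite "\<lambda>_::'a. lborel :: real measure" by standard
  show ?thesis by (rule sigma_finite) simp
qed

lemma measurable_nn_sphere_integral [measurable]:
  fixes f :: "'a::euclidean_space \<Rightarrow> ennreal"
  assumes [measurable]: "f \<in> borel_measurable borel"
  shows "nn_sphere_integral f \<in> borel_measurable borel"
proof -
  interpret sigma_finite_measure "hyperplane_coords (SOME b. b \<in> (Basis::'a set))"
    by (rule sigma_finite_hyperplane_coords)
  show ?thesis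
    unfolding nn_sphere_integral_def Let_def indicator_def mem_ball dist_0_norm by measurable
qed

text \<open>On each line parallel to b the substitution of \<open>nn_integral_chord\<close> trades
  the height t for the radius s. The weight s / sqrt (s^2 - |p|^2) that it produces is exactly the
  area element of the two hemispheres, and Tonelli then puts the radius outside.\<close>

lemma nn_integral_polar:
  fixes f :: "'a::euclidean_space \<Rightarrow> ennreal"
  assumes [measurable]: "f \<in> borel_measurable borel" and r: "r > 0"
  shows "(\<integral>\<^sup>+y. f y * indicator (ball 0 r) y \<partial>lborel)
    = (\<integral>\<^sup>+s. nn_sphere_integral f s * indicator {0<..<r} s \<partial>lborel)"
proof -
  define b where "b = (SOME b. b \<in> (Basis :: 'a set))"
  have b: "b \<in> Basis" unfolding b_def by (rule some_Basis)
  let ?e = "hyperplane_point b"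
  define h where "h s p = sqrt (s\<^sup>2 - (norm p)\<^sup>2)" for s and p :: 'a
  have [measurable]: "(\<lambda>(s, p). h s p) \<in> borel_measurable (borel \<Otimes>\<^sub>M borel)" unfolding h_def by measurable
  define \<Phi> where "\<Phi> s p = (f (p + h s p *\<^sub>R b) + f (p - h s p *\<^sub>R b)) * ennreal (s / h s p) * indicator (ball 0 s) p" for s p
  interpret H: sigma_finite_measure "hyperplane_coords b" by (rule sigma_finite_hyperplane_coords)
  interpret P: pair_sigma_finite "hyperplane_coords b" "lborel :: real measure" by standard
  have ball: "norm (?e q + t *\<^sub>R b) < r \<longleftrightarrow> (norm (?e q))\<^sup>2 + t\<^sup>2 < r\<^sup>2" for t q
  proof -
    have "norm (?e q + t *\<^sub>R b) < r \<longleftrightarrow> (norm (?e q + t *\<^sub>R b))\<^sup>2 < r\<^sup>2"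
      using r by (auto intro: power2_less_imp_less power_strict_mono)
    then show ?thesis using norm_hyperplane_point_add[OF b] by simp
  qed
  have "(\<integral>\<^sup>+y. f y * indicator (ball 0 r) y \<partial>lborel) =
     (\<integral>\<^sup>+q. \<integral>\<^sup>+t. f (?e q + t *\<^sub>R b) * indicator (ball 0 r) (?e q + t *\<^sub>R b) \<partial>lborel \<partial>hyperplane_coords b)"
  proof (rule nn_integral_lborel_split_coordinate[OF b])
    have [measurable]: "ball (0::'a) r \<in> sets borel" by simp
    show "(\<lambda>y. f y * indicator (ball 0 r) y) \<in> borel_measurable borel" by measurable
  qed
  also have "\<dots> = (\<integral>\<^sup>+q. \<integral>\<^sup>+t. f (?e q + t *\<^sub>R b) * indicator {t. (norm (?e q))\<^sup>2 + t\<^sup>2 < r\<^sup>2} t \<partial>lborel \<partial>hyperplane_coords b)"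
    by (intro nn_integral_cong) (simp add: ball indicator_def)
  also have "\<dots> = (\<integral>\<^sup>+q. \<integral>\<^sup>+s. \<Phi> s (?e q) * indicator {0<..<r} s \<partial>lborel \<partial>hyperplane_coords b)"
  proof (rule nn_integral_cong)
    fix q
    have "norm (?e q) < s \<Longrightarrow> s > 0" for s using norm_ge_zero[of "?e q"] by linarith
    then have "(f (?e q + h s (?e q) *\<^sub>R b) + f (?e q + (- h s (?e q)) *\<^sub>R b)) * ennreal (s / h s (?e q))
        * indicator {norm (?e q)<..<r} s = \<Phi> s (?e q) * indicator {0<..<r} s" for s
      by (auto simp: \<Phi>_def split: split_indicator)
    then show "(\<integral>\<^sup>+t. f (?e q + t *\<^sub>R b) * indicator {t. (norm (?e q))\<^sup>2 + t\<^sup>2 < r\<^sup>2} t \<partial>lborel)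
        = (\<integral>\<^sup>+s. \<Phi> s (?e q) * indicator {0<..<r} s \<partial>lborel)"
      using nn_integral_chord[of "\<lambda>t. f (?e q + t *\<^sub>R b)" "norm (?e q)" r] r by (simp add: h_def)
  qed
  also have "\<dots> = (\<integral>\<^sup>+s. \<integral>\<^sup>+q. \<Phi> s (?e q) * indicator {0<..<r} s \<partial>hyperplane_coords b \<partial>lborel)"
    unfolding \<Phi>_def indicator_def mem_ball dist_0_norm by (rule P.Fubini'[symmetric]) measurable
  also have "\<dots> = (\<integral>\<^sup>+s. nn_sphere_integral f s * indicator {0<..<r} s \<partial>lborel)"
  proof (intro nn_integral_cong)
    fix s :: real
    have [measurable]: "ball (0::'a) s \<in> sets borel" by simp
    show "(\<integral>\<^sup>+q. \<Phi> s (?e q) * indicator {0<..<r} s \<partial>hyperplane_coords b) = nn_sphere_integral f s * indicator {0<..<r} s"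
      unfolding nn_sphere_integral_def Let_def b_def[symmetric] \<Phi>_def h_def
      by (rule nn_integral_multc) measurable
  qed
  finally show ?thesis .
qed

lemma measure_ball_scale:
  assumes "r > 0"
  shows "measure lborel (ball (x::'a::euclidean_space) r) = r ^ DIM('a) * measure lborel (ball (0::'a) 1)"
proof -
  have [measurable]: "ball x r \<in> sets borel" by simp
  have "emeasure lborel (ball x r) = (\<integral>\<^sup>+y. indicator (ball x r) y \<partial>lborel)" by simp
  also have "\<dots> = ennreal (r ^ DIM('a)) * (\<integral>\<^sup>+y. indicator (ball x r) (x + r *\<^sub>R y) \<partial>lborel)"
    using assms by (intro nn_integral_lborel_scale) measurable
  also have "(\<integral>\<^sup>+y. indicator (ball x r) (x + r *\<^sub>R y) \<partial>lborel) = (\<integral>\<^sup>+y. indicator (ball (0::'a) 1) y \<partial>lborel)"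
    using assms by (intro nn_integral_cong) (auto simp: dist_norm split: split_indicator)
  also have "\<dots> = emeasure lborel (ball (0::'a) 1)" by simp
  finally show ?thesis
    using assms by (simp add: measure_def enn2real_mult)
qed

lemma measure_unit_ball_pos: "measure lborel (ball (0::'a::euclidean_space) 1) > 0"
  using content_ball_pos[of 1 "0::'a"] by (simp add: measure_completion)

lemma nn_sphere_integral_1_scale:
  assumes s: "s > 0"
  shows "nn_sphere_integral (\<lambda>_::'a::euclidean_space. 1) s = ennreal (s ^ (DIM('a) - 1)) * nn_sphere_integral (\<lambda>_::'a. 1) 1"
proof -
  define b where "b = (SOME b. b \<in> (Basis :: 'a set))"
  have b: "b \<in> Basis" unfolding b_def by (rule some_Basis)
  define F where "F s p = 2 * ennreal (s / sqrt (s\<^sup>2 - (norm p)\<^sup>2)) * indicator (ball 0 s) p" for s :: real and p :: 'a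
  have [measurable]: "F s \<in> borel_measurable borel"
    unfolding F_def indicator_def mem_ball by measurable
  have F: "F s (s *\<^sub>R p) = F 1 p" for p
  proof -
    have "s\<^sup>2 - (norm (s *\<^sub>R p))\<^sup>2 = s\<^sup>2 * (1 - (norm p)\<^sup>2)"
      by (simp add: power_mult_distrib algebra_simps)
    then have "s / sqrt (s\<^sup>2 - (norm (s *\<^sub>R p))\<^sup>2) = 1 / sqrt (1\<^sup>2 - (norm p)\<^sup>2)"
      using s by (simp add: real_sqrt_mult)
    moreover have "indicator (ball 0 s) (s *\<^sub>R p) = (indicator (ball 0 1) p :: ennreal)"
      using s by (auto split: split_indicator)
    ultimately show ?thesis unfolding F_def by simp
  qed
  have "nn_sphere_integral (\<lambda>_::'a. 1) s = (\<integral>\<^sup>+q. F s (hyperplane_point b q) \<partial>hyperplane_coords b)" for s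
    unfolding nn_sphere_integral_def Let_def b_def F_def by simp
  then show ?thesis
    using nn_integral_hyperplane_scale[OF b _ s, of "F s"] unfolding F by simp
qed

text \<open>The area is not computed from its defining integral. Scaling reduces it to the unit
  sphere, and polar coordinates for the constant 1 give V = area * (integral of s^(m-1) over (0,1))
  = area / m.\<close>

lemma nn_sphere_integral_1:
  assumes s: "s > 0"
  shows "nn_sphere_integral (\<lambda>_::'a::euclidean_space. 1) s
    = ennreal (real DIM('a) * s ^ (DIM('a) - 1) * measure lborel (ball (0::'a) 1))"
proof -
  define m where "m = DIM('a)"
  have m: "m > 0" by (simp add: m_def)
  let ?S = "nn_sphere_integral (\<lambda>_::'a. 1)"
  have fin: "emeasure lborel (ball (0::'a) 1) = ennreal (measure lborel (ball (0::'a) 1))"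
    by (rule emeasure_eq_ennreal_measure) (use emeasure_lborel_ball_finite[of "0::'a" 1] in auto)
  have "(\<integral>\<^sup>+s. ennreal (s ^ (m - 1)) * indicator {0..1} s \<partial>lborel) = ennreal (1 ^ m / m - 0 ^ m / m)"
  proof (rule nn_integral_FTC_Icc)
    fix x :: real
    show "((\<lambda>x. x ^ m / real m) has_real_derivative x ^ (m - 1)) (at x)"
      using m by (auto intro!: derivative_eq_intros)
  qed auto
  also have "\<dots> = ennreal (1 / m)" using m by (simp add: power_0_left)
  finally have I: "(\<integral>\<^sup>+s. ennreal (s ^ (m - 1)) * indicator {0..1} s \<partial>lborel) = ennreal (1 / m)" .
  have "emeasure lborel (ball (0::'a) 1) = (\<integral>\<^sup>+y. (\<lambda>_. 1) y * indicator (ball (0::'a) 1) y \<partial>lborel)" by simp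
  also have "\<dots> = (\<integral>\<^sup>+s. ?S s * indicator {0<..<1} s \<partial>lborel)"
    by (rule nn_integral_polar) auto
  also have "\<dots> = (\<integral>\<^sup>+s. ennreal (s ^ (m - 1)) * indicator {0..1} s * ?S 1 \<partial>lborel)"
  proof (rule nn_integral_cong_AE)
    show "AE s in lborel. ?S s * indicator {0<..<1} s = ennreal (s ^ (m - 1)) * indicator {0..1} s * ?S 1"
      using AE_lborel_singleton[of "0::real"] AE_lborel_singleton[of "1::real"]
    proof eventually_elim
      case (elim s)
      then show ?case
        using nn_sphere_integral_1_scale[of s, where 'a='a] by (cases "s \<in> {0<..<1}") (auto simp: m_def)
    qed
  qed
  also have "\<dots> = ennreal (1 / m) * ?S 1"
    unfolding I[symmetric] by (rule nn_integral_multc) measurable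
  finally have "ennreal (real m) * ennreal (measure lborel (ball (0::'a) 1)) = ennreal (real m) * (ennreal (1 / m) * ?S 1)"
    unfolding fin by simp
  also have "\<dots> = ?S 1" using m by (simp add: mult.assoc[symmetric] ennreal_mult'[symmetric])
  finally have "?S 1 = ennreal (real m * measure lborel (ball (0::'a) 1))"
    by (simp add: ennreal_mult)
  then show ?thesis
    unfolding nn_sphere_integral_1_scale[OF s, where 'a='a] using s
    by (simp add: m_def ennreal_mult'[symmetric] mult_ac)
qed

section \<open>Sphere integrals of real functions and integration over balls\<close>

lemma sphere_integral_as_coords:
  fixes f :: "'a::euclidean_space \<Rightarrow> real"
  assumes [measurable]: "f \<in> borel_measurable borel"
  defines "b \<equiv> (SOME b. b \<in> (Basis :: 'a set))"
  shows "sphere_integral f x s = (LINT q|hyperplane_coords b.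
    (\<lambda>p. indicat_real (ball 0 s) p * ((f (x + p + sqrt (s\<^sup>2 - (norm p)\<^sup>2) *\<^sub>R b) + f (x + p - sqrt (s\<^sup>2 - (norm p)\<^sup>2) *\<^sub>R b))
       * (s / sqrt (s\<^sup>2 - (norm p)\<^sup>2)))) (hyperplane_point b q))"
proof -
  have [measurable]: "ball (0::'a) s \<in> sets borel" by simp
  show ?thesis
    unfolding sphere_integral_def Let_def b_def[symmetric] set_lebesgue_integral_def hyperplane_lborel_def
    by (subst integral_distr) (auto simp del: mem_ball)
qed

text \<open>When the integral is infinite both sides are 0, by the conventions for the Bochner
  integral and for \<open>enn2real\<close>.\<close>

lemma sphere_integral_nonneg_nn:
  fixes f :: "'a::euclidean_space \<Rightarrow> real"
  assumes [measurable]: "f \<in> borel_measurable borel" and f: "\<And>y. 0 \<le> f y"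
  shows "sphere_integral f x s = enn2real (nn_sphere_integral (\<lambda>y. ennreal (f (x + y))) s)"
proof -
  define b where "b = (SOME b. b \<in> (Basis :: 'a set))"
  define h where "h p = sqrt (s\<^sup>2 - (norm p)\<^sup>2)" for p :: 'a
  have [measurable]: "ball (0::'a) s \<in> sets borel" "h \<in> borel_measurable borel"
    by (simp_all add: h_def[abs_def])
  let ?T = "\<lambda>p. indicat_real (ball 0 s) p * ((f (x + p + h p *\<^sub>R b) + f (x + p - h p *\<^sub>R b)) * (s / h p))"
  have T0: "0 \<le> ?T p" for p
  proof (cases "norm p < s")
    case True
    moreover have "s \<ge> 0" using norm_ge_zero[of p] True by linarith
    moreover have "h p \<ge> 0" unfolding h_def using True by (simp add: power_mono)
    ultimately show ?thesis
      using f by (auto intro!: divide_nonneg_nonneg mult_nonneg_nonneg add_nonneg_nonneg)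
  qed simp
  have "ennreal ((f y + f z) * c) = (ennreal (f y) + ennreal (f z)) * ennreal c" for y z c
    using f by (simp add: ennreal_mult' ennreal_plus[symmetric] del: ennreal_plus)
  then have T: "ennreal (?T p) = (ennreal (f (x + (p + h p *\<^sub>R b))) + ennreal (f (x + (p - h p *\<^sub>R b))))
      * ennreal (s / h p) * indicator (ball 0 s) p" for p
    by (simp add: indicator_def add_diff_eq add.assoc del: times_divide_eq_right)
  have "(LINT q|hyperplane_coords b. ?T (hyperplane_point b q))
      = enn2real (\<integral>\<^sup>+q. ennreal (?T (hyperplane_point b q)) \<partial>hyperplane_coords b)"
    by (rule integral_eq_nn_integral) (measurable, rule AE_I2, rule T0)
  then show ?thesis
    unfolding sphere_integral_as_coords[OF assms(1)] nn_sphere_integral_def Let_def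
      b_def[symmetric] h_def[symmetric] T .
qed

lemma nn_sphere_integral_mono:
  "(\<And>y. norm y = s \<Longrightarrow> f y \<le> g y) \<Longrightarrow> nn_sphere_integral f s \<le> nn_sphere_integral (g :: 'a::euclidean_space \<Rightarrow> ennreal) s"
proof -
  define b where "b = (SOME b. b \<in> (Basis :: 'a set))"
  have b: "b \<in> Basis" unfolding b_def by (rule some_Basis)
  assume le: "\<And>y. norm y = s \<Longrightarrow> f y \<le> g y"
  show ?thesis
    unfolding nn_sphere_integral_def Let_def b_def[symmetric]
  proof (intro nn_integral_mono)
    fix q
    let ?p = "hyperplane_point b q" and ?t = "sqrt (s\<^sup>2 - (norm (hyperplane_point b q))\<^sup>2)"
    show "(f (?p + ?t *\<^sub>R b) + f (?p - ?t *\<^sub>R b)) * ennreal (s / ?t) * indicator (ball 0 s) ?p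
      \<le> (g (?p + ?t *\<^sub>R b) + g (?p - ?t *\<^sub>R b)) * ennreal (s / ?t) * indicator (ball 0 s) ?p"
      using le[OF norm_hyperplane_point_sphere(1)[OF b, of q s]] le[OF norm_hyperplane_point_sphere(2)[OF b, of q s]]
      by (cases "norm ?p < s") (simp_all add: indicator_def mult_right_mono add_mono)
  qed
qed

lemma continuous_bounded_on_cball:
  fixes f :: "'a::euclidean_space \<Rightarrow> real"
  assumes "continuous_on UNIV f"
  obtains B where "\<And>y. y \<in> cball x r \<Longrightarrow> \<bar>f y\<bar> \<le> B"
proof -
  have "bounded (f ` cball x r)"
    by (intro compact_imp_bounded compact_continuous_image continuous_on_subset[OF assms]) auto
  then obtain B where "\<forall>y\<in>cball x r. \<bar>f y\<bar> \<le> B" unfolding bounded_iff by auto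
  then show thesis using that by blast
qed

text \<open>The weight blows up at the equator, so the integrand has no useful bound; finiteness
  comes from bounding f by a constant and from the finite total area.\<close>

lemma nn_sphere_integral_finite:
  fixes f :: "'a::euclidean_space \<Rightarrow> real"
  assumes f: "continuous_on UNIV f" and s: "s > 0"
  shows "nn_sphere_integral (\<lambda>y. ennreal (f (x + y))) s < \<infinity>"
proof -
  define b where "b = (SOME b. b \<in> (Basis :: 'a set))"
  have [measurable]: "ball (0::'a) s \<in> sets borel" by simp
  obtain B where "\<And>y. y \<in> cball x s \<Longrightarrow> \<bar>f y\<bar> \<le> B"
    using continuous_bounded_on_cball[OF f] by blast
  then have B: "\<And>y. y \<in> cball x s \<Longrightarrow> f y \<le> B" using abs_le_D1 by blast
  have "nn_sphere_integral (\<lambda>y. ennreal (f (x + y))) s \<le> nn_sphere_integral (\<lambda>y::'a. ennreal B) s"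
    by (intro nn_sphere_integral_mono ennreal_leI B) (auto simp: dist_norm)
  also have "\<dots> = (\<integral>\<^sup>+q. ennreal B * ((\<lambda>p. 2 * ennreal (s / sqrt (s\<^sup>2 - (norm p)\<^sup>2)) * indicator (ball 0 s) p)
        (hyperplane_point b q)) \<partial>hyperplane_coords b)"
    unfolding nn_sphere_integral_def Let_def b_def by (simp add: mult_2 distrib_right distrib_left mult.assoc)
  also have "\<dots> = ennreal B * nn_sphere_integral (\<lambda>_::'a. 1) s"
    unfolding nn_sphere_integral_def Let_def b_def
    by (subst nn_integral_cmult) auto
  also have "\<dots> < \<infinity>"
    by (simp add: nn_sphere_integral_1[OF s] ennreal_mult_less_top)
  finally show ?thesis .
qed

lemma sphere_integral_diff:
  fixes f g :: "'a::euclidean_space \<Rightarrow> real"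
  assumes f: "continuous_on UNIV f" and g: "continuous_on UNIV g" and s: "s > 0"
  shows "sphere_integral (\<lambda>y. f y - g y) x s = sphere_integral f x s - sphere_integral g x s"
proof -
  define b where "b = (SOME b. b \<in> (Basis :: 'a set))"
  define T where "T f p = indicat_real (ball 0 s) p * ((f (x + p + sqrt (s\<^sup>2 - (norm p)\<^sup>2) *\<^sub>R b) + f (x + p - sqrt (s\<^sup>2 - (norm p)\<^sup>2) *\<^sub>R b))
       * (s / sqrt (s\<^sup>2 - (norm p)\<^sup>2)))" for f :: "'a \<Rightarrow> real" and p
  have [measurable]: "ball (0::'a) s \<in> sets borel" by simp
  have m: "h \<in> borel_measurable borel" if "continuous_on UNIV h" for h :: "'a \<Rightarrow> real"
    using that by (rule borel_measurable_continuous_onI)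
  have eq: "sphere_integral h x s = (LINT q|hyperplane_coords b. T h (hyperplane_point b q))"
    if "continuous_on UNIV h" for h
    unfolding sphere_integral_as_coords[OF m[OF that]] T_def b_def ..
  have int: "integrable (hyperplane_coords b) (\<lambda>q. T h (hyperplane_point b q))"
    if h: "continuous_on UNIV h" for h
  proof (rule integrableI_bounded)
    note [measurable] = m[OF h]
    show "(\<lambda>q. T h (hyperplane_point b q)) \<in> borel_measurable (hyperplane_coords b)"
      unfolding T_def by measurable
    have "(\<integral>\<^sup>+q. ennreal (norm (T h (hyperplane_point b q))) \<partial>hyperplane_coords b) \<le>
      nn_sphere_integral (\<lambda>y. ennreal \<bar>h (x + y)\<bar>) s"
      unfolding nn_sphere_integral_def Let_def b_def[symmetric]
    proof (rule nn_integral_mono)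
      fix q
      let ?p = "hyperplane_point b q" and ?t = "sqrt (s\<^sup>2 - (norm (hyperplane_point b q))\<^sup>2)"
      show "ennreal (norm (T h ?p)) \<le> (ennreal \<bar>h (x + (?p + ?t *\<^sub>R b))\<bar> + ennreal \<bar>h (x + (?p - ?t *\<^sub>R b))\<bar>) *
         ennreal (s / ?t) * indicator (ball 0 s) ?p"
      proof (cases "norm ?p < s")
        case True
        then have "(norm ?p)\<^sup>2 \<le> s\<^sup>2" by (intro power_mono) auto
        then have c: "s / ?t \<ge> 0" using s by (intro divide_nonneg_nonneg) auto
        have "norm (T h ?p) = \<bar>h (x + (?p + ?t *\<^sub>R b)) + h (x + (?p - ?t *\<^sub>R b))\<bar> * (s / ?t)"
          using True c s by (simp add: T_def abs_mult add.assoc add_diff_eq)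
        also have "\<dots> \<le> (\<bar>h (x + (?p + ?t *\<^sub>R b))\<bar> + \<bar>h (x + (?p - ?t *\<^sub>R b))\<bar>) * (s / ?t)"
          using c by (intro mult_right_mono) auto
        finally have "ennreal (norm (T h ?p)) \<le> ennreal ((\<bar>h (x + (?p + ?t *\<^sub>R b))\<bar> + \<bar>h (x + (?p - ?t *\<^sub>R b))\<bar>) * (s / ?t))"
          by (rule ennreal_leI)
        then show ?thesis
          using True by (simp add: ennreal_mult' ennreal_plus[symmetric] del: ennreal_plus times_divide_eq_right)
      qed (simp add: T_def)
    qed
    also have "\<dots> < \<infinity>"
      using h s by (intro nn_sphere_integral_finite[of "\<lambda>y. \<bar>h y\<bar>"]) (auto intro!: continuous_intros)
    finally show "(\<integral>\<^sup>+q. ennreal (norm (T h (hyperplane_point b q))) \<partial>hyperplane_coords b) < \<infinity>" .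
  qed
  have "T (\<lambda>y. f y - g y) p = T f p - T g p" for p
    unfolding T_def by (simp add: algebra_simps diff_divide_distrib)
  then show ?thesis
    using int[OF f] int[OF g] f g by (simp add: eq continuous_on_diff)
qed

lemma sphere_integral_1:
  assumes "s > 0"
  shows "sphere_integral (\<lambda>_. 1) (x :: 'a::euclidean_space) s = real DIM('a) * s ^ (DIM('a) - 1) * measure lborel (ball (0::'a) 1)"
proof -
  have "sphere_integral (\<lambda>_. 1) x s = enn2real (nn_sphere_integral (\<lambda>y::'a. ennreal 1) s)"
    by (rule sphere_integral_nonneg_nn) auto
  then show ?thesis using assms by (simp add: nn_sphere_integral_1)
qed

lemma ball_integral_polar_nonneg:
  fixes f :: "'a::euclidean_space \<Rightarrow> real"
  assumes f: "continuous_on UNIV f" and f0: "\<And>y. f y \<ge> 0" and r: "r > 0"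
  shows "set_integrable lborel {0<..<r} (sphere_integral f x)"
    and "(LINT y:ball x r|lborel. f y) = (LINT s:{0<..<r}|lborel. sphere_integral f x s)"
proof -
  note [measurable] = borel_measurable_continuous_onI[OF f]
  have [measurable]: "ball x r \<in> sets borel" by simp
  let ?S = "nn_sphere_integral (\<lambda>y. ennreal (f (x + y)))"
  have S: "sphere_integral f x = (\<lambda>s. enn2real (?S s))"
    by (rule ext, rule sphere_integral_nonneg_nn) (auto simp: f0)
  have [measurable]: "sphere_integral f x \<in> borel_measurable borel" unfolding S by measurable
  have e: "ennreal (sphere_integral f x s) = ?S s" if "s > 0" for s
    unfolding S using nn_sphere_integral_finite[OF f that, of x] by (simp add: ennreal_enn2real)
  have "(\<integral>\<^sup>+y. ennreal (indicator (ball x r) y * f y) \<partial>lborel) = ennreal (1 ^ DIM('a)) * (\<integral>\<^sup>+y. ennreal (indicator (ball x r) (x + 1 *\<^sub>R y) * f (x + 1 *\<^sub>R y)) \<partial>lborel)"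
    by (rule nn_integral_lborel_scale[of "\<lambda>y. ennreal (indicator (ball x r) y * f y)"]) auto
  also have "\<dots> = (\<integral>\<^sup>+y. ennreal (f (x + y)) * indicator (ball 0 r) y \<partial>lborel)"
    by (simp, intro nn_integral_cong) (auto simp: dist_norm split: split_indicator)
  also have "\<dots> = (\<integral>\<^sup>+s. ?S s * indicator {0<..<r} s \<partial>lborel)"
    using r by (intro nn_integral_polar) auto
  also have "\<dots> = (\<integral>\<^sup>+s. ennreal (indicator {0<..<r} s * sphere_integral f x s) \<partial>lborel)"
    by (intro nn_integral_cong) (auto simp: e[symmetric] split: split_indicator)
  finally have nn: "(\<integral>\<^sup>+y. ennreal (indicator (ball x r) y * f y) \<partial>lborel) = \<dots>" .
  have sn: "sphere_integral f x s \<ge> 0" for s unfolding S by simp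
  show "(LINT y:ball x r|lborel. f y) = (LINT s:{0<..<r}|lborel. sphere_integral f x s)"
    unfolding set_lebesgue_integral_def real_scaleR_def
    by (subst (1 2) integral_eq_nn_integral) (auto simp: f0 sn nn)
  show "set_integrable lborel {0<..<r} (sphere_integral f x)"
    unfolding set_integrable_def real_scaleR_def
  proof (rule integrableI_nonneg)
    have "integrable lborel (\<lambda>y. indicator (cball x r) y *\<^sub>R f y)"
      by (intro borel_integrable_compact continuous_on_subset[OF f]) auto
    then have "integrable lborel (\<lambda>y. indicator (ball x r) y *\<^sub>R f y)"
      by (rule Bochner_Integration.integrable_bound) (auto simp: f0 split: split_indicator)
    then have "(\<integral>\<^sup>+y. ennreal (indicator (ball x r) y * f y) \<partial>lborel) < \<infinity>"
      using f0 by (auto simp: integrable_iff_bounded abs_mult)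
    then show "(\<integral>\<^sup>+s. ennreal (indicator {0<..<r} s * sphere_integral f x s) \<partial>lborel) < \<infinity>"
      unfolding nn .
  qed (auto simp: sn)
qed

text \<open>Positive and negative parts are treated separately. Continuity of both makes their
  sphere integrals finite for every radius, so they may be subtracted sphere by sphere.\<close>

lemma ball_integral_polar:
  fixes f :: "'a::euclidean_space \<Rightarrow> real"
  assumes f: "continuous_on UNIV f" and r: "r > 0"
  shows "set_integrable lborel {0<..<r} (sphere_integral f x)"
    and "(LINT y:ball x r|lborel. f y) = (LINT s:{0<..<r}|lborel. sphere_integral f x s)"
proof -
  let ?p = "\<lambda>y. max 0 (f y)" and ?n = "\<lambda>y. max 0 (- f y)"
  have c: "continuous_on UNIV ?p" "continuous_on UNIV ?n" using f by (auto intro!: continuous_intros)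
  have d: "f = (\<lambda>y. ?p y - ?n y)" by (auto simp: fun_eq_iff)
  have S: "sphere_integral f x s = sphere_integral ?p x s - sphere_integral ?n x s" if "s > 0" for s
    using sphere_integral_diff[OF c that, of x] d[symmetric] by simp
  note P = ball_integral_polar_nonneg[OF c(1) _ r, of x] and N = ball_integral_polar_nonneg[OF c(2) _ r, of x]
  have i: "set_integrable lborel {0<..<r} (\<lambda>s. sphere_integral ?p x s - sphere_integral ?n x s)"
    by (rule set_integral_diff(1)) (auto intro: P N)
  show "set_integrable lborel {0<..<r} (sphere_integral f x)"
    by (rule set_integrable_cong[OF refl refl, THEN iffD2, OF _ i]) (simp add: S)
  have ib: "set_integrable lborel (ball x r) h" if "continuous_on UNIV h" for h :: "'a \<Rightarrow> real"
  proof -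
    have "set_integrable lborel (cball x r) h" unfolding set_integrable_def
      by (intro borel_integrable_compact continuous_on_subset[OF that]) auto
    then show ?thesis by (rule set_integrable_subset) auto
  qed
  have "(LINT y:ball x r|lborel. f y) = (LINT y:ball x r|lborel. ?p y) - (LINT y:ball x r|lborel. ?n y)"
    by (subst d, rule set_integral_diff(2)) (auto intro: ib c)
  also have "\<dots> = (LINT s:{0<..<r}|lborel. sphere_integral ?p x s) - (LINT s:{0<..<r}|lborel. sphere_integral ?n x s)"
    using P(2) N(2) by simp
  also have "\<dots> = (LINT s:{0<..<r}|lborel. sphere_integral ?p x s - sphere_integral ?n x s)"
    by (rule set_integral_diff(2)[symmetric]) (auto intro: P N)
  also have "\<dots> = (LINT s:{0<..<r}|lborel. sphere_integral f x s)"
    by (rule set_lebesgue_integral_cong) (auto simp: S)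
  finally show "(LINT y:ball x r|lborel. f y) = (LINT s:{0<..<r}|lborel. sphere_integral f x s)" .
qed

subsection \<open>Ball integrals under the Bessel identity\<close>

text \<open>Rescaling to the unit ball keeps the integral meaningful, continuous and even in r
  across r = 0, where it equals V times the value at x. The closed ball is compact, which makes
  continuous functions integrable on it; the sphere is a null set.\<close>

definition cball_integral :: "('a::euclidean_space \<Rightarrow> real) \<Rightarrow> 'a \<Rightarrow> real \<Rightarrow> real" where
  "cball_integral f x r = (LINT h:cball 0 1|lborel. f (x + r *\<^sub>R h))"

lemma set_integrable_continuous_compact:
  fixes f :: "'a::euclidean_space \<Rightarrow> real"
  assumes "continuous_on UNIV f" "compact S"
  shows "set_integrable lborel S f"
  unfolding set_integrable_def
  by (intro borel_integrable_compact assms continuous_on_subset[OF assms(1)]) auto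

lemma continuous_on_comp_UNIV:
  "continuous_on UNIV f \<Longrightarrow> continuous_on S g \<Longrightarrow> continuous_on S (\<lambda>x. f (g x))"
  by (rule continuous_on_compose2) auto

lemma integral_lborel_affine:
  fixes f :: "'a::euclidean_space \<Rightarrow> real"
  assumes [measurable]: "f \<in> borel_measurable borel" and c: "c \<noteq> 0"
  shows "(LINT y|lborel. f y) = \<bar>c\<bar> ^ DIM('a) * (LINT y|lborel. f (x + c *\<^sub>R y))"
proof -
  have "(LINT y|lborel. f y) = (LINT y|density (distr lborel borel (\<lambda>y. x + c *\<^sub>R y)) (\<lambda>_. ennreal (\<bar>c\<bar> ^ DIM('a))). f y)"
    using c by (subst lborel_affine[of c x]) auto
  also have "\<dots> = \<bar>c\<bar> ^ DIM('a) * (LINT y|lborel. f (x + c *\<^sub>R y))"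
    by (simp add: integral_density integral_distr)
  finally show ?thesis .
qed

lemma AE_not_in_sphere: "AE y in lborel. y \<notin> sphere x (r::real)" for x :: "'a::euclidean_space"
proof -
  have "sphere x r \<in> null_sets lborel"
    using negligible_sphere[of x r] closed_sphere[of x r]
    by (simp add: negligible_iff_null_sets null_sets_completion_iff borel_closed)
  then show ?thesis by (rule AE_not_in)
qed

lemma ball_integral_eq_cball_integral:
  fixes f :: "'a::euclidean_space \<Rightarrow> real"
  assumes f: "continuous_on UNIV f" and r: "r > 0"
  shows "(LINT y:ball x r|lborel. f y) = r ^ DIM('a) * cball_integral f x r"
proof -
  note [measurable] = borel_measurable_continuous_onI[OF f]
  have [measurable]: "ball x r \<in> sets borel" "cball x r \<in> sets borel" by simp_all
  have "(LINT y:ball x r|lborel. f y) = (LINT y|lborel. indicator (cball x r) y * f y)"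
    unfolding set_lebesgue_integral_def real_scaleR_def
  proof (rule integral_cong_AE)
    show "AE y in lborel. indicator (ball x r) y * f y = indicator (cball x r) y * f y"
      using AE_not_in_sphere[of x r]
      by eventually_elim (auto simp: sphere_def split: split_indicator)
  qed measurable
  also have "\<dots> = r ^ DIM('a) * (LINT y|lborel. indicator (cball x r) (x + r *\<^sub>R y) * f (x + r *\<^sub>R y))"
    using integral_lborel_affine[of "\<lambda>y. indicator (cball x r) y * f y" r x] r by simp
  also have "(\<lambda>y. indicator (cball x r) (x + r *\<^sub>R y) * f (x + r *\<^sub>R y)) =
      (\<lambda>y. indicator (cball 0 1) y * f (x + r *\<^sub>R y))"
    using r by (auto simp: fun_eq_iff dist_norm split: split_indicator)
  finally show ?thesis by (simp add: cball_integral_def set_lebesgue_integral_def)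
qed

lemma tendsto_LINT_cball:
  fixes f :: "'a::euclidean_space \<Rightarrow> real"
  assumes [measurable]: "\<And>n::nat. F n \<in> borel_measurable borel" "f \<in> borel_measurable borel"
    and w: "continuous_on UNIV w"
    and lim: "\<And>h. norm h \<le> 1 \<Longrightarrow> (\<lambda>n. F n h) \<longlonglongrightarrow> f h"
    and bound: "\<And>n h. norm h \<le> 1 \<Longrightarrow> \<bar>F n h\<bar> \<le> w h"
  shows "(\<lambda>n. LINT h:cball 0 1|lborel. F n h) \<longlonglongrightarrow> (LINT h:cball 0 1|lborel. f h)"
proof -
  have [measurable]: "cball (0::'a) 1 \<in> sets borel" by simp
  show ?thesis
    unfolding set_lebesgue_integral_def
  proof (intro integral_dominated_convergence AE_I2)
    show "integrable lborel (\<lambda>h::'a. indicator (cball 0 1) h *\<^sub>R w h)"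
      by (intro borel_integrable_compact compact_cball continuous_on_subset[OF w]) auto
    fix h :: 'a
    show "(\<lambda>n. indicat_real (cball 0 1) h *\<^sub>R F n h) \<longlonglongrightarrow> indicat_real (cball 0 1) h *\<^sub>R f h"
      using lim[of h] by (cases "norm h \<le> 1") auto
    show "norm (indicat_real (cball 0 1) h *\<^sub>R F n h) \<le> indicator (cball 0 1) h *\<^sub>R w h" for n
      using bound[of h n] by (cases "norm h \<le> 1") auto
  qed measurable
qed

text \<open>Continuity is joint in centre and radius. The weight g is 1 for
  \<open>cball_integral\<close> and a bump in \<open>radial_moment_3_eq_bessel\<close>. Dominated
  convergence applies because a convergent sequence of pairs is bounded, so that all arguments of f
  stay in one ball.\<close>

lemma continuous_on_weighted_cball_integral:
  fixes f g :: "'a::euclidean_space \<Rightarrow> real"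
  assumes f: "continuous_on UNIV f" and g: "continuous_on UNIV g"
  shows "continuous_on UNIV (\<lambda>p. LINT h:cball 0 1|lborel. f (fst p + snd p *\<^sub>R h) * g h)"
proof (intro continuous_at_imp_continuous_on ballI continuous_at_sequentiallyI)
  fix p :: "'a \<times> real" and X assume X: "X \<longlonglongrightarrow> p"
  note [measurable] = borel_measurable_continuous_onI[OF f] borel_measurable_continuous_onI[OF g]
  obtain K where K: "\<And>n. norm (X n) \<le> K"
    using convergent_imp_Bseq[OF convergentI[OF X]] by (auto simp: Bseq_def)
  obtain B where B: "\<And>y. y \<in> cball 0 (K + K) \<Longrightarrow> \<bar>f y\<bar> \<le> B"
    using continuous_bounded_on_cball[OF f] by blast
  show "(\<lambda>n. LINT h:cball 0 1|lborel. f (fst (X n) + snd (X n) *\<^sub>R h) * g h)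
    \<longlonglongrightarrow> (LINT h:cball 0 1|lborel. f (fst p + snd p *\<^sub>R h) * g h)"
  proof (rule tendsto_LINT_cball)
    show "continuous_on UNIV (\<lambda>h. B * \<bar>g h\<bar>)" by (intro continuous_intros g)
    fix h :: 'a assume h: "norm h \<le> 1"
    have "isCont f (fst p + snd p *\<^sub>R h)" using f by (simp add: continuous_on_eq_continuous_at)
    then have "(\<lambda>n. f (fst (X n) + snd (X n) *\<^sub>R h)) \<longlonglongrightarrow> f (fst p + snd p *\<^sub>R h)"
      by (rule isCont_tendsto_compose) (intro tendsto_intros X)
    then show "(\<lambda>n. f (fst (X n) + snd (X n) *\<^sub>R h) * g h) \<longlonglongrightarrow> f (fst p + snd p *\<^sub>R h) * g h"
      by (intro tendsto_intros)
    fix n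
    have "norm (fst (X n) + snd (X n) *\<^sub>R h) \<le> K + K"
    proof (rule norm_triangle_mono)
      show "norm (fst (X n)) \<le> K" using norm_fst_le[of "fst (X n)" "snd (X n)"] K[of n] by simp
      have "\<bar>snd (X n)\<bar> \<le> K" using norm_snd_le[of "snd (X n)" "fst (X n)"] K[of n] by simp
      then show "norm (snd (X n) *\<^sub>R h) \<le> K"
        using h mult_mono[of "\<bar>snd (X n)\<bar>" K "norm h" 1] by auto
    qed
    then show "\<bar>f (fst (X n) + snd (X n) *\<^sub>R h) * g h\<bar> \<le> B * \<bar>g h\<bar>"
      by (auto simp: abs_mult intro!: B mult_right_mono)
  qed measurable
qed

lemma isCont_weighted_cball_integral:
  fixes f g :: "'a::euclidean_space \<Rightarrow> real"
  assumes "continuous_on UNIV f" and "continuous_on UNIV g"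
  shows "isCont (\<lambda>r. LINT h:cball 0 1|lborel. f (x + r *\<^sub>R h) * g h) r"
  using continuous_on_comp_UNIV[OF continuous_on_weighted_cball_integral[OF assms], of UNIV "\<lambda>r. (x, r)"]
  by (simp add: continuous_on_eq_continuous_at continuous_on_Pair)

lemma isCont_cball_integral:
  fixes f :: "'a::euclidean_space \<Rightarrow> real"
  assumes f: "continuous_on UNIV f"
  shows "isCont (cball_integral f x) r"
  using isCont_weighted_cball_integral[OF f, where g = "\<lambda>_. 1" and x = x and r = r] unfolding cball_integral_def[abs_def] by simp

lemma continuous_on_cball_integral:
  fixes f :: "'a::euclidean_space \<Rightarrow> real"
  assumes f: "continuous_on UNIV f"
  shows "continuous_on UNIV (\<lambda>z. cball_integral f z r)"
  using continuous_on_comp_UNIV[OF continuous_on_weighted_cball_integral[OF f, of "\<lambda>_. 1"], of UNIV "\<lambda>z. (z, r)"]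
  by (simp add: cball_integral_def continuous_on_Pair)

lemma measure_cball_eq_ball: "measure lborel (cball x r) = measure lborel (ball (x::'a::euclidean_space) r)"
proof (rule measure_eq_AE)
  show "AE y in lborel. (y \<in> cball x r) = (y \<in> ball x r)"
    using AE_not_in_sphere[of x r] by eventually_elim auto
qed simp_all

lemma cball_integral_0: "cball_integral f x 0 = measure lborel (ball (0::'a::euclidean_space) 1) * f (x::'a)"
proof -
  have "emeasure lborel (cball (0::'a) 1) \<noteq> \<infinity>" using emeasure_lborel_cball_finite[of "0::'a" 1] by auto
  then have "(LINT h:cball (0::'a) 1|lborel. f x) = measure lborel (cball (0::'a) 1) *\<^sub>R f x"
    by (intro set_integral_const) auto
  then show ?thesis by (simp add: cball_integral_def measure_cball_eq_ball)
qed

text \<open>The ball integral A and the comparison function F have the same logarithmic derivative,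
  so A / F is constant. Cancelling the common factor r^m leaves functions continuous at 0, and the
  constant is found there.\<close>

lemma cball_integral_of_bessel_identity:
  fixes v :: "'a::euclidean_space \<Rightarrow> real"
  assumes v: "continuous_on UNIV v" and \<mu>: "\<mu> > 0" and \<rho>: "\<rho> > 0" and D: "DIM('a) \<ge> 2"
    and eq: "\<And>r. 0 < r \<Longrightarrow> r < \<rho> \<Longrightarrow>
           real DIM('a) * bessel_J (real DIM('a) / 2) (\<mu> * r) * sphere_mean v x r
             = \<mu> * r * bessel_J ((real DIM('a) - 2) / 2) (\<mu> * r) * ball_mean v x r"
  defines "\<nu> \<equiv> real DIM('a) / 2"
  shows "\<exists>\<delta>>0. \<forall>r. 0 < r \<and> r < \<delta> \<longrightarrow> cball_integral v x r =
     measure lborel (ball (0::'a) 1) * v x * bessel_series \<nu> (\<mu>\<^sup>2 / 4 * r\<^sup>2) / bessel_series \<nu> 0"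
proof -
  define m where "m = DIM('a)"
  define V where "V = measure lborel (ball (0::'a) 1)"
  have V: "V > 0" unfolding V_def by (rule measure_unit_ball_pos)
  define c where "c = \<mu>\<^sup>2 / 4"
  have c: "c > 0" using \<mu> by (simp add: c_def)
  have m: "m \<ge> 2" "\<nu> = real m / 2" "\<nu> \<ge> 1" using D by (simp_all add: m_def \<nu>_def)
  have m2: "2 * \<nu> = real m" using m by simp
  define j where "j r = bessel_series \<nu> (c * r\<^sup>2)" for r
  define j1 where "j1 r = bessel_series (\<nu> - 1) (c * r\<^sup>2)" for r
  define A where "A r = (LINT y:ball x r|lborel. v y)" for r
  define S where "S = sphere_integral v x"
  have A: "A r = r ^ m * cball_integral v x r" if "r > 0" for r
    unfolding A_def m_def by (rule ball_integral_eq_cball_integral[OF v that])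
  have j0: "j 0 > 0" using m by (simp add: j_def bessel_series_0 rGamma_real_pos)
  have jc: "isCont j r" "isCont j1 r" for r
  proof -
    have q: "isCont (\<lambda>r. c * r\<^sup>2) r" by (intro continuous_intros)
    have "isCont (bessel_series \<nu>) (c * r\<^sup>2)" "isCont (bessel_series (\<nu> - 1)) (c * r\<^sup>2)"
      using m by (auto intro!: isCont_bessel_series)
    then show "isCont j r" "isCont j1 r"
      unfolding j_def[abs_def] j1_def[abs_def] using isCont_o2[OF q] by blast+
  qed
  \<comment> \<open>Where j is positive, the identity can be solved for S and one may divide by
    F.\<close>
  have "eventually (\<lambda>r. j r > 0) (at 0)"
    using jc(1)[of 0] j0 unfolding isCont_def by (intro order_tendstoD(1))
  then obtain d where d: "d > 0" "\<And>r. r \<noteq> 0 \<Longrightarrow> \<bar>r\<bar> < d \<Longrightarrow> j r > 0"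
    unfolding eventually_at by (auto simp: dist_real_def)
  define \<delta> where "\<delta> = min d \<rho>"
  have \<delta>: "\<delta> > 0" using d \<rho> by (simp add: \<delta>_def)
  have jp: "j r > 0" if "0 < r" "r < \<delta>" for r using d(2)[of r] that by (simp add: \<delta>_def)
  have rm: "r ^ m = r * r ^ (m - 1)" for r :: real using m by (simp add: power_eq_if)
  \<comment> \<open>The factors (\<mu> r / 2) powr \<nu> cancel: on the right-hand side the order is
    lower by one, and the explicit \<mu> r makes up for it. The ratio m / r of area to volume
    accounts for the remaining factor.\<close>
  have S: "S r = 2 * j1 r * A r / (r * j r)" if r: "0 < r" "r < \<delta>" for r
  proof -
    have p: "\<mu> * r > 0" using \<mu> r by simp
    define q where "q = (\<mu> * r / 2) powr \<nu>"
    have q: "q > 0" using \<mu> r by (simp add: q_def)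
    have "(\<mu> * r) * (\<mu> * r / 2) powr (\<nu> - 1) = 2 * ((\<mu> * r / 2) * (\<mu> * r / 2) powr (\<nu> - 1))" by simp
    also have "\<dots> = 2 * q" using powr_mult_base[of "\<mu> * r / 2" "\<nu> - 1"] p by (simp add: q_def)
    finally have q1: "\<mu> * r * (\<mu> * r / 2) powr (\<nu> - 1) = 2 * q" .
    have z: "(\<mu> * r)\<^sup>2 / 4 = c * r\<^sup>2" by (simp add: c_def power_mult_distrib)
    have J: "bessel_J \<nu> (\<mu> * r) = q * j r" "bessel_J (\<nu> - 1) (\<mu> * r) = (\<mu> * r / 2) powr (\<nu> - 1) * j1 r"
      using m p by (simp_all add: bessel_J_eq_series z q_def j_def j1_def)
    have n: "(real DIM('a) - 2) / 2 = \<nu> - 1" by (simp add: \<nu>_def diff_divide_distrib)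
    have "real m * bessel_J \<nu> (\<mu> * r) * sphere_mean v x r = \<mu> * r * bessel_J (\<nu> - 1) (\<mu> * r) * ball_mean v x r"
      using eq[of r] r unfolding n m_def \<nu>_def \<delta>_def by simp
    then have "real m * q * j r * sphere_mean v x r = 2 * q * j1 r * ball_mean v x r"
      unfolding J using q1 by (metis mult.assoc)
    then have "real m * j r * sphere_mean v x r = 2 * j1 r * ball_mean v x r"
      using q by simp
    moreover have "sphere_mean v x r = S r / (real m * r ^ (m - 1) * V)"
      unfolding sphere_mean_def S_def m_def V_def sphere_integral_1[OF r(1)] ..
    moreover have "ball_mean v x r = A r / (r * r ^ (m - 1) * V)"
      unfolding ball_mean_def A_def V_def measure_ball_scale[OF r(1), of x] m_def[symmetric] rm ..
    ultimately have e: "j r * S r / (r ^ (m - 1) * V) = 2 * j1 r * A r / r / (r ^ (m - 1) * V)"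
      using m by simp
    have "r ^ (m - 1) * V \<noteq> 0" using V r by simp
    then have "j r * S r = 2 * j1 r * A r / r" using e unfolding divide_cancel_right by blast
    then show ?thesis using jp[OF r] r by (simp add: field_simps)
  qed
  \<comment> \<open>Up to a constant factor this is r powr (m/2) times J_(m/2)(\<mu> r), written
    without \<open>powr\<close>. The recurrence turns its derivative into an expression in j1
    alone.\<close>
  define F where "F r = r ^ m * j r" for r
  have dF: "(F has_real_derivative 2 * r ^ (m - 1) * j1 r) (at r)" for r
  proof -
    let ?J = "bessel_series (\<nu> + 1) (c * r\<^sup>2)"
    have "(j has_real_derivative - ?J * (c * (2 * r))) (at r)"
      unfolding j_def using m
      by (intro DERIV_chain2[OF has_real_derivative_bessel_series]) (auto intro!: derivative_eq_intros)
    from DERIV_mult[OF DERIV_pow[of m r] this]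
    have "(F has_real_derivative real m * r ^ (m - 1) * j r + - ?J * (c * (2 * r)) * r ^ m) (at r)"
      unfolding F_def by simp
    also have "real m * r ^ (m - 1) * j r + - ?J * (c * (2 * r)) * r ^ m = 2 * r ^ (m - 1) * (\<nu> * j r - c * r\<^sup>2 * ?J)"
      unfolding m2[symmetric] rm by (simp add: power2_eq_square algebra_simps)
    also have "\<nu> * j r - c * r\<^sup>2 * ?J = j1 r"
      unfolding j_def j1_def using m by (intro bessel_series_recurrence) simp
    finally show ?thesis .
  qed
  have cA: "isCont A r" if "r > 0" for r
  proof -
    have "isCont (\<lambda>r. r ^ m * cball_integral v x r) r" by (intro continuous_intros isCont_cball_integral v)
    moreover have "\<forall>\<^sub>F s in nhds r. A s = s ^ m * cball_integral v x s"
      unfolding eventually_nhds using that A by (intro exI[of _ "{0<..}"]) auto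
    ultimately show ?thesis using isCont_cong[of A "\<lambda>s. s ^ m * cball_integral v x s" r] by blast
  qed
  have dA: "(A has_real_derivative 2 * j1 r * A r / (r * j r)) (at r)" if r: "0 < r" "r < \<delta>" for r
  proof -
    \<comment> \<open>S is only known to be integrable, so A need not be differentiable a priori.
      The identity expresses S through A itself, which is continuous; G is this continuous
      representative, and the fundamental theorem of calculus applies to it.\<close>
    define G where "G s = 2 * j1 s * A s / (s * j s)" for s
    define a b where "a = r / 2" and "b = (r + \<delta>) / 2"
    have ab: "0 < a" "a < r" "r < b" "b < \<delta>" using r by (simp_all add: a_def b_def)
    have cG: "continuous_on {a..b} G"
      unfolding G_def
    proof (intro continuous_at_imp_continuous_on ballI)
      fix s assume s: "s \<in> {a..b}"
      then have "0 < s" "s < \<delta>" using ab by auto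
      then show "isCont (\<lambda>s. 2 * j1 s * A s / (s * j s)) s"
        using jp[of s] by (intro continuous_intros cA jc) auto
    qed
    have Si: "S integrable_on {0..s}" and As: "A s = integral {0..s} S" if "s > 0" for s
    proof -
      have "set_integrable lborel {0<..<s} S" unfolding S_def by (rule ball_integral_polar[OF v that])
      note * = set_borel_integral_eq_integral[OF this]
      show "S integrable_on {0..s}" using *(1) integrable_on_open_interval[of S 0 s] by simp
      have "A s = integral {0<..<s} S"
        unfolding A_def ball_integral_polar(2)[OF v that] S_def[symmetric] by (rule *(2))
      then show "A s = integral {0..s} S" using integral_open_interval[of 0 s S] by simp
    qed
    have AG: "A s = A a + integral {a..s} G" if s: "s \<in> {a..b}" for s
    proof -
      have "integral {0..a} S + integral {a..s} S = integral {0..s} S"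
        using ab s by (intro Henstock_Kurzweil_Integration.integral_combine Si) auto
      moreover have "integral {a..s} S = integral {a..s} G"
        using ab s by (intro integral_cong) (auto simp: G_def S)
      ultimately show ?thesis using As[of s] As[of a] ab s by simp
    qed
    have "((\<lambda>s. integral {a..s} G) has_real_derivative G r) (at r within {a..b})"
      using ab by (intro integral_has_real_derivative cG) auto
    then have "((\<lambda>s. A a + integral {a..s} G) has_real_derivative G r) (at r within {a..b})"
      by (auto intro!: derivative_eq_intros)
    then have "(A has_real_derivative G r) (at r within {a..b})"
    proof (rule has_field_derivative_transform_within[OF _ zero_less_one])
      show "r \<in> {a..b}" using ab by simp
      show "A a + integral {a..s} G = A s" if "s \<in> {a..b}" for s using AG[OF that] by (rule sym)
    qed
    then show ?thesis
      using ab at_within_interior[of r "{a..b}"] by (simp add: G_def)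
  qed
  have dQ: "((\<lambda>r. A r / F r) has_real_derivative 0) (at r)" if r: "0 < r" "r < \<delta>" for r
  proof -
    have Fn: "F r \<noteq> 0" using jp[OF r] r by (simp add: F_def)
    have "2 * j1 r * A r / (r * j r) * F r - A r * (2 * r ^ (m - 1) * j1 r) = 0"
      unfolding F_def rm using jp[OF r] r by simp
    then show ?thesis
      using DERIV_divide[OF dA[OF r] dF Fn] by simp
  qed
  have "\<exists>K. \<forall>r\<in>{0<..<\<delta>}. A r / F r = K"
  proof (rule has_field_derivative_zero_constant)
    fix r assume "r \<in> {0<..<\<delta>}"
    then show "((\<lambda>r. A r / F r) has_real_derivative 0) (at r within {0<..<\<delta>})"
      by (intro has_field_derivative_at_within[OF dQ]) auto
  qed (rule convex_real_interval)
  then obtain K where K: "\<And>r. 0 < r \<Longrightarrow> r < \<delta> \<Longrightarrow> A r / F r = K" by auto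
  then have K': "cball_integral v x r = K * j r" if "0 < r" "r < \<delta>" for r
  proof -
    have "r ^ m * cball_integral v x r / (r ^ m * j r) = K"
      using K[OF that] A[OF that(1)] by (simp only: F_def)
    then show ?thesis using that jp[OF that] by (simp add: field_simps)
  qed
  \<comment> \<open>The constant is identified in the rescaled form, since A and F both vanish at
    0.\<close>
  have "((\<lambda>r. cball_integral v x r) \<longlongrightarrow> cball_integral v x 0) (at_right 0)"
    using isCont_cball_integral[OF v, where x = x and r = 0] unfolding isCont_def by (rule tendsto_within_subset) simp
  moreover have "((\<lambda>r. K * j r) \<longlongrightarrow> K * j 0) (at_right 0)"
    using tendsto_within_subset[OF jc(1)[of 0, unfolded isCont_def] subset_UNIV]
    by (intro tendsto_mult tendsto_const)
  moreover have "eventually (\<lambda>r. cball_integral v x r = K * j r) (at_right 0)"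
    using eventually_at_right_less[of 0] eventually_at_right_real[OF \<delta>] by eventually_elim (auto simp: K')
  ultimately have "cball_integral v x 0 = K * j 0"
    using tendsto_cong[of "cball_integral v x" "\<lambda>r. K * j r" "at_right 0"]
      tendsto_unique[OF trivial_limit_at_right_real[of "0::real"]] by blast
  then have "K = V * v x / j 0" using j0 by (simp add: cball_integral_0 V_def)
  then show ?thesis
    using K' \<delta> unfolding j_def c_def V_def by (intro exI[of _ \<delta>]) auto
qed

subsection \<open>Second moments of the unit ball\<close>

lemma set_integral_sum:
  fixes f :: "'i \<Rightarrow> 'b \<Rightarrow> real"
  assumes "\<And>i. i \<in> I \<Longrightarrow> set_integrable M A (f i)"
  shows "(LINT x:A|M. \<Sum>i\<in>I. f i x) = (\<Sum>i\<in>I. LINT x:A|M. f i x)"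
  using assms unfolding set_integrable_def set_lebesgue_integral_def scaleR_sum_right
  by (rule Bochner_Integration.integral_sum)

text \<open>On the sphere of radius s the integrand is the constant s^2, so polar coordinates leave
  the integral of m V s^(m+1) over (0,1).\<close>

lemma LINT_cball_norm_sq:
  "(LINT h:cball (0::'a::euclidean_space) 1|lborel. (norm h)\<^sup>2)
     = real DIM('a) * measure lborel (ball (0::'a) 1) / (real DIM('a) + 2)"
proof -
  define m where "m = DIM('a)"
  have m: "m > 0" by (simp add: m_def)
  define V where "V = measure lborel (ball (0::'a) 1)"
  define F where "F x = real m * V / real (m + 2) * x ^ (m + 2)" for x
  define b where "b = (SOME b. b \<in> (Basis :: 'a set))"
  have b: "b \<in> Basis" unfolding b_def by (rule some_Basis)
  let ?f = "\<lambda>h::'a. (norm h)\<^sup>2"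
  have f: "continuous_on UNIV ?f" by (intro continuous_intros)
  have S: "sphere_integral ?f 0 s = real m * V * s ^ (m + 1)" if s: "s > 0" for s
  proof -
    have T: "indicat_real (ball 0 s) p * ((?f (0 + p + sqrt (s\<^sup>2 - (norm p)\<^sup>2) *\<^sub>R b) + ?f (0 + p - sqrt (s\<^sup>2 - (norm p)\<^sup>2) *\<^sub>R b))
       * (s / sqrt (s\<^sup>2 - (norm p)\<^sup>2))) = s\<^sup>2 * (indicat_real (ball 0 s) p * ((1 + 1) * (s / sqrt (s\<^sup>2 - (norm p)\<^sup>2))))"
      if p: "p = hyperplane_point b q" for p q
    proof (cases "norm p < s")
      case True
      from norm_hyperplane_point_sphere[OF b True[unfolded p], folded p]
      have "(norm (p + sqrt (s\<^sup>2 - (norm p)\<^sup>2) *\<^sub>R b))\<^sup>2 = s\<^sup>2" "(norm (p - sqrt (s\<^sup>2 - (norm p)\<^sup>2) *\<^sub>R b))\<^sup>2 = s\<^sup>2"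
        by simp_all
      then show ?thesis unfolding add_0 by (simp only:) (simp add: algebra_simps)
    qed simp
    have "sphere_integral ?f 0 s = s\<^sup>2 * sphere_integral (\<lambda>_. 1) (0::'a) s"
      unfolding sphere_integral_as_coords[OF borel_measurable_continuous_onI[OF f]] b_def[symmetric]
        sphere_integral_as_coords[OF borel_measurable_const]
      by (subst integral_mult_right_zero[symmetric], intro Bochner_Integration.integral_cong refl T[OF refl])
    also have "\<dots> = real m * V * (s\<^sup>2 * s ^ (m - 1))"
      by (simp add: sphere_integral_1[OF s] m_def V_def)
    also have "s\<^sup>2 * s ^ (m - 1) = s ^ (m + 1)" using m by (simp add: power_add[symmetric] del: power_Suc)
    finally show ?thesis .
  qed
  have "(LINT h:cball (0::'a) 1|lborel. ?f h) = (LINT h:ball (0::'a) 1|lborel. ?f h)"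
    unfolding ball_integral_eq_cball_integral[OF f zero_less_one] by (simp add: cball_integral_def)
  also have "\<dots> = (LINT s:{0<..<1}|lborel. sphere_integral ?f 0 s)"
    by (rule ball_integral_polar(2)[OF f]) simp
  also have "\<dots> = (LINT s:{0<..<1}|lborel. real m * V * s ^ (m + 1))"
    by (intro set_lebesgue_integral_cong) (auto simp: S)
  also have "\<dots> = integral {0<..<1} (\<lambda>s. real m * V * s ^ (m + 1))"
  proof (rule set_borel_integral_eq_integral)
    have "set_integrable lborel {0..1} (\<lambda>s. real m * V * s ^ (m + 1))"
      by (intro set_integrable_continuous_compact continuous_intros) auto
    then show "set_integrable lborel {0<..<1} (\<lambda>s. real m * V * s ^ (m + 1))"
      by (rule set_integrable_subset) auto
  qed
  also have "\<dots> = integral {0..1} (\<lambda>s. real m * V * s ^ (m + 1))"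
    using integral_open_interval[of 0 "1::real" "\<lambda>s. real m * V * s ^ (m + 1)"]
    unfolding box_real .
  also have "\<dots> = F 1 - F 0"
  proof (rule integral_unique, rule fundamental_theorem_of_calculus[where f = F])
    fix x :: real
    define N where "N = m + 2"
    have N: "N > 0" "m + 1 = N - Suc 0" by (simp_all add: N_def)
    have "((\<lambda>x. real m * V / real N * x ^ N) has_real_derivative real m * V / real N * (real N * x ^ (N - Suc 0))) (at x within {0..1})"
      by (intro DERIV_cmult DERIV_pow)
    also have "real m * V / real N * (real N * x ^ (N - Suc 0)) = real m * V * x ^ (N - Suc 0)"
      using N(1) by simp
    finally show "(F has_vector_derivative real m * V * x ^ (m + 1)) (at x within {0..1})"
      unfolding has_real_derivative_iff_has_vector_derivative N(2) N_def[symmetric] F_def[abs_def] .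
  qed simp
  finally show ?thesis by (simp add: m_def V_def F_def add.commute)
qed

lemma lborel_reflect_coordinate:
  assumes i: "i \<in> (Basis :: 'a::euclidean_space set)"
  defines "T \<equiv> \<lambda>h::'a. \<Sum>k\<in>Basis. ((if k = i then -1 else 1) * (h \<bullet> k)) *\<^sub>R k"
  shows "distr lborel borel T = lborel"
proof -
  have "(\<Prod>k\<in>(Basis::'a set). \<bar>if k = i then -1 else 1 :: real\<bar>) = 1"
    by (rule prod.neutral) auto
  then show ?thesis
    using lborel_affine_euclidean[of "\<lambda>k. if k = i then -1 else 1" "0::'a"] unfolding T_def
    by (simp add: density_1)
qed

lemma lborel_swap_coordinates:
  assumes i: "i \<in> (Basis :: 'a::euclidean_space set)" and j: "j \<in> Basis"
  defines "T \<equiv> \<lambda>h::'a. \<Sum>k\<in>Basis. (h \<bullet> Transposition.transpose i j k) *\<^sub>R k"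
  shows "distr lborel borel T = lborel"
proof (rule lborel_eqI[symmetric])
  let ?p = "Transposition.transpose i j"
  have p: "?p k \<in> Basis" if "k \<in> Basis" for k using that i j by (auto simp: Transposition.transpose_def)
  have pp: "?p (?p k) = k" for k by simp
  have T: "T h \<bullet> k = h \<bullet> ?p k" if "k \<in> Basis" for h k
    using that by (simp add: T_def inner_sum_left_Basis)
  have bij: "bij_betw ?p Basis Basis"
    by (rule bij_betwI[of _ _ _ ?p]) (use p in auto)
  have m[measurable]: "T \<in> borel \<rightarrow>\<^sub>M borel" unfolding T_def by measurable
  fix l u :: 'a assume le: "\<And>b. b \<in> Basis \<Longrightarrow> l \<bullet> b \<le> u \<bullet> b"
  \<comment> \<open>T is a linear involution permuting the coordinates, so the preimage of a box is
    the box with permuted corners; the volume is a product of the same side lengths.\<close>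
  have "T -` box l u = box (T l) (T u)"
  proof (intro set_eqI iffI)
    fix h assume "h \<in> T -` box l u"
    then have *: "\<And>k. k \<in> Basis \<Longrightarrow> l \<bullet> k < h \<bullet> ?p k \<and> h \<bullet> ?p k < u \<bullet> k" by (auto simp: mem_box T)
    show "h \<in> box (T l) (T u)" using *[OF p] by (auto simp: mem_box T)
  next
    fix h assume "h \<in> box (T l) (T u)"
    then have *: "\<And>k. k \<in> Basis \<Longrightarrow> l \<bullet> ?p k < h \<bullet> k \<and> h \<bullet> k < u \<bullet> ?p k" by (auto simp: mem_box T)
    show "h \<in> T -` box l u" using *[OF p] by (auto simp: mem_box T)
  qed
  then have "emeasure (distr lborel borel T) (box l u) = emeasure lborel (box (T l) (T u))"
    by (simp add: emeasure_distr)
  also have "\<dots> = ennreal (\<Prod>b\<in>Basis. (T u - T l) \<bullet> b)"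
    by (rule emeasure_lborel_box) (auto simp: T le p)
  also have "(\<Prod>b\<in>Basis. (T u - T l) \<bullet> b) = (\<Prod>b\<in>Basis. (u - l) \<bullet> ?p b)"
    by (intro prod.cong) (auto simp: T inner_diff_left)
  also have "\<dots> = (\<Prod>b\<in>Basis. (u - l) \<bullet> b)"
    by (rule prod.reindex_bij_betw[OF bij])
  finally show "emeasure (distr lborel borel T) (box l u) = ennreal (\<Prod>b\<in>Basis. (u - l) \<bullet> b)" .
qed simp

text \<open>The matrix M of second moments is a multiple of the identity: a sign change of one
  coordinate kills the off-diagonal entries, and swapping two coordinates makes the diagonal entries
  equal. The multiple follows from the trace, which is \<open>LINT_cball_norm_sq\<close>.\<close>

lemma LINT_cball_inner_sq:
  fixes x :: "'a::euclidean_space"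
  shows "(LINT h:cball (0::'a) 1|lborel. (x \<bullet> h)\<^sup>2)
     = measure lborel (ball (0::'a) 1) / (real DIM('a) + 2) * (norm x)\<^sup>2"
proof -
  define V where "V = measure lborel (ball (0::'a) 1)"
  define M where "M i j = (LINT h:cball (0::'a) 1|lborel. (h \<bullet> i) * (h \<bullet> j))" for i j
  have [measurable]: "cball (0::'a) 1 \<in> sets borel" by simp
  have si: "set_integrable lborel (cball (0::'a) 1) (\<lambda>h. (h \<bullet> i) * (h \<bullet> j))" for i j
    by (intro set_integrable_continuous_compact continuous_intros) auto
  have inv: "(LINT h:cball (0::'a) 1|lborel. F h) = (LINT h:cball (0::'a) 1|lborel. F (T h))"
    if T: "distr lborel borel T = lborel" and mT[measurable]: "T \<in> borel_measurable borel" and n: "\<And>h. norm (T h) = norm h"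
      and mF[measurable]: "F \<in> borel_measurable borel" for F :: "'a \<Rightarrow> real" and T
  proof -
    have "(LINT h:cball (0::'a) 1|lborel. F h) = (LINT h|distr lborel borel T. indicator (cball 0 1) h * F h)"
      unfolding T set_lebesgue_integral_def by simp
    also have "\<dots> = (LINT h|lborel. indicator (cball 0 1) (T h) * F (T h))"
      by (rule integral_distr) measurable
    also have "(\<lambda>h. indicator (cball 0 1) (T h) * F (T h)) = (\<lambda>h. indicator (cball 0 1) h * F (T h))"
      by (auto simp: fun_eq_iff n split: split_indicator)
    finally show ?thesis by (simp add: set_lebesgue_integral_def)
  qed
  have norm_eq: "norm h = norm g" if "(\<Sum>k\<in>Basis. (h \<bullet> k)\<^sup>2) = (\<Sum>k\<in>Basis. (g \<bullet> k)\<^sup>2)" for h g :: 'a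
    using that unfolding norm_eq_sqrt_inner euclidean_inner[of h h] euclidean_inner[of g g] by (simp add: power2_eq_square)
  have off: "M i j = 0" if ij: "i \<in> Basis" "j \<in> Basis" "i \<noteq> j" for i j
  proof -
    define T where "T = (\<lambda>h::'a. \<Sum>k\<in>Basis. ((if k = i then -1 else 1) * (h \<bullet> k)) *\<^sub>R k)"
    have T: "T h \<bullet> k = (if k = i then -1 else 1) * (h \<bullet> k)" if "k \<in> Basis" for h k
      using that by (simp add: T_def inner_sum_left_Basis)
    have "M i j = (LINT h:cball (0::'a) 1|lborel. (T h \<bullet> i) * (T h \<bullet> j))"
      unfolding M_def
    proof (rule inv)
      show "distr lborel borel T = lborel" unfolding T_def by (rule lborel_reflect_coordinate[OF ij(1)])
      show "norm (T h) = norm h" for h by (rule norm_eq, rule sum.cong) (auto simp: T power_mult_distrib)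
    qed (auto simp: T_def)
    also have "\<dots> = (LINT h:cball (0::'a) 1|lborel. - ((h \<bullet> i) * (h \<bullet> j)))"
      using ij by (simp add: T)
    also have "\<dots> = - M i j" unfolding M_def set_lebesgue_integral_def by simp
    finally show ?thesis by simp
  qed
  have diag: "M i i = M j j" if ij: "i \<in> Basis" "j \<in> Basis" for i j
  proof -
    define T where "T = (\<lambda>h::'a. \<Sum>k\<in>Basis. (h \<bullet> Transposition.transpose i j k) *\<^sub>R k)"
    have T: "T h \<bullet> k = h \<bullet> Transposition.transpose i j k" if "k \<in> Basis" for h k
      using that by (simp add: T_def inner_sum_left_Basis)
    have "bij_betw (Transposition.transpose i j) Basis Basis"
      by (rule bij_betwI[of _ _ _ "Transposition.transpose i j"]) (use ij in \<open>auto simp: Transposition.transpose_def\<close>)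
    note re = sum.reindex_bij_betw[OF this]
    have "M i i = (LINT h:cball (0::'a) 1|lborel. (T h \<bullet> i) * (T h \<bullet> i))"
      unfolding M_def
    proof (rule inv)
      show "distr lborel borel T = lborel" unfolding T_def by (rule lborel_swap_coordinates[OF ij])
      show "norm (T h) = norm h" for h
      proof (rule norm_eq)
        have "(\<Sum>k\<in>Basis. (T h \<bullet> k)\<^sup>2) = (\<Sum>k\<in>Basis. (h \<bullet> Transposition.transpose i j k)\<^sup>2)"
          by (rule sum.cong) (auto simp: T)
        also have "\<dots> = (\<Sum>k\<in>Basis. (h \<bullet> k)\<^sup>2)" by (rule re)
        finally show "(\<Sum>k\<in>Basis. (T h \<bullet> k)\<^sup>2) = (\<Sum>k\<in>Basis. (h \<bullet> k)\<^sup>2)" .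
      qed
    qed (auto simp: T_def)
    also have "\<dots> = M j j" using ij by (simp add: T M_def)
    finally show ?thesis .
  qed
  have trace: "(\<Sum>k\<in>Basis. M k k) = real DIM('a) * V / (real DIM('a) + 2)"
  proof -
    have "(\<Sum>k\<in>Basis. M k k) = (LINT h:cball (0::'a) 1|lborel. (\<Sum>k\<in>Basis. (h \<bullet> k) * (h \<bullet> k)))"
      unfolding M_def by (rule set_integral_sum[symmetric]) (auto intro: si)
    also have "\<dots> = (LINT h:cball (0::'a) 1|lborel. (norm h)\<^sup>2)"
      by (simp add: euclidean_inner[symmetric] power2_norm_eq_inner)
    finally show ?thesis using LINT_cball_norm_sq[where 'a='a] by (simp add: V_def)
  qed
  have M: "M i i = V / (real DIM('a) + 2)" if i: "i \<in> Basis" for i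
  proof -
    have "(\<Sum>k\<in>(Basis::'a set). M k k) = (\<Sum>k\<in>(Basis::'a set). M i i)"
      by (rule sum.cong) (auto intro: diag i)
    then have "real DIM('a) * M i i = real DIM('a) * (V / (real DIM('a) + 2))" using trace by simp
    then show ?thesis using DIM_positive[where 'a='a] unfolding mult_cancel_left by simp
  qed
  have "(LINT h:cball (0::'a) 1|lborel. (x \<bullet> h)\<^sup>2) =
      (LINT h:cball (0::'a) 1|lborel. (\<Sum>i\<in>Basis. \<Sum>j\<in>Basis. (x \<bullet> i) * (x \<bullet> j) * ((h \<bullet> i) * (h \<bullet> j))))"
  proof (intro arg_cong[where f="\<lambda>F. LINT h:cball (0::'a) 1|lborel. F h"] ext)
    fix h
    have "(x \<bullet> h)\<^sup>2 = (\<Sum>i\<in>Basis. (x \<bullet> i) * (h \<bullet> i)) * (\<Sum>j\<in>Basis. (x \<bullet> j) * (h \<bullet> j))"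
      unfolding power2_eq_square euclidean_inner[of x h] ..
    also have "\<dots> = (\<Sum>i\<in>Basis. \<Sum>j\<in>Basis. (x \<bullet> i) * (x \<bullet> j) * ((h \<bullet> i) * (h \<bullet> j)))"
      unfolding sum_product by (intro sum.cong refl) (simp only: mult_ac)
    finally show "(x \<bullet> h)\<^sup>2 = (\<Sum>i\<in>Basis. \<Sum>j\<in>Basis. (x \<bullet> i) * (x \<bullet> j) * ((h \<bullet> i) * (h \<bullet> j)))" .
  qed
  also have "\<dots> = (\<Sum>i\<in>Basis. (LINT h:cball (0::'a) 1|lborel. \<Sum>j\<in>Basis. (x \<bullet> i) * (x \<bullet> j) * ((h \<bullet> i) * (h \<bullet> j))))"
    by (rule set_integral_sum) (auto intro!: set_integrable_continuous_compact continuous_intros)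
  also have "\<dots> = (\<Sum>i\<in>Basis. \<Sum>j\<in>Basis. (LINT h:cball (0::'a) 1|lborel. (x \<bullet> i) * (x \<bullet> j) * ((h \<bullet> i) * (h \<bullet> j))))"
    by (intro sum.cong refl set_integral_sum) (auto intro!: set_integrable_continuous_compact continuous_intros)
  also have "\<dots> = (\<Sum>i\<in>Basis. \<Sum>j\<in>Basis. (x \<bullet> i) * (x \<bullet> j) * M i j)"
    by (simp add: M_def)
  also have "\<dots> = (\<Sum>i\<in>Basis. \<Sum>j\<in>Basis. if j = i then (x \<bullet> i) * (x \<bullet> i) * (V / (real DIM('a) + 2)) else 0)"
    by (intro sum.cong refl) (auto simp: off M)
  also have "\<dots> = (\<Sum>i\<in>Basis. (x \<bullet> i) * (x \<bullet> i) * (V / (real DIM('a) + 2)))"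
    by simp
  also have "\<dots> = V / (real DIM('a) + 2) * (norm x)\<^sup>2"
    unfolding power2_norm_eq_inner euclidean_inner[of x x] sum_distrib_left
    by (intro sum.cong refl) (simp only: mult_ac)
  finally show ?thesis by (simp add: V_def)
qed

subsection \<open>Sup-convolution\<close>

text \<open>The witness is the sup-convolution \<open>w x = sup\<^sub>y (v y - n |x - y|\<^sup>2)\<close> over a ball.\<close>
lemma semiconvex_approximation:
  fixes v :: "'a::euclidean_space \<Rightarrow> real"
  assumes v: "continuous_on UNIV v" and R: "0 \<le> R" "R < R0" and \<omega>: "\<omega> > 0"
  obtains w c where "continuous_on UNIV w" "c \<ge> 0"
    "\<And>z. z \<in> cball 0 R \<Longrightarrow> \<bar>w z - v z\<bar> \<le> \<omega>"
    "\<And>z h. w (z + h) + w (z - h) - 2 * w z \<ge> - c * (norm h)\<^sup>2"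
    "\<And>z. z \<in> cball 0 R \<Longrightarrow> \<exists>y\<in>ball 0 R0. v y \<le> v z + \<omega> \<and>
       (\<exists>\<delta>>0. \<forall>h. norm h < \<delta> \<longrightarrow> v (y + h) - v y \<le> w (z + h) - w z)"
proof -
  define K where "K = cball (0::'a) R0"
  have K: "compact K" "K \<noteq> {}" using R by (auto simp: K_def)
  have vK: "continuous_on K v" using v continuous_on_subset by blast
  obtain M where M: "\<And>y. y \<in> K \<Longrightarrow> \<bar>v y\<bar> \<le> M"
    using continuous_bounded_on_cball[OF v] unfolding K_def by blast
  have M0: "M \<ge> 0" using M[of 0] R by (simp add: K_def)
  have "uniformly_continuous_on K v" using vK K(1) by (rule compact_uniformly_continuous)
  then obtain d where d: "d > 0" "\<And>y z. y \<in> K \<Longrightarrow> z \<in> K \<Longrightarrow> dist y z < d \<Longrightarrow> \<bar>v y - v z\<bar> < \<omega>"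
    unfolding uniformly_continuous_on_def dist_real_def using \<omega> by metis
  \<comment> \<open>Maximisers within d' of z lie both within the modulus of continuity for
    \<open>\<omega>\<close> and in the open ball of radius R0.\<close>
  define d' where "d' = min d (R0 - R)"
  have d': "d' > 0" using d R by (simp add: d'_def)
  \<comment> \<open>The penalty for moving by d' must exceed 2 M, the most that v can gain on K. The
    summand 1 makes this strict, also when M = 0.\<close>
  define n where "n = 2 * M / d'\<^sup>2 + 1"
  have n: "n > 0" using M0 by (simp add: n_def add_nonneg_pos)
  have n2: "2 * M < n * d'\<^sup>2" using d' by (simp add: n_def field_simps)
  define g where "g x y = v y - n * (norm (x - y))\<^sup>2" for x y
  have "\<exists>y\<in>K. \<forall>y'\<in>K. g x y' \<le> g x y" for x
    unfolding g_def by (intro continuous_attains_sup K continuous_intros vK)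
  then obtain Y where Y: "\<And>x. Y x \<in> K" "\<And>x y. y \<in> K \<Longrightarrow> g x y \<le> g x (Y x)" by metis
  define w where "w x = g x (Y x)" for x
  \<comment> \<open>The maximiser for x is used as a competitor at x', which leaves only a
    difference of penalties.\<close>
  have lip: "w x - w x' \<le> n * (norm (x' - x) * (norm x + norm x' + 2 * R0))" for x x'
  proof -
    define y where "y = Y x"
    have y: "norm y \<le> R0" using Y(1)[of x] by (simp add: y_def K_def)
    have "w x - w x' \<le> g x y - g x' y" using Y(2)[OF Y(1)[of x], of x'] by (simp add: w_def y_def)
    also have "\<dots> = n * ((norm (x' - y))\<^sup>2 - (norm (x - y))\<^sup>2)" by (simp add: g_def algebra_simps)
    also have "(norm (x' - y))\<^sup>2 - (norm (x - y))\<^sup>2 = (norm (x' - y) - norm (x - y)) * (norm (x' - y) + norm (x - y))"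
      by (simp add: power2_eq_square algebra_simps)
    also have "\<dots> \<le> norm (x' - x) * (norm (x' - y) + norm (x - y))"
      using norm_triangle_ineq2[of "x' - y" "x - y"] by (intro mult_right_mono) auto
    also have "\<dots> \<le> norm (x' - x) * (norm x + norm x' + 2 * R0)"
      using y norm_triangle_ineq4[of x' y] norm_triangle_ineq4[of x y] by (intro mult_left_mono) auto
    finally show ?thesis using n by simp
  qed
  have lip': "\<bar>w x' - w x\<bar> \<le> n * (norm (x' - x) * (norm x + norm x' + 2 * R0))" for x x'
    using lip[of x x'] lip[of x' x] by (auto simp: abs_le_iff norm_minus_commute add.commute)
  have cw: "continuous_on UNIV w"
  proof (intro continuous_at_imp_continuous_on ballI)
    fix x :: 'a
    have "((\<lambda>x'. n * (norm (x' - x) * (norm x + norm x' + 2 * R0))) \<longlongrightarrow> n * (norm (x - x) * (norm x + norm x + 2 * R0))) (at x)"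
      by (intro tendsto_intros)
    then have "((\<lambda>x'. n * (norm (x' - x) * (norm x + norm x' + 2 * R0))) \<longlongrightarrow> 0) (at x)" by simp
    then have "((\<lambda>x'. w x' - w x) \<longlongrightarrow> 0) (at x)"
      by (rule Lim_null_comparison[rotated]) (simp add: lip' always_eventually)
    then show "isCont w x" unfolding isCont_def by (rule LIM_zero_cancel)
  qed
  have near: "norm (Y z - z) < d' \<and> v z \<le> w z \<and> w z \<le> v (Y z)" if z: "z \<in> cball 0 R" for z
  proof -
    have zK: "z \<in> K" using z R by (simp add: K_def)
    have 1: "v z \<le> w z" using Y(2)[OF zK, of z] by (simp add: w_def g_def)
    have 2: "w z = v (Y z) - n * (norm (z - Y z))\<^sup>2" by (simp add: w_def g_def)
    have "n * (norm (z - Y z))\<^sup>2 \<le> v (Y z) - v z" using 1 2 by simp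
    also have "\<dots> \<le> 2 * M" using M[OF Y(1)[of z]] M[OF zK] by linarith
    also have "\<dots> < n * d'\<^sup>2" by (rule n2)
    finally have "(norm (z - Y z))\<^sup>2 < d'\<^sup>2" using n by simp
    then have "norm (z - Y z) < d'" using d' by (intro power2_less_imp_less[of _ d']) auto
    moreover have "n * (norm (z - Y z))\<^sup>2 \<ge> 0" using n by simp
    ultimately show ?thesis using 1 2 by (simp add: norm_minus_commute)
  qed
  have nearv: "\<bar>v (Y z) - v z\<bar> < \<omega>" if z: "z \<in> cball 0 R" for z
    using near[OF z] z R by (intro d(2) Y(1)) (auto simp: K_def d'_def dist_norm)
  show thesis
  proof (rule that[of w "2 * n"])
    show "continuous_on UNIV w" by (rule cw)
    show "0 \<le> 2 * n" using n by simp
    show "\<bar>w z - v z\<bar> \<le> \<omega>" if "z \<in> cball 0 R" for z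
      using near[OF that] nearv[OF that] by auto
    show "w (z + h) + w (z - h) - 2 * w z \<ge> - (2 * n) * (norm h)\<^sup>2" for z h
    proof -
      \<comment> \<open>The maximiser for z competes at both z + h and z - h. By the parallelogram
        law the two penalties add up to 2 |z - y|^2 + 2 |h|^2, whence the constant 2 n.\<close>
      let ?y = "Y z"
      have e: "(norm (z + h - ?y))\<^sup>2 + (norm (z - h - ?y))\<^sup>2 = 2 * (norm (z - ?y))\<^sup>2 + 2 * (norm h)\<^sup>2"
        by (simp add: power2_norm_eq_inner inner_diff_left inner_diff_right inner_add_left inner_add_right inner_commute)
      have "g (z + h) ?y + g (z - h) ?y = 2 * v ?y - n * ((norm (z + h - ?y))\<^sup>2 + (norm (z - h - ?y))\<^sup>2)"
        unfolding g_def distrib_left by linarith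
      also have "\<dots> = 2 * w z - 2 * n * (norm h)\<^sup>2"
        unfolding e w_def g_def by (simp add: distrib_left)
      finally have "g (z + h) ?y + g (z - h) ?y = 2 * w z - 2 * n * (norm h)\<^sup>2" .
      moreover have "w (z + h) \<ge> g (z + h) ?y" "w (z - h) \<ge> g (z - h) ?y" unfolding w_def by (intro Y)+
      ultimately show ?thesis by simp
    qed
    show "\<exists>y\<in>ball 0 R0. v y \<le> v z + \<omega> \<and>
       (\<exists>\<delta>>0. \<forall>h. norm h < \<delta> \<longrightarrow> v (y + h) - v y \<le> w (z + h) - w z)" if z: "z \<in> cball 0 R" for z
    proof (intro bexI conjI exI allI impI)
      have "norm (Y z) \<le> norm (Y z - z) + norm z" using norm_triangle_sub[of "Y z" z] by linarith
      also have "\<dots> < R0" using near[OF z] z by (simp add: d'_def)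
      finally have y: "norm (Y z) < R0" .
      then show "Y z \<in> ball 0 R0" by simp
      show "v (Y z) \<le> v z + \<omega>" using nearv[OF z] by linarith
      show "R0 - norm (Y z) > 0" using y by simp
      fix h :: 'a assume h: "norm h < R0 - norm (Y z)"
      \<comment> \<open>Moving z and its maximiser by the same h leaves the penalty unchanged, so
        increments of v at the maximiser are bounded by those of w at z, as long as the moved point
        is still in K.\<close>
      have "Y z + h \<in> K" unfolding K_def using h norm_triangle_ineq[of "Y z" h] by simp
      then have "g (z + h) (Y z + h) \<le> w (z + h)" unfolding w_def by (rule Y)
      then show "v (Y z + h) - v (Y z) \<le> w (z + h) - w z"
        by (simp add: w_def g_def)
    qed
  qed
qed

section \<open>Symmetry in the radius and second differences\<close>

lemma cball_integral_minus:
  fixes f :: "'a::euclidean_space \<Rightarrow> real"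
  assumes f: "continuous_on UNIV f"
  shows "cball_integral f x (- r) = cball_integral f x r"
proof -
  note [measurable] = borel_measurable_continuous_onI[OF f]
  have [measurable]: "cball (0::'a) 1 \<in> sets borel" by simp
  have i: "indicator (cball 0 1) (0 + (-1) *\<^sub>R h) = (indicator (cball 0 1) h :: real)" for h :: 'a
    by (auto split: split_indicator)
  have "(LINT h|lborel. indicator (cball 0 1) h * f (x + (- r) *\<^sub>R h)) =
     \<bar>-1\<bar> ^ DIM('a) * (LINT h|lborel. indicator (cball 0 1) (0 + (-1) *\<^sub>R h) * f (x + (- r) *\<^sub>R (0 + (-1) *\<^sub>R h)))"
    by (rule integral_lborel_affine) auto
  then show ?thesis unfolding i cball_integral_def set_lebesgue_integral_def by simp
qed

lemma set_integrable_cball_shift: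
  fixes f :: "'a::euclidean_space \<Rightarrow> real"
  assumes f: "continuous_on UNIV f"
  shows "set_integrable lborel (cball 0 1) (\<lambda>h. f (x + r *\<^sub>R h))"
  by (intro set_integrable_continuous_compact continuous_on_comp_UNIV[OF f] continuous_intros) auto

lemma LINT_cball_const: "(LINT h:cball (0::'a::euclidean_space) 1|lborel. (k::real)) = measure lborel (ball (0::'a) 1) * k"
  using cball_integral_0[of "\<lambda>_::'a. k"] by (simp add: cball_integral_def)

lemma set_integrable_cball_const: "set_integrable lborel (cball (0::'a::euclidean_space) 1) (\<lambda>_. k::real)"
  by (intro set_integrable_continuous_compact continuous_intros) auto

lemma cball_integral_minus_const:
  fixes f :: "'a::euclidean_space \<Rightarrow> real"
  assumes f: "continuous_on UNIV f"
  shows "cball_integral f x r - measure lborel (ball (0::'a) 1) * k = (LINT h:cball 0 1|lborel. f (x + r *\<^sub>R h) - k)"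
  unfolding cball_integral_def LINT_cball_const[symmetric]
  by (rule set_integral_diff(2)[symmetric]) (auto intro: set_integrable_cball_shift f set_integrable_cball_const)

text \<open>By evenness in r the first difference may be averaged with the one for -r. This yields a
  symmetric second difference, to which semiconvexity or a Taylor estimate applies.\<close>

lemma cball_integral_second_difference:
  fixes f :: "'a::euclidean_space \<Rightarrow> real"
  assumes f: "continuous_on UNIV f"
  shows "cball_integral f x r - measure lborel (ball (0::'a) 1) * f x
     = (LINT h:cball 0 1|lborel. f (x + r *\<^sub>R h) + f (x - r *\<^sub>R h) - 2 * f x) / 2"
proof -
  let ?V = "measure lborel (ball (0::'a) 1)"
  have "(LINT h:cball 0 1|lborel. f (x + r *\<^sub>R h) - f x) + (LINT h:cball 0 1|lborel. f (x + (-r) *\<^sub>R h) - f x)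
     = (LINT h:cball 0 1|lborel. (f (x + r *\<^sub>R h) - f x) + (f (x + (-r) *\<^sub>R h) - f x))"
    by (rule set_integral_add(2)[symmetric])
      (auto intro!: set_integral_diff(1) set_integrable_cball_shift continuous_on_diff f continuous_on_const simp del: scaleR_minus_left)
  moreover have "(\<lambda>h. (f (x + r *\<^sub>R h) - f x) + (f (x + (-r) *\<^sub>R h) - f x)) = (\<lambda>h. f (x + r *\<^sub>R h) + f (x - r *\<^sub>R h) - 2 * f x)"
    by (auto simp: fun_eq_iff)
  ultimately have "(cball_integral f x r - ?V * f x) + (cball_integral f x (-r) - ?V * f x)
     = (LINT h:cball 0 1|lborel. f (x + r *\<^sub>R h) + f (x - r *\<^sub>R h) - 2 * f x)"
    unfolding cball_integral_minus_const[OF f, symmetric] by simp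
  then show ?thesis unfolding cball_integral_minus[OF f] by linarith
qed

subsection \<open>The weak inequality\<close>

text \<open>Ball averaging is self-adjoint: after Fubini, the translation z to z - r h moves the
  average to the other function with radius -r, and evenness restores r. The bounded support of f
  confines both double integrals to compact sets.\<close>

lemma integral_cball_integral_commute:
  fixes f g :: "'a::euclidean_space \<Rightarrow> real"
  assumes f: "continuous_on UNIV f" and g: "continuous_on UNIV g"
    and f0: "\<And>z. norm z > R \<Longrightarrow> f z = 0"
  shows "(LINT z|lborel. f z * cball_integral g z r) = (LINT z|lborel. g z * cball_integral f z r)"
proof -
  note [measurable] = borel_measurable_continuous_onI[OF f] borel_measurable_continuous_onI[OF g]
  let ?B = "cball (0::'a) 1"
  have [measurable]: "?B \<in> sets borel" by simp
  have i1: "integrable (lborel \<Otimes>\<^sub>M lborel) (\<lambda>(z, h). indicator ?B h * (f z * g (z + r *\<^sub>R h)))"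
  proof -
    have "integrable lborel (\<lambda>p::'a \<times> 'a. indicator (cball 0 R \<times> ?B) p *\<^sub>R (f (fst p) * g (fst p + r *\<^sub>R snd p)))"
      by (intro borel_integrable_compact compact_Times compact_cball continuous_intros
          continuous_on_comp_UNIV[OF f] continuous_on_comp_UNIV[OF g])
    moreover have "(\<lambda>p::'a \<times> 'a. indicator (cball 0 R \<times> ?B) p *\<^sub>R (f (fst p) * g (fst p + r *\<^sub>R snd p)))
       = (\<lambda>(z, h). indicator ?B h * (f z * g (z + r *\<^sub>R h)))"
      using f0 by (auto simp: fun_eq_iff indicator_def not_le)
    ultimately show ?thesis by (simp add: lborel_prod)
  qed
  have i2: "integrable (lborel \<Otimes>\<^sub>M lborel) (\<lambda>(z, h). indicator ?B h * (f (z - r *\<^sub>R h) * g z))"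
  proof -
    have "integrable lborel (\<lambda>p::'a \<times> 'a. indicator (cball 0 (R + \<bar>r\<bar>) \<times> ?B) p *\<^sub>R (f (fst p - r *\<^sub>R snd p) * g (fst p)))"
      by (intro borel_integrable_compact compact_Times compact_cball continuous_intros
          continuous_on_comp_UNIV[OF f] continuous_on_comp_UNIV[OF g])
    moreover have "indicator (cball 0 (R + \<bar>r\<bar>) \<times> ?B) (z, h) *\<^sub>R (f (z - r *\<^sub>R h) * g z)
       = indicator ?B h * (f (z - r *\<^sub>R h) * g z)" for z h :: 'a
    proof (cases "norm h \<le> 1 \<and> norm z > R + \<bar>r\<bar>")
      case True
      have "norm z \<le> norm (z - r *\<^sub>R h) + norm (r *\<^sub>R h)" using norm_triangle_sub[of z "r *\<^sub>R h"] by simp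
      moreover have "norm (r *\<^sub>R h) \<le> \<bar>r\<bar>" using True mult_left_mono[of "norm h" 1 "\<bar>r\<bar>"] by simp
      ultimately have "norm (z - r *\<^sub>R h) > R" using True by linarith
      then show ?thesis using f0 by simp
    qed (auto simp: indicator_def)
    then have "(\<lambda>p::'a \<times> 'a. indicator (cball 0 (R + \<bar>r\<bar>) \<times> ?B) p *\<^sub>R (f (fst p - r *\<^sub>R snd p) * g (fst p)))
       = (\<lambda>(z, h). indicator ?B h * (f (z - r *\<^sub>R h) * g z))"
      by (auto simp: fun_eq_iff)
    ultimately show ?thesis by (simp add: lborel_prod)
  qed
  have "(LINT z|lborel. f z * cball_integral g z r) = (LINT z|lborel. LINT h|lborel. indicator ?B h * (f z * g (z + r *\<^sub>R h)))"
    unfolding cball_integral_def set_lebesgue_integral_def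
    by (subst integral_mult_right_zero[symmetric]) (simp add: mult_ac)
  also have "\<dots> = (LINT h|lborel. LINT z|lborel. indicator ?B h * (f z * g (z + r *\<^sub>R h)))"
    using lborel_pair.Fubini_integral[OF i1] by simp
  also have "\<dots> = (LINT h|lborel. LINT z|lborel. indicator ?B h * (f (z - r *\<^sub>R h) * g z))"
  proof (rule Bochner_Integration.integral_cong[OF refl])
    fix h
    have "(LINT z|lborel. indicator ?B h * (f z * g (z + r *\<^sub>R h))) = \<bar>1\<bar> ^ DIM('a) *
      (LINT z|lborel. indicator ?B h * (f (- (r *\<^sub>R h) + 1 *\<^sub>R z) * g (- (r *\<^sub>R h) + 1 *\<^sub>R z + r *\<^sub>R h)))"
      by (rule integral_lborel_affine) auto
    then show "(LINT z|lborel. indicator ?B h * (f z * g (z + r *\<^sub>R h))) = (LINT z|lborel. indicator ?B h * (f (z - r *\<^sub>R h) * g z))"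
      by simp
  qed
  also have "\<dots> = (LINT z|lborel. LINT h|lborel. indicator ?B h * (f (z - r *\<^sub>R h) * g z))"
    using lborel_pair.Fubini_integral[OF i2] by simp
  also have "\<dots> = (LINT z|lborel. g z * cball_integral f z (- r))"
    unfolding cball_integral_def set_lebesgue_integral_def
    by (subst integral_mult_right_zero[symmetric]) (simp add: mult_ac)
  finally show ?thesis by (simp add: cball_integral_minus[OF f])
qed

lemma integrable_compact_support:
  fixes f :: "'a::euclidean_space \<Rightarrow> real"
  assumes "continuous_on UNIV f" and "\<And>z. norm z > R \<Longrightarrow> f z = 0"
  shows "integrable lborel f"
proof -
  have "integrable lborel (\<lambda>z. indicator (cball 0 R) z *\<^sub>R f z)"
    by (intro borel_integrable_compact compact_cball continuous_on_subset[OF assms(1)]) auto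
  moreover have "(\<lambda>z. indicator (cball 0 R) z *\<^sub>R f z) = f"
    using assms(2) by (auto simp: fun_eq_iff indicator_def not_le)
  ultimately show ?thesis by simp
qed

text \<open>Self-adjointness moves the difference quotient from w, where no upper bound is
  available, to \<phi>, where C dominates it.\<close>

lemma tendsto_integral_cball_difference:
  fixes w \<phi> \<psi> :: "'a::euclidean_space \<Rightarrow> real"
  assumes w: "continuous_on UNIV w" and \<phi>: "continuous_on UNIV \<phi>" and \<psi>: "continuous_on UNIV \<psi>"
    and supp: "\<And>z. norm z > R \<Longrightarrow> \<phi> z = 0"
    and V: "V = measure lborel (ball (0::'a) 1)"
    and bound: "\<And>z r. \<bar>cball_integral \<phi> z r - V * \<phi> z\<bar> \<le> C * r\<^sup>2"
    and lim: "\<And>z. ((\<lambda>r. (cball_integral \<phi> z r - V * \<phi> z) / r\<^sup>2) \<longlongrightarrow> \<psi> z) (at_right 0)"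
    and X: "\<And>n. 0 < X n" "\<And>n. X n \<le> 1" "X \<longlonglongrightarrow> 0"
  shows "(\<lambda>n. LINT z|lborel. \<phi> z * ((cball_integral w z (X n) - V * w z) / (X n)\<^sup>2))
     \<longlonglongrightarrow> (LINT z|lborel. w z * \<psi> z)"
proof -
  note [measurable] = borel_measurable_continuous_onI[OF w] borel_measurable_continuous_onI[OF \<phi>]
    borel_measurable_continuous_onI[OF \<psi>] borel_measurable_continuous_onI[OF continuous_on_cball_integral[OF \<phi>]]
  have ev: "filterlim X (at_right 0) sequentially"
    using X by (intro filterlim_at_withinI) (auto intro!: always_eventually)
  \<comment> \<open>Radii up to 1 enlarge the support of \<phi> by at most 1, so that one ball of
    radius R + 1 serves for the whole sequence.\<close>
  have far: "cball_integral \<phi> z r = 0" if z: "norm z > R + 1" and r: "0 < r" "r \<le> 1" for z r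
  proof -
    have "\<phi> (z + r *\<^sub>R h) = 0" if "h \<in> cball 0 1" for h
    proof (rule supp)
      have "norm (r *\<^sub>R h) \<le> 1" using that r mult_mono[of r 1 "norm h" 1] by simp
      moreover have "norm z \<le> norm (z + r *\<^sub>R h) + norm (r *\<^sub>R h)"
        using norm_triangle_ineq4[of "z + r *\<^sub>R h" "r *\<^sub>R h"] by simp
      ultimately show "norm (z + r *\<^sub>R h) > R" using z by linarith
    qed
    then have "cball_integral \<phi> z r = (LINT h:cball (0::'a) 1|lborel. 0)"
      unfolding cball_integral_def by (intro set_lebesgue_integral_cong) auto
    then show ?thesis by simp
  qed
  have zero: "\<phi> z = 0" if "norm z > R + 1" for z using that by (intro supp) simp
  have swap: "(LINT z|lborel. \<phi> z * ((cball_integral w z (X n) - V * w z) / (X n)\<^sup>2))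
     = (LINT z|lborel. w z * ((cball_integral \<phi> z (X n) - V * \<phi> z) / (X n)\<^sup>2))" for n
  proof -
    have int: "integrable lborel (\<lambda>z. \<phi> z * cball_integral w z (X n))" "integrable lborel (\<lambda>z. w z * cball_integral \<phi> z (X n))"
       "integrable lborel (\<lambda>z. \<phi> z * w z)"
    proof -
      show "integrable lborel (\<lambda>z. \<phi> z * cball_integral w z (X n))" "integrable lborel (\<lambda>z. \<phi> z * w z)"
        by (rule integrable_compact_support[of _ R];
            (intro continuous_intros continuous_on_cball_integral \<phi> w | simp add: supp))+
      show "integrable lborel (\<lambda>z. w z * cball_integral \<phi> z (X n))"
        by (rule integrable_compact_support[of _ "R + 1"])
          (intro continuous_intros continuous_on_cball_integral \<phi> w, simp add: far X)
    qed
    have "(LINT z|lborel. \<phi> z * cball_integral w z (X n) - V * (\<phi> z * w z)) = (LINT z|lborel. w z * cball_integral \<phi> z (X n) - V * (\<phi> z * w z))"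
      using int integral_cball_integral_commute[OF \<phi> w supp, where r = "X n"] by simp
    then have "(LINT z|lborel. (\<phi> z * cball_integral w z (X n) - V * (\<phi> z * w z)) / (X n)\<^sup>2) = (LINT z|lborel. (w z * cball_integral \<phi> z (X n) - V * (\<phi> z * w z)) / (X n)\<^sup>2)"
      by simp
    then show ?thesis by (simp add: algebra_simps)
  qed
  obtain B where "\<And>y. y \<in> cball 0 (R + 1) \<Longrightarrow> \<bar>w y\<bar> \<le> B"
    using continuous_bounded_on_cball[OF w] by blast
  then have B: "\<bar>w y\<bar> \<le> B" if "norm y \<le> R + 1" for y using that by simp
  show ?thesis
    unfolding swap
  proof (intro integral_dominated_convergence AE_I2)
    show "integrable lborel (\<lambda>z::'a. indicator (cball 0 (R + 1)) z *\<^sub>R (B * C))"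
      by (intro borel_integrable_compact) auto
    fix z
    show "(\<lambda>n. w z * ((cball_integral \<phi> z (X n) - V * \<phi> z) / (X n)\<^sup>2)) \<longlonglongrightarrow> w z * \<psi> z"
      by (intro tendsto_mult tendsto_const filterlim_compose[OF lim ev])
    show "norm (w z * ((cball_integral \<phi> z (X n) - V * \<phi> z) / (X n)\<^sup>2)) \<le> indicat_real (cball 0 (R + 1)) z *\<^sub>R (B * C)" for n
    proof (cases "norm z \<le> R + 1")
      case True
      have "\<bar>(cball_integral \<phi> z (X n) - V * \<phi> z) / (X n)\<^sup>2\<bar> \<le> C"
        using bound[of z "X n"] X(1)[of n] by (simp add: field_simps)
      then have "\<bar>w z\<bar> * \<bar>(cball_integral \<phi> z (X n) - V * \<phi> z) / (X n)\<^sup>2\<bar> \<le> B * C"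
        using B[OF True] by (intro mult_mono) auto
      then show ?thesis using True by (simp add: abs_mult)
    next
      case False
      then show ?thesis using far[of z "X n"] X zero[of z] by simp
    qed
  qed measurable
qed

lemma cball_integral_semiconvex_lower_bound:
  fixes w :: "'a::euclidean_space \<Rightarrow> real"
  assumes w: "continuous_on UNIV w" and c: "c \<ge> 0"
    and sc: "\<And>h. w (z + h) + w (z - h) - 2 * w z \<ge> - c * (norm h)\<^sup>2"
  defines "V \<equiv> measure lborel (ball (0::'a) 1)"
  shows "cball_integral w z r - V * w z \<ge> - (c * V * r\<^sup>2)"
proof -
  have "V * (- c * r\<^sup>2) = (LINT h:cball (0::'a) 1|lborel. - c * r\<^sup>2)"
    by (simp only: LINT_cball_const V_def)
  also have "\<dots> \<le> (LINT h:cball 0 1|lborel. w (z + r *\<^sub>R h) + w (z - r *\<^sub>R h) - 2 * w z)"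
  proof (rule set_integral_mono[OF set_integrable_cball_const])
    show "set_integrable lborel (cball 0 1) (\<lambda>h. w (z + r *\<^sub>R h) + w (z - r *\<^sub>R h) - 2 * w z)"
      by (intro set_integrable_continuous_compact compact_cball continuous_intros continuous_on_comp_UNIV[OF w])
    fix h :: 'a assume "h \<in> cball 0 1"
    then have "(norm h)\<^sup>2 \<le> 1" by (simp add: power_le_one)
    then have "(norm (r *\<^sub>R h))\<^sup>2 \<le> r\<^sup>2"
      using mult_left_mono[of "(norm h)\<^sup>2" 1 "r\<^sup>2"] by (simp add: power_mult_distrib)
    then have "- c * r\<^sup>2 \<le> - c * (norm (r *\<^sub>R h))\<^sup>2" using c by (intro mult_left_mono_neg) auto
    then show "- c * r\<^sup>2 \<le> w (z + r *\<^sub>R h) + w (z - r *\<^sub>R h) - 2 * w z"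
      using sc[of "r *\<^sub>R h"] by linarith
  qed
  also have "\<dots> = 2 * (cball_integral w z r - V * w z)"
    unfolding cball_integral_second_difference[OF w] V_def by simp
  finally have *: "V * (- c * r\<^sup>2) \<le> 2 * (cball_integral w z r - V * w z)" .
  \<comment> \<open>The estimate just obtained has c V r^2 / 2; it is relaxed to the rounder
    constant.\<close>
  have P: "0 \<le> c * V * r\<^sup>2" using c by (simp add: V_def)
  have "- (c * V * r\<^sup>2) \<le> 2 * (cball_integral w z r - V * w z)"
    using * by (simp only: mult_minus_left mult_minus_right mult_ac)
  then show ?thesis using P by argo
qed

text \<open>The pointwise lower limit and the one-sided bound coming from semiconvexity allow to pass to
  the limit as in Fatou's lemma: only the negative parts have to converge dominatedly.\<close>
lemma weak_inequality_approx:
  fixes v w \<phi> \<psi> :: "'a::euclidean_space \<Rightarrow> real"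
  assumes v: "continuous_on UNIV v" and \<phi>: "continuous_on UNIV \<phi>" and \<psi>: "continuous_on UNIV \<psi>"
    and supp: "\<And>z. norm z > R \<Longrightarrow> \<phi> z = 0" and \<phi>0: "\<And>z. \<phi> z \<ge> 0"
    and V: "V = measure lborel (ball (0::'a) 1)" and \<kappa>: "\<kappa> \<ge> 0"
    and bound: "\<And>z r. \<bar>cball_integral \<phi> z r - V * \<phi> z\<bar> \<le> C * r\<^sup>2"
    and lim: "\<And>z. ((\<lambda>r. (cball_integral \<phi> z r - V * \<phi> z) / r\<^sup>2) \<longlongrightarrow> \<psi> z) (at_right 0)"
    and L: "\<And>y. y \<in> ball 0 R0 \<Longrightarrow> ((\<lambda>r. (cball_integral v y r - V * v y) / r\<^sup>2) \<longlongrightarrow> - \<kappa> * v y) (at_right 0)"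
    and w: "continuous_on UNIV w" and c: "c \<ge> 0"
    and sc: "\<And>z h. w (z + h) + w (z - h) - 2 * w z \<ge> - c * (norm h)\<^sup>2"
    and near: "\<And>z. z \<in> cball 0 R \<Longrightarrow> \<exists>y\<in>ball 0 R0. v y \<le> v z + \<omega> \<and>
       (\<exists>\<delta>>0. \<forall>h. norm h < \<delta> \<longrightarrow> v (y + h) - v y \<le> w (z + h) - w z)"
  shows "0 \<le> (LINT z|lborel. w z * \<psi> z) + \<kappa> * (LINT z|lborel. \<phi> z * (v z + \<omega>))"
proof -
  note [measurable] = borel_measurable_continuous_onI[OF w] borel_measurable_continuous_onI[OF \<phi>]
    borel_measurable_continuous_onI[OF v]
  define X where "X n = 1 / real (Suc n)" for n
  have X: "0 < X n" "X n \<le> 1" for n by (simp_all add: X_def)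
  have X0: "X \<longlonglongrightarrow> 0" unfolding X_def using LIMSEQ_inverse_real_of_nat by (simp add: inverse_eq_divide)
  have ev: "filterlim X (at_right 0) sequentially"
    using X X0 by (intro filterlim_at_withinI) (auto intro!: always_eventually)
  define f where "f n z = (cball_integral w z (X n) - V * w z) / (X n)\<^sup>2" for n z
  have cf: "continuous_on UNIV (f n)" for n
    unfolding f_def divide_inverse by (intro continuous_intros continuous_on_cball_integral w)
  have flow: "f n z \<ge> - (c * V)" for n z
    unfolding f_def V using cball_integral_semiconvex_lower_bound[OF w c sc, where z = z and r = "X n"] X(1)[of n]
    by (simp add: pos_le_divide_eq)
  \<comment> \<open>The negative part of the quantity that should be nonnegative in the limit. It is
    dominated by semiconvexity, and only its pointwise convergence to 0 has to be shown.\<close>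
  define g where "g n z = min (f n z + \<kappa> * (v z + \<omega>)) 0" for n z
  have cg: "continuous_on UNIV (g n)" for n
    unfolding g_def by (intro continuous_intros cf v)
  note [measurable] = borel_measurable_continuous_onI[OF cg]
  have glow: "\<bar>g n z\<bar> \<le> c * V + \<kappa> * \<bar>v z + \<omega>\<bar>" for n z
  proof -
    have "\<bar>\<kappa> * (v z + \<omega>)\<bar> = \<kappa> * \<bar>v z + \<omega>\<bar>" using \<kappa> by (simp add: abs_mult)
    moreover have "0 \<le> c * V" using c by (simp add: V)
    ultimately show ?thesis using flow[of n z] unfolding g_def by linarith
  qed
  have int\<phi>: "integrable lborel (\<lambda>z. \<phi> z * (c * V + \<kappa> * \<bar>v z + \<omega>\<bar>))"
    by (rule integrable_compact_support[of _ R]) (auto intro!: continuous_intros \<phi> v simp: supp)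
  have int\<phi>2: "integrable lborel (\<lambda>z. \<phi> z * (v z + \<omega>))"
    by (rule integrable_compact_support[of _ R]) (auto intro!: continuous_intros \<phi> v simp: supp)
  have g0: "(\<lambda>n. g n z) \<longlonglongrightarrow> 0" if z: "z \<in> cball 0 R" for z
  proof -
    obtain y \<delta> where y: "y \<in> ball 0 R0" "v y \<le> v z + \<omega>" "\<delta> > 0"
      "\<And>h. norm h < \<delta> \<Longrightarrow> v (y + h) - v y \<le> w (z + h) - w z"
      using near[OF z] by blast
    \<comment> \<open>For small radii the quotient of w at z is at least the quotient a of v at the
      touching point y. Its limit -\<kappa> v y is at least -\<kappa> (v z + \<omega>), which is why
      the shift by \<omega> is built into g.\<close>
    define a where "a n = (cball_integral v y (X n) - V * v y) / (X n)\<^sup>2" for n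
    have a: "a \<longlonglongrightarrow> - \<kappa> * v y" unfolding a_def using filterlim_compose[OF L[OF y(1)] ev] .
    have "(\<lambda>n. min (a n + \<kappa> * (v z + \<omega>)) 0) \<longlonglongrightarrow> min (- \<kappa> * v y + \<kappa> * (v z + \<omega>)) 0"
      by (intro tendsto_intros a)
    moreover have "\<kappa> * v y \<le> \<kappa> * (v z + \<omega>)" using y(2) \<kappa> by (rule mult_left_mono)
    then have "min (- \<kappa> * v y + \<kappa> * (v z + \<omega>)) 0 = 0" by (simp add: min_absorb2)
    ultimately have lo: "(\<lambda>n. min (a n + \<kappa> * (v z + \<omega>)) 0) \<longlonglongrightarrow> 0" by (simp only:)
    have "eventually (\<lambda>n. X n < \<delta>) sequentially" using X0 y(3) by (rule order_tendstoD)
    then have "eventually (\<lambda>n. min (a n + \<kappa> * (v z + \<omega>)) 0 \<le> g n z) sequentially"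
    proof eventually_elim
      case (elim n)
      have "cball_integral v y (X n) - V * v y \<le> cball_integral w z (X n) - V * w z"
        unfolding V cball_integral_minus_const[OF v] cball_integral_minus_const[OF w]
      proof (rule set_integral_mono)
        fix h :: 'a assume "h \<in> cball 0 1"
        then have "norm (X n *\<^sub>R h) \<le> X n" using X[of n] mult_left_mono[of "norm h" 1 "X n"] by simp
        then show "v (y + X n *\<^sub>R h) - v y \<le> w (z + X n *\<^sub>R h) - w z"
          using elim by (intro y(4)) simp
      qed (intro set_integral_diff(1) set_integrable_cball_shift set_integrable_cball_const v w)+
      then have "a n \<le> f n z" unfolding a_def f_def by (rule divide_right_mono) simp
      then show ?case unfolding g_def by linarith
    qed
    moreover have "eventually (\<lambda>n. g n z \<le> 0) sequentially" by (simp add: g_def)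
    ultimately show ?thesis using lo tendsto_const by (rule tendsto_sandwich)
  qed
  have lg: "(\<lambda>n. LINT z|lborel. \<phi> z * g n z) \<longlonglongrightarrow> (LINT z::'a|lborel. 0)"
  proof (rule integral_dominated_convergence[OF _ _ int\<phi>])
    show "AE z in lborel. (\<lambda>n. \<phi> z * g n z) \<longlonglongrightarrow> 0"
    proof (rule AE_I2)
      fix z
      show "(\<lambda>n. \<phi> z * g n z) \<longlonglongrightarrow> 0"
        using tendsto_mult_right_zero[OF g0[of z], of "\<phi> z"] supp[of z] by (cases "norm z \<le> R") auto
    qed
    show "AE z in lborel. norm (\<phi> z * g n z) \<le> \<phi> z * (c * V + \<kappa> * \<bar>v z + \<omega>\<bar>)" for n
      using glow[of n] \<phi>0 by (intro AE_I2) (simp add: abs_mult mult_left_mono)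
  qed measurable
  have lf: "(\<lambda>n. LINT z|lborel. \<phi> z * f n z) \<longlonglongrightarrow> (LINT z|lborel. w z * \<psi> z)"
    unfolding f_def by (rule tendsto_integral_cball_difference[OF w \<phi> \<psi> supp V bound lim X X0])
  have "(LINT z|lborel. \<phi> z * g n z) \<le> (LINT z|lborel. \<phi> z * f n z) + \<kappa> * (LINT z|lborel. \<phi> z * (v z + \<omega>))" for n
  proof -
    have ig: "integrable lborel (\<lambda>z. \<phi> z * g n z)" and if': "integrable lborel (\<lambda>z. \<phi> z * f n z)"
      by (rule integrable_compact_support[of _ R]; (intro continuous_intros \<phi> cf cg | simp add: supp))+
    have "(LINT z|lborel. \<phi> z * g n z) \<le> (LINT z|lborel. \<phi> z * f n z + \<kappa> * (\<phi> z * (v z + \<omega>)))"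
    proof (rule integral_mono[OF ig])
      show "integrable lborel (\<lambda>z. \<phi> z * f n z + \<kappa> * (\<phi> z * (v z + \<omega>)))" using if' int\<phi>2 by simp
      fix z
      have "\<phi> z * g n z \<le> \<phi> z * (f n z + \<kappa> * (v z + \<omega>))"
        using \<phi>0[of z] by (intro mult_left_mono) (simp_all add: g_def)
      then show "\<phi> z * g n z \<le> \<phi> z * f n z + \<kappa> * (\<phi> z * (v z + \<omega>))"
        by (simp add: distrib_left mult.left_commute)
    qed
    then show ?thesis using if' int\<phi>2 by simp
  qed
  moreover have "(\<lambda>n. (LINT z|lborel. \<phi> z * f n z) + \<kappa> * (LINT z|lborel. \<phi> z * (v z + \<omega>)))
     \<longlonglongrightarrow> (LINT z|lborel. w z * \<psi> z) + \<kappa> * (LINT z|lborel. \<phi> z * (v z + \<omega>))"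
    by (intro tendsto_intros lf)
  ultimately show ?thesis
    using lg by (intro tendsto_le[OF sequentially_bot]) (auto intro: always_eventually)
qed

text \<open>The approximate inequality for w differs from the desired one for v by at most \<omega>
  times a constant independent of w, and \<omega> is arbitrary.\<close>

lemma weak_inequality:
  fixes v \<phi> \<psi> :: "'a::euclidean_space \<Rightarrow> real"
  assumes v: "continuous_on UNIV v" and \<phi>: "continuous_on UNIV \<phi>" and \<psi>: "continuous_on UNIV \<psi>"
    and R: "0 \<le> R" "R < R0"
    and supp: "\<And>z. norm z > R \<Longrightarrow> \<phi> z = 0" and supp': "\<And>z. norm z > R \<Longrightarrow> \<psi> z = 0" and \<phi>0: "\<And>z. \<phi> z \<ge> 0"
    and V: "V = measure lborel (ball (0::'a) 1)" and \<kappa>: "\<kappa> \<ge> 0"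
    and bound: "\<And>z r. \<bar>cball_integral \<phi> z r - V * \<phi> z\<bar> \<le> C * r\<^sup>2"
    and lim: "\<And>z. ((\<lambda>r. (cball_integral \<phi> z r - V * \<phi> z) / r\<^sup>2) \<longlongrightarrow> \<psi> z) (at_right 0)"
    and L: "\<And>y. y \<in> ball 0 R0 \<Longrightarrow> ((\<lambda>r. (cball_integral v y r - V * v y) / r\<^sup>2) \<longlongrightarrow> - \<kappa> * v y) (at_right 0)"
  shows "0 \<le> (LINT z|lborel. v z * \<psi> z) + \<kappa> * (LINT z|lborel. v z * \<phi> z)"
proof -
  let ?A = "(LINT z|lborel. v z * \<psi> z) + \<kappa> * (LINT z|lborel. v z * \<phi> z)"
  \<comment> \<open>The first summand pays for replacing w by v against \<psi>, the second for the
    shift of v by \<omega> against \<phi>.\<close>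
  define K where "K = (LINT z|lborel. \<bar>\<psi> z\<bar>) + \<kappa> * (LINT z|lborel. \<phi> z)"
  have i: "integrable lborel (\<lambda>z. v z * \<psi> z)" "integrable lborel (\<lambda>z. \<phi> z * v z)" "integrable lborel \<phi>" "integrable lborel (\<lambda>z. \<bar>\<psi> z\<bar>)"
    by (rule integrable_compact_support[of _ R]; auto intro!: continuous_intros \<phi> \<psi> v simp: supp supp')+
  have main: "- (\<omega> * K) \<le> ?A" if \<omega>: "\<omega> > 0" for \<omega>
  proof -
    obtain w c where w: "continuous_on UNIV w" "c \<ge> 0"
      "\<And>z. z \<in> cball 0 R \<Longrightarrow> \<bar>w z - v z\<bar> \<le> \<omega>"
      "\<And>z h. w (z + h) + w (z - h) - 2 * w z \<ge> - c * (norm h)\<^sup>2"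
      "\<And>z. z \<in> cball 0 R \<Longrightarrow> \<exists>y\<in>ball 0 R0. v y \<le> v z + \<omega> \<and>
         (\<exists>\<delta>>0. \<forall>h. norm h < \<delta> \<longrightarrow> v (y + h) - v y \<le> w (z + h) - w z)"
      using semiconvex_approximation[OF v R \<omega>] by blast
    have iw: "integrable lborel (\<lambda>z. w z * \<psi> z)"
      by (rule integrable_compact_support[of _ R]) (auto intro!: continuous_intros \<psi> w(1) simp: supp')
    have "0 \<le> (LINT z|lborel. w z * \<psi> z) + \<kappa> * (LINT z|lborel. \<phi> z * (v z + \<omega>))"
      by (rule weak_inequality_approx[OF v \<phi> \<psi> supp \<phi>0 V \<kappa> bound lim L w(1,2,4,5)])
    also have "(LINT z|lborel. \<phi> z * (v z + \<omega>)) = (LINT z|lborel. v z * \<phi> z) + \<omega> * (LINT z|lborel. \<phi> z)"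
      using i by (simp add: distrib_left mult.commute)
    also have "(LINT z|lborel. w z * \<psi> z) \<le> (LINT z|lborel. v z * \<psi> z + \<omega> * \<bar>\<psi> z\<bar>)"
    proof (rule integral_mono[OF iw])
      show "integrable lborel (\<lambda>z. v z * \<psi> z + \<omega> * \<bar>\<psi> z\<bar>)" using i by simp
      fix z
      show "w z * \<psi> z \<le> v z * \<psi> z + \<omega> * \<bar>\<psi> z\<bar>"
      proof (cases "norm z \<le> R")
        case True
        have "(w z - v z) * \<psi> z \<le> \<bar>w z - v z\<bar> * \<bar>\<psi> z\<bar>" by (metis abs_ge_self abs_mult)
        also have "\<dots> \<le> \<omega> * \<bar>\<psi> z\<bar>" using w(3)[of z] True by (intro mult_right_mono) auto
        finally show ?thesis by (simp add: left_diff_distrib)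
      qed (simp add: supp')
    qed
    also have "\<dots> = (LINT z|lborel. v z * \<psi> z) + \<omega> * (LINT z|lborel. \<bar>\<psi> z\<bar>)"
      using i by simp
    finally show ?thesis by (simp add: K_def algebra_simps)
  qed
  have le: "- ((1 / real (Suc n)) * K) \<le> ?A" for n by (rule main) simp
  have "(\<lambda>n. - ((1 / real (Suc n)) * K)) \<longlonglongrightarrow> - (0 * K)"
    using LIMSEQ_inverse_real_of_nat by (intro tendsto_intros) (simp add: inverse_eq_divide)
  then show ?thesis
    using le by (intro LIMSEQ_le_const2[of _ "- (0 * K)", simplified]) auto
qed

subsection \<open>Bump functions\<close>

lemma has_real_derivative_pos_part_power:
  assumes "k \<ge> 1"
  shows "((\<lambda>x. (max 0 x) ^ Suc k) has_real_derivative real (Suc k) * (max 0 x) ^ k) (at (x::real))"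
proof (cases x "0::real" rule: linorder_cases)
  case less
  have "((\<lambda>_. 0) has_real_derivative real (Suc k) * (max 0 x) ^ k) (at x)"
    using less assms by (cases k) (auto simp: max_def)
  then show ?thesis
    by (rule has_field_derivative_transform_within_open[where S = "{..<0}"]) (use less in auto)
next
  case greater
  have "((\<lambda>x. x ^ Suc k) has_real_derivative real (Suc k) * (max 0 x) ^ k) (at x)"
    using greater DERIV_pow[of "Suc k" x] by (simp add: max_def)
  then show ?thesis
    by (rule has_field_derivative_transform_within_open[where S = "{0<..}"]) (use greater in auto)
next
  case equal
  \<comment> \<open>At the kink the difference quotient is at most |h|^k, which tends to 0 because k
    is at least 1.\<close>
  have "((\<lambda>h::real. (max 0 (0 + h) ^ Suc k - max 0 0 ^ Suc k) / h) \<longlongrightarrow> 0) (at 0)"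
  proof (rule Lim_null_comparison)
    show "((\<lambda>h::real. \<bar>h\<bar> ^ k) \<longlongrightarrow> 0) (at 0)"
      using assms tendsto_power[OF tendsto_rabs_zero[OF tendsto_ident_at[of "0::real" UNIV]], of k] by (simp add: power_0_left)
    have "norm ((max 0 (0 + h) ^ Suc k - max 0 0 ^ Suc k) / h) \<le> \<bar>h\<bar> ^ k" for h :: real
      by (cases "h > 0") (auto simp: max_def)
    then show "\<forall>\<^sub>F h in at 0. norm ((max 0 (0 + h) ^ Suc k - max 0 0 ^ Suc k) / h) \<le> \<bar>h\<bar> ^ k"
      by (intro always_eventually allI)
  qed
  then show ?thesis using equal assms by (simp add: DERIV_def power_0_left)
qed

text \<open>Taylor's formula with Lagrange remainder at r and at -r; the linear terms cancel. Both
  intermediate points are kept, which spares an intermediate value argument for the second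
  derivative.\<close>

lemma second_difference_mvt:
  fixes \<theta> :: "real \<Rightarrow> real"
  assumes d1: "\<And>t. (\<theta> has_real_derivative \<theta>' t) (at t)" and d2: "\<And>t. (\<theta>' has_real_derivative \<theta>'' t) (at t)"
  obtains s t where "\<bar>s\<bar> \<le> \<bar>r\<bar>" "\<bar>t\<bar> \<le> \<bar>r\<bar>" "\<theta> r + \<theta> (- r) - 2 * \<theta> 0 = (\<theta>'' s + \<theta>'' t) / 2 * r\<^sup>2"
proof -
  define diff where "diff m = (if m = 0 then \<theta> else if m = 1 then \<theta>' else \<theta>'')" for m :: nat
  have D: "(diff m has_real_derivative diff (Suc m) t) (at t)" if "m < 2" for m t
    using that d1 d2 by (auto simp: diff_def less_2_cases_iff)
  have T: "\<exists>t. \<bar>t\<bar> \<le> \<bar>x\<bar> \<and> \<theta> x = \<theta> 0 + \<theta>' 0 * x + \<theta>'' t / 2 * x\<^sup>2" for x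
  proof -
    have "\<exists>t. \<bar>t\<bar> \<le> \<bar>x\<bar> \<and> \<theta> x = (\<Sum>m<2. diff m 0 / fact m * x ^ m) + diff 2 t / fact 2 * x ^ 2"
      by (rule Maclaurin_bi_le) (use D in \<open>auto simp: diff_def\<close>)
    then show ?thesis by (simp add: diff_def numeral_2_eq_2)
  qed
  obtain s t where "\<bar>s\<bar> \<le> \<bar>r\<bar>" "\<theta> r = \<theta> 0 + \<theta>' 0 * r + \<theta>'' s / 2 * r\<^sup>2"
     "\<bar>t\<bar> \<le> \<bar>- r\<bar>" "\<theta> (- r) = \<theta> 0 + \<theta>' 0 * (- r) + \<theta>'' t / 2 * (- r)\<^sup>2"
    using T[of r] T[of "- r"] by blast
  then show thesis by (intro that[of s t]) (auto simp: algebra_simps add_divide_distrib)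
qed

text \<open>The kernel proper is the case k = 3. Differentiating lowers k and produces polynomial
  factors, so that the cases 2 and 1 carry its first and second derivatives.\<close>

definition bump :: "nat \<Rightarrow> real \<Rightarrow> 'a::euclidean_space \<Rightarrow> real" where
  "bump k R z = (max 0 (R\<^sup>2 - (norm z)\<^sup>2)) ^ k"

lemma continuous_on_bump: "continuous_on S (bump k R)"
  unfolding bump_def by (intro continuous_intros)

lemma bump_nonneg: "bump k R z \<ge> 0"
  by (simp add: bump_def)

lemma bump_outside:
  assumes "R \<ge> 0" "norm z \<ge> R" "k \<ge> 1"
  shows "bump k R z = 0"
proof -
  have "R\<^sup>2 \<le> (norm z)\<^sup>2" using assms by (intro power_mono) auto
  then show ?thesis using assms(3) by (simp add: bump_def max_def)
qed

lemma bump_Suc: "k \<ge> 1 \<Longrightarrow> bump (Suc k) R z = (R\<^sup>2 - (norm z)\<^sup>2) * bump k R z"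
  by (auto simp: bump_def max_def)

text \<open>The second derivative of \<open>bump 3 R\<close> at z along h, as
  \<open>has_real_derivative_bump_line\<close> confirms.\<close>

definition bump_second :: "real \<Rightarrow> 'a::euclidean_space \<Rightarrow> 'a \<Rightarrow> real" where
  "bump_second R z h = 24 * (z \<bullet> h)\<^sup>2 * bump 1 R z - 6 * (norm h)\<^sup>2 * bump 2 R z"

lemma has_real_derivative_bump_line:
  fixes z h :: "'a::euclidean_space"
  shows "((\<lambda>t. bump 3 R (z + t *\<^sub>R h)) has_real_derivative - 6 * ((z + t *\<^sub>R h) \<bullet> h) * bump 2 R (z + t *\<^sub>R h)) (at t)"
    and "((\<lambda>t. - 6 * ((z + t *\<^sub>R h) \<bullet> h) * bump 2 R (z + t *\<^sub>R h)) has_real_derivative bump_second R (z + t *\<^sub>R h) h) (at t)"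
proof -
  define q where "q t = R\<^sup>2 - (norm (z + t *\<^sub>R h))\<^sup>2" for t
  have q: "q = (\<lambda>t. R\<^sup>2 - (z \<bullet> z + 2 * t * (z \<bullet> h) + t\<^sup>2 * (h \<bullet> h)))"
  proof
    fix t
    have "(norm (z + t *\<^sub>R h))\<^sup>2 = z \<bullet> z + 2 * t * (z \<bullet> h) + t\<^sup>2 * (h \<bullet> h)"
      unfolding power2_norm_eq_inner inner_add_left inner_add_right
      by (simp add: inner_commute power2_eq_square)
    then show "q t = R\<^sup>2 - (z \<bullet> z + 2 * t * (z \<bullet> h) + t\<^sup>2 * (h \<bullet> h))" by (simp add: q_def)
  qed
  have dq: "(q has_real_derivative - 2 * ((z + t *\<^sub>R h) \<bullet> h)) (at t)" for t
    unfolding q by (auto intro!: derivative_eq_intros simp: inner_add_left)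
  have b: "bump k R (z + t *\<^sub>R h) = (max 0 (q t)) ^ k" for k t by (simp add: bump_def q_def)
  have dl: "((\<lambda>t. (z + t *\<^sub>R h) \<bullet> h) has_real_derivative h \<bullet> h) (at t)"
    by (auto intro!: derivative_eq_intros simp: inner_add_left)
  have d3: "((\<lambda>t. (max 0 (q t)) ^ 3) has_real_derivative 3 * (max 0 (q t)) ^ 2 * (- 2 * ((z + t *\<^sub>R h) \<bullet> h))) (at t)"
    using DERIV_chain2[OF has_real_derivative_pos_part_power[of 2] dq] by (simp add: eval_nat_numeral)
  have d2: "((\<lambda>t. (max 0 (q t)) ^ 2) has_real_derivative 2 * (max 0 (q t)) * (- 2 * ((z + t *\<^sub>R h) \<bullet> h))) (at t)"
    using DERIV_chain2[OF has_real_derivative_pos_part_power[of 1] dq] by (simp add: eval_nat_numeral)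
  show "((\<lambda>t. bump 3 R (z + t *\<^sub>R h)) has_real_derivative - 6 * ((z + t *\<^sub>R h) \<bullet> h) * bump 2 R (z + t *\<^sub>R h)) (at t)"
    unfolding b using d3 by (rule DERIV_cong) simp
  have "((\<lambda>t. - 6 * ((z + t *\<^sub>R h) \<bullet> h)) has_real_derivative - 6 * (h \<bullet> h)) (at t)"
    by (rule DERIV_cmult[OF dl])
  from DERIV_mult[OF this d2]
  show "((\<lambda>t. - 6 * ((z + t *\<^sub>R h) \<bullet> h) * bump 2 R (z + t *\<^sub>R h)) has_real_derivative bump_second R (z + t *\<^sub>R h) h) (at t)"
    unfolding b bump_second_def power2_norm_eq_inner
    by (rule DERIV_cong) (simp add: power2_eq_square)
qed

text \<open>30 is 24 + 6: inside the ball both |z . h| <= R and 0 <= R^2 - |z|^2 <= R^2, so each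
  term is at most its coefficient times R^4. Outside, everything vanishes.\<close>

lemma bump_second_bound:
  fixes z h :: "'a::euclidean_space"
  assumes R: "R \<ge> 0" and h: "norm h \<le> 1"
  shows "\<bar>bump_second R z h\<bar> \<le> 30 * R ^ 4"
proof (cases "norm z < R")
  case True
  have n: "(norm z)\<^sup>2 \<le> R\<^sup>2" using True by (intro power_mono) auto
  have h2: "(norm h)\<^sup>2 \<le> 1" using h by (simp add: power_le_one)
  have b: "max 0 (R\<^sup>2 - (norm z)\<^sup>2) \<le> R\<^sup>2" using n by simp
  have b2: "bump 2 R z \<le> (R\<^sup>2)\<^sup>2" unfolding bump_def using b by (intro power_mono) auto
  have "\<bar>z \<bullet> h\<bar> \<le> R * 1"
    using Cauchy_Schwarz_ineq2[of z h] mult_mono[OF less_imp_le[OF True] h R norm_ge_zero] by linarith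
  then have zh: "(z \<bullet> h)\<^sup>2 \<le> R\<^sup>2" by (simp add: abs_le_square_iff[symmetric] R)
  have "(z \<bullet> h)\<^sup>2 * bump 1 R z \<le> R\<^sup>2 * R\<^sup>2" using zh b by (intro mult_mono) (auto simp: bump_def)
  moreover have "(norm h)\<^sup>2 * bump 2 R z \<le> 1 * (R\<^sup>2)\<^sup>2" using h2 b2 by (intro mult_mono) (auto simp: bump_def)
  moreover have "R\<^sup>2 * R\<^sup>2 = R ^ 4" "(R\<^sup>2)\<^sup>2 = R ^ 4" by (simp_all flip: power_add power_mult)
  moreover have "(z \<bullet> h)\<^sup>2 * bump 1 R z \<ge> 0" "(norm h)\<^sup>2 * bump 2 R z \<ge> 0" by (simp_all add: bump_nonneg)
  ultimately show ?thesis unfolding bump_second_def abs_le_iff mult.assoc by linarith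
next
  case False
  then show ?thesis using R by (simp add: bump_second_def bump_outside)
qed

lemma bump_second_difference:
  fixes z h :: "'a::euclidean_space"
  assumes R: "R \<ge> 0" and h: "norm h \<le> 1"
  shows "\<bar>bump 3 R (z + r *\<^sub>R h) + bump 3 R (z - r *\<^sub>R h) - 2 * bump 3 R z\<bar> \<le> 30 * R ^ 4 * r\<^sup>2"
    and "((\<lambda>r. (bump 3 R (z + r *\<^sub>R h) + bump 3 R (z - r *\<^sub>R h) - 2 * bump 3 R z) / r\<^sup>2) \<longlongrightarrow> bump_second R z h) (at_right 0)"
proof -
  define \<theta> where "\<theta> t = bump 3 R (z + t *\<^sub>R h)" for t
  define g where "g t = bump_second R (z + t *\<^sub>R h) h" for t
  have d: "bump 3 R (z + r *\<^sub>R h) + bump 3 R (z - r *\<^sub>R h) - 2 * bump 3 R z = \<theta> r + \<theta> (- r) - 2 * \<theta> 0" for r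
    by (simp add: \<theta>_def)
  have gb: "\<bar>g t\<bar> \<le> 30 * R ^ 4" for t unfolding g_def by (rule bump_second_bound[OF R h])
  have mvt: "\<exists>s t. \<bar>s\<bar> \<le> \<bar>r\<bar> \<and> \<bar>t\<bar> \<le> \<bar>r\<bar> \<and> \<theta> r + \<theta> (- r) - 2 * \<theta> 0 = (g s + g t) / 2 * r\<^sup>2" for r
  proof -
    have "(\<theta> has_real_derivative - 6 * ((z + t *\<^sub>R h) \<bullet> h) * bump 2 R (z + t *\<^sub>R h)) (at t)"
      "((\<lambda>t. - 6 * ((z + t *\<^sub>R h) \<bullet> h) * bump 2 R (z + t *\<^sub>R h)) has_real_derivative g t) (at t)" for t
      unfolding \<theta>_def g_def by (rule has_real_derivative_bump_line)+
    then show ?thesis by (rule second_difference_mvt[where r = r]) blast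
  qed
  show "\<bar>bump 3 R (z + r *\<^sub>R h) + bump 3 R (z - r *\<^sub>R h) - 2 * bump 3 R z\<bar> \<le> 30 * R ^ 4 * r\<^sup>2"
  proof -
    obtain s t where st: "\<theta> r + \<theta> (- r) - 2 * \<theta> 0 = (g s + g t) / 2 * r\<^sup>2" using mvt by blast
    have "\<bar>(g s + g t) / 2\<bar> \<le> 30 * R ^ 4" using gb[of s] gb[of t] abs_triangle_ineq[of "g s" "g t"] by simp
    then show ?thesis unfolding d st abs_mult abs_power2 by (rule mult_right_mono) simp
  qed
  have "continuous_on UNIV g" unfolding g_def bump_second_def bump_def by (intro continuous_intros)
  then have g0: "g \<midarrow>0\<rightarrow> g 0" by (simp add: continuous_on_eq_continuous_at isCont_def)
  show "((\<lambda>r. (bump 3 R (z + r *\<^sub>R h) + bump 3 R (z - r *\<^sub>R h) - 2 * bump 3 R z) / r\<^sup>2) \<longlongrightarrow> bump_second R z h) (at_right 0)"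
    unfolding d
  proof (rule tendstoI)
    fix e :: real assume e: "e > 0"
    then obtain \<delta> where \<delta>: "\<delta> > 0" "\<And>t. t \<noteq> 0 \<Longrightarrow> \<bar>t\<bar> < \<delta> \<Longrightarrow> \<bar>g t - g 0\<bar> < e"
      using LIM_D[OF g0 e] by auto
    then have \<delta>': "\<bar>g t - g 0\<bar> < e" if "\<bar>t\<bar> < \<delta>" for t using that e by (cases "t = 0") auto
    have "eventually (\<lambda>r. r \<in> {0<..<\<delta>}) (at_right 0)" using \<delta>(1) by (rule eventually_at_right_real)
    then show "\<forall>\<^sub>F r in at_right 0. dist ((\<theta> r + \<theta> (- r) - 2 * \<theta> 0) / r\<^sup>2) (bump_second R z h) < e"
    proof eventually_elim
      case (elim r)
      obtain s t where st: "\<bar>s\<bar> \<le> \<bar>r\<bar>" "\<bar>t\<bar> \<le> \<bar>r\<bar>" "\<theta> r + \<theta> (- r) - 2 * \<theta> 0 = (g s + g t) / 2 * r\<^sup>2" using mvt by blast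
      have "\<bar>g s - g 0\<bar> < e" "\<bar>g t - g 0\<bar> < e" using st elim by (auto intro!: \<delta>')
      moreover have "bump_second R z h = g 0" by (simp add: g_def)
      moreover have "(\<theta> r + \<theta> (- r) - 2 * \<theta> 0) / r\<^sup>2 = (g s + g t) / 2" unfolding st using elim by simp
      moreover have "\<bar>(g s + g t) / 2 - g 0\<bar> < e" using \<open>\<bar>g s - g 0\<bar> < e\<close> \<open>\<bar>g t - g 0\<bar> < e\<close>
        by (simp add: abs_less_iff) argo
      ultimately show ?case unfolding dist_real_def by (simp only:)
    qed
  qed
qed

text \<open>The trace of the second derivatives is 24 |z|^2 \<open>bump 1\<close> - 6 m
  \<open>bump 2\<close>. Here |z|^2 is eliminated as R^2 - (R^2 - |z|^2), so that integrals against
  v become combinations of radial moments.\<close>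

definition bump_laplacian :: "real \<Rightarrow> 'a::euclidean_space \<Rightarrow> real" where
  "bump_laplacian R z = 24 * R\<^sup>2 * bump 1 R z - (24 + 6 * real DIM('a)) * bump 2 R z"

lemma continuous_on_bump_laplacian: "continuous_on S (bump_laplacian R)"
  unfolding bump_laplacian_def by (intro continuous_intros continuous_on_bump)

text \<open>Symmetrising the difference halves the constants: 15 is 30 / 2, and the second moments V
  / (m + 2) of the unit ball give V / (2 (m + 2)). The uniform bound also justifies the limit under
  the integral.\<close>

lemma cball_integral_bump:
  fixes z :: "'a::euclidean_space"
  assumes R: "R \<ge> 0"
  defines "V \<equiv> measure lborel (ball (0::'a) 1)"
  shows "\<bar>cball_integral (bump 3 R) z r - V * bump 3 R z\<bar> \<le> 15 * R ^ 4 * V * r\<^sup>2"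
    and "((\<lambda>r. (cball_integral (bump 3 R) z r - V * bump 3 R z) / r\<^sup>2)
      \<longlongrightarrow> V / (2 * (real DIM('a) + 2)) * bump_laplacian R z) (at_right 0)"
proof -
  define \<Delta> where "\<Delta> r h = bump 3 R (z + r *\<^sub>R h) + bump 3 R (z - r *\<^sub>R h) - 2 * bump 3 R z" for r h
  have c\<Delta>: "continuous_on UNIV (\<Delta> r)" for r
    unfolding \<Delta>_def by (intro continuous_intros continuous_on_comp_UNIV[OF continuous_on_bump])
  note [measurable] = borel_measurable_continuous_onI[OF c\<Delta>]
  have [measurable]: "cball (0::'a) 1 \<in> sets borel" by simp
  have i\<Delta>: "set_integrable lborel (cball 0 1) (\<Delta> r)" for r
    by (intro set_integrable_continuous_compact c\<Delta>) auto
  have V0: "V \<ge> 0" by (simp add: V_def)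
  have eq: "cball_integral (bump 3 R) z r - V * bump 3 R z = (LINT h:cball 0 1|lborel. \<Delta> r h) / 2" for r
    unfolding V_def \<Delta>_def by (rule cball_integral_second_difference[OF continuous_on_bump])
  have \<Delta>b: "\<bar>\<Delta> r h\<bar> \<le> 30 * R ^ 4 * r\<^sup>2" if "h \<in> cball 0 1" for r h
    unfolding \<Delta>_def using that by (intro bump_second_difference R) simp
  have \<Delta>b': "\<Delta> r h \<le> 30 * R ^ 4 * r\<^sup>2" "- (30 * R ^ 4 * r\<^sup>2) \<le> \<Delta> r h" if "h \<in> cball 0 1" for r h
    using \<Delta>b[OF that, of r] by linarith+
  show "\<bar>cball_integral (bump 3 R) z r - V * bump 3 R z\<bar> \<le> 15 * R ^ 4 * V * r\<^sup>2"
  proof -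
    have "(LINT h:cball 0 1|lborel. \<Delta> r h) \<le> (LINT h:cball (0::'a) 1|lborel. 30 * R ^ 4 * r\<^sup>2)"
      "(LINT h:cball (0::'a) 1|lborel. - (30 * R ^ 4 * r\<^sup>2)) \<le> (LINT h:cball 0 1|lborel. \<Delta> r h)"
      by (rule set_integral_mono[OF i\<Delta> set_integrable_cball_const \<Delta>b'(1)] set_integral_mono[OF set_integrable_cball_const i\<Delta> \<Delta>b'(2)]; assumption)+
    then have "\<bar>(LINT h:cball 0 1|lborel. \<Delta> r h)\<bar> \<le> V * (30 * R ^ 4 * r\<^sup>2)"
      unfolding LINT_cball_const V_def by linarith
    then show ?thesis unfolding eq by (simp add: algebra_simps)
  qed
  have "((\<lambda>r. (LINT h:cball 0 1|lborel. \<Delta> r h) / r\<^sup>2) \<longlongrightarrow> (LINT h:cball 0 1|lborel. bump_second R z h)) (at_right 0)"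
  proof (rule tendsto_at_right_sequentially[of 0 1])
    fix X :: "nat \<Rightarrow> real" assume X: "\<And>n. 0 < X n" "\<And>n. X n < 1" "decseq X" "X \<longlonglongrightarrow> 0"
    have ev: "filterlim X (at_right 0) sequentially"
      using X by (intro filterlim_at_withinI) (auto intro!: always_eventually)
    have "(\<lambda>n. LINT h:cball 0 1|lborel. \<Delta> (X n) h / (X n)\<^sup>2) \<longlonglongrightarrow> (LINT h:cball 0 1|lborel. bump_second R z h)"
    proof (rule tendsto_LINT_cball[where w = "\<lambda>_. 30 * R ^ 4"])
      show "bump_second R z \<in> borel_measurable borel"
        unfolding bump_second_def by measurable
      show "(\<lambda>h. \<Delta> (X n) h / (X n)\<^sup>2) \<in> borel_measurable borel" for n by measurable
      fix h :: 'a assume h: "norm h \<le> 1"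
      show "(\<lambda>n. \<Delta> (X n) h / (X n)\<^sup>2) \<longlonglongrightarrow> bump_second R z h"
        using filterlim_compose[OF bump_second_difference(2)[OF R h, of z] ev] unfolding \<Delta>_def .
      show "\<bar>\<Delta> (X n) h / (X n)\<^sup>2\<bar> \<le> 30 * R ^ 4" for n
        using \<Delta>b[of h "X n"] h X(1)[of n] by (simp add: pos_divide_le_eq)
    qed simp
    then show "(\<lambda>n. (LINT h:cball 0 1|lborel. \<Delta> (X n) h) / (X n)\<^sup>2) \<longlonglongrightarrow> (LINT h:cball 0 1|lborel. bump_second R z h)"
      by simp
  qed simp
  moreover have "(LINT h:cball 0 1|lborel. bump_second R z h) = V / (real DIM('a) + 2) * bump_laplacian R z"
  proof -
    have "(LINT h:cball 0 1|lborel. bump_second R z h)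
      = (LINT h:cball 0 1|lborel. 24 * bump 1 R z * (z \<bullet> h)\<^sup>2) - (LINT h:cball (0::'a) 1|lborel. 6 * bump 2 R z * (norm h)\<^sup>2)"
    proof -
      have e: "(\<lambda>h. bump_second R z h) = (\<lambda>h. 24 * bump 1 R z * (z \<bullet> h)\<^sup>2 - 6 * bump 2 R z * (norm h)\<^sup>2)"
        by (simp add: fun_eq_iff bump_second_def)
      show ?thesis
        unfolding e
          by (rule set_integral_diff(2)) (auto intro!: set_integrable_continuous_compact continuous_intros)
    qed
    also have "\<dots> = 24 * bump 1 R z * (V / (real DIM('a) + 2) * (norm z)\<^sup>2) - 6 * bump 2 R z * (real DIM('a) * V / (real DIM('a) + 2))"
      by (simp only: set_integral_mult_right LINT_cball_inner_sq LINT_cball_norm_sq V_def)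
    also have "\<dots> = V / (real DIM('a) + 2) * (24 * ((norm z)\<^sup>2 * bump 1 R z) - 6 * real DIM('a) * bump 2 R z)"
      by (simp add: right_diff_distrib mult_ac)
    also have "(norm z)\<^sup>2 * bump 1 R z = R\<^sup>2 * bump 1 R z - bump 2 R z"
      using bump_Suc[of 1 R z] by (simp add: left_diff_distrib numeral_2_eq_2)
    finally show ?thesis by (simp add: bump_laplacian_def algebra_simps)
  qed
  ultimately have "((\<lambda>r. ((LINT h:cball 0 1|lborel. \<Delta> r h) / r\<^sup>2) / 2) \<longlongrightarrow> V / (real DIM('a) + 2) * bump_laplacian R z / 2) (at_right 0)"
    by (intro tendsto_divide tendsto_const) auto
  moreover have "V / (real DIM('a) + 2) * bump_laplacian R z / 2 = V / (2 * (real DIM('a) + 2)) * bump_laplacian R z"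
    by (simp add: field_simps)
  ultimately show "((\<lambda>r. (cball_integral (bump 3 R) z r - V * bump 3 R z) / r\<^sup>2)
      \<longlongrightarrow> V / (2 * (real DIM('a) + 2)) * bump_laplacian R z) (at_right 0)"
    unfolding eq by (simp add: mult.commute)
qed

subsection \<open>The weak equation and radial moments\<close>

text \<open>The factor V / (2 (m + 2)) occurs in the limit for the kernel as well as in the one for
  v, and being positive it can be cancelled from the inequalities for v and for -v.\<close>

lemma weak_equation:
  fixes v :: "'a::euclidean_space \<Rightarrow> real"
  assumes v: "continuous_on UNIV v" and R: "0 \<le> R" "R < R0"
    and V: "V = measure lborel (ball (0::'a) 1)"
    and L: "\<And>y. y \<in> ball x R0 \<Longrightarrow> ((\<lambda>r. (cball_integral v y r - V * v y) / r\<^sup>2)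
       \<longlongrightarrow> - (V * \<mu>\<^sup>2 / (2 * (real DIM('a) + 2))) * v y) (at_right 0)"
  shows "(LINT y|lborel. v (x + y) * bump_laplacian R y) = - \<mu>\<^sup>2 * (LINT y|lborel. v (x + y) * bump 3 R y)"
proof -
  define s where "s = V / (2 * (real DIM('a) + 2))"
  have Vp: "V > 0" unfolding V by (rule measure_unit_ball_pos)
  have s: "s > 0" unfolding s_def using Vp by (intro divide_pos_pos) auto
  define \<kappa> where "\<kappa> = s * \<mu>\<^sup>2"
  have \<kappa>: "\<kappa> \<ge> 0" using s by (simp add: \<kappa>_def)
  have \<kappa>': "V * \<mu>\<^sup>2 / (2 * (real DIM('a) + 2)) = \<kappa>" by (simp add: \<kappa>_def s_def)
  note L' = L[unfolded \<kappa>']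
  have half: "0 \<le> (LINT y|lborel. w (x + y) * bump_laplacian R y) + \<mu>\<^sup>2 * (LINT y|lborel. w (x + y) * bump 3 R y)"
    if w: "continuous_on UNIV w"
      and Lw: "\<And>y. y \<in> ball x R0 \<Longrightarrow> ((\<lambda>r. (cball_integral w y r - V * w y) / r\<^sup>2) \<longlongrightarrow> - \<kappa> * w y) (at_right 0)"
    for w
  proof -
    have cs: "cball_integral (\<lambda>y. w (x + y)) y r = cball_integral w (x + y) r" for y r
      by (simp add: cball_integral_def add.assoc)
    have "0 \<le> (LINT z|lborel. w (x + z) * (s * bump_laplacian R z)) + \<kappa> * (LINT z|lborel. w (x + z) * bump 3 R z)"
    proof (rule weak_inequality[where R = R and ?R0.0 = R0 and V = V and C = "15 * R ^ 4 * V"])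
      show "continuous_on UNIV (\<lambda>y. w (x + y))"
        by (intro continuous_on_comp_UNIV[OF w] continuous_intros)
      show "continuous_on UNIV (\<lambda>z. s * bump_laplacian R z)"
        by (intro continuous_intros continuous_on_bump_laplacian)
      show "s * bump_laplacian R z = 0" if "norm z > R" for z :: 'a
        using that R by (simp add: bump_laplacian_def bump_outside)
      show "bump 3 R z = 0" if "norm z > R" for z :: 'a
        using that R by (simp add: bump_outside)
      show "\<bar>cball_integral (bump 3 R) z r - V * bump 3 R z\<bar> \<le> 15 * R ^ 4 * V * r\<^sup>2" for z :: 'a and r
        unfolding V by (rule cball_integral_bump(1)[OF R(1)])
      show "((\<lambda>r. (cball_integral (bump 3 R) z r - V * bump 3 R z) / r\<^sup>2) \<longlongrightarrow> s * bump_laplacian R z) (at_right 0)" for z :: 'a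
        unfolding V s_def by (rule cball_integral_bump(2)[OF R(1)])
      show "((\<lambda>r. (cball_integral (\<lambda>y. w (x + y)) y r - V * w (x + y)) / r\<^sup>2) \<longlongrightarrow> - \<kappa> * w (x + y)) (at_right 0)"
        if "y \<in> ball 0 R0" for y
        unfolding cs by (rule Lw) (use that in \<open>simp add: dist_norm\<close>)
    qed (use R V \<kappa> in \<open>auto intro: continuous_on_bump bump_nonneg\<close>)
    also have "\<dots> = s * ((LINT y|lborel. w (x + y) * bump_laplacian R y) + \<mu>\<^sup>2 * (LINT y|lborel. w (x + y) * bump 3 R y))"
      by (simp add: \<kappa>_def distrib_left mult.left_commute[of _ s])
    finally show ?thesis using s by (simp add: zero_le_mult_iff)
  qed
  have "0 \<le> (LINT y|lborel. v (x + y) * bump_laplacian R y) + \<mu>\<^sup>2 * (LINT y|lborel. v (x + y) * bump 3 R y)"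
    by (rule half[OF v L'])
  moreover have "0 \<le> (LINT y|lborel. - v (x + y) * bump_laplacian R y) + \<mu>\<^sup>2 * (LINT y|lborel. - v (x + y) * bump 3 R y)"
  proof (rule half)
    show "continuous_on UNIV (\<lambda>y. - v y)" by (intro continuous_intros v)
    fix y assume "y \<in> ball x R0"
    note lim = tendsto_minus[OF L'[OF this]]
    have "(cball_integral (\<lambda>y. - v y) y r - V * - v y) / r\<^sup>2 = - ((cball_integral v y r - V * v y) / r\<^sup>2)" for r
      by (simp add: cball_integral_def set_lebesgue_integral_def diff_divide_distrib)
    moreover have "- \<kappa> * - v y = - (- \<kappa> * v y)" by simp
    ultimately show "((\<lambda>r. (cball_integral (\<lambda>y. - v y) y r - V * - v y) / r\<^sup>2) \<longlongrightarrow> - \<kappa> * - v y) (at_right 0)"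
      using lim by (simp only:)
  qed
  ultimately show ?thesis by simp
qed

text \<open>The squared radius is the parameter because d/dw then simply lowers the exponent, with
  factor k, without any factor depending on w.\<close>

definition radial_moment :: "nat \<Rightarrow> ('a::euclidean_space \<Rightarrow> real) \<Rightarrow> 'a \<Rightarrow> real \<Rightarrow> real" where
  "radial_moment k v x w = (LINT y|lborel. v (x + y) * (max 0 (w - (norm y)\<^sup>2)) ^ k)"

lemma LINT_eq_integral_cbox:
  fixes f :: "'a::euclidean_space \<Rightarrow> real"
  assumes f: "continuous_on UNIV f" and out: "\<And>y. y \<notin> cbox a b \<Longrightarrow> f y = 0"
  shows "(LINT y|lborel. f y) = integral (cbox a b) f"
proof -
  have "(LINT y|lborel. f y) = (LINT y:cbox a b|lborel. f y)"
    unfolding set_lebesgue_integral_def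
    by (intro Bochner_Integration.integral_cong refl) (use out in \<open>auto simp: indicator_def\<close>)
  also have "\<dots> = integral (cbox a b) f"
    by (intro set_borel_integral_eq_integral set_integrable_continuous_compact f compact_cbox)
  finally show ?thesis .
qed

text \<open>One box serves all w up to W: differentiation under the integral sign needs a domain
  that does not move with the parameter.\<close>

lemma radial_moment_eq_integral:
  fixes v :: "'a::euclidean_space \<Rightarrow> real"
  assumes v: "continuous_on UNIV v" and k: "k \<ge> 1" and ab: "cball 0 (sqrt W) \<subseteq> cbox a b" and w: "w \<le> W"
  shows "radial_moment k v x w = integral (cbox a b) (\<lambda>y. v (x + y) * (max 0 (w - (norm y)\<^sup>2)) ^ k)"
  unfolding radial_moment_def
proof (rule LINT_eq_integral_cbox)
  show "continuous_on UNIV (\<lambda>y. v (x + y) * (max 0 (w - (norm y)\<^sup>2)) ^ k)"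
    by (intro continuous_intros continuous_on_comp_UNIV[OF v])
  fix y :: 'a assume "y \<notin> cbox a b"
  then have "norm y > sqrt W" using ab by (auto simp: not_le)
  then have "(norm y)\<^sup>2 \<ge> W" by (simp add: less_imp_le real_sqrt_le_iff sqrt_le_D)
  then show "v (x + y) * (max 0 (w - (norm y)\<^sup>2)) ^ k = 0" using w k by (simp add: max_def)
qed

lemma has_real_derivative_radial_moment:
  fixes v :: "'a::euclidean_space \<Rightarrow> real"
  assumes v: "continuous_on UNIV v" and k: "k \<ge> 1"
  shows "(radial_moment (Suc k) v x has_real_derivative real (Suc k) * radial_moment k v x w) (at w)"
proof -
  define W where "W = \<bar>w\<bar> + 1"
  obtain a where a: "cball (0::'a) (sqrt W) \<subseteq> cbox (- a) a"
    using bounded_subset_cbox_symmetric[OF bounded_cball] by blast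
  define f where "f w y = v (x + y) * (max 0 (w - (norm y)\<^sup>2)) ^ Suc k" for w y
  define f' where "f' w y = v (x + y) * (real (Suc k) * (max 0 (w - (norm y)\<^sup>2)) ^ k)" for w y
  have "((\<lambda>w. integral (cbox (- a) a) (f w)) has_real_derivative integral (cbox (- a) a) (f' w)) (at w within {..<W})"
  proof (rule leibniz_rule_field_derivative)
    fix s and y :: 'a
    have "((\<lambda>s. (max 0 (s - (norm y)\<^sup>2)) ^ Suc k) has_real_derivative real (Suc k) * (max 0 (s - (norm y)\<^sup>2)) ^ k * 1) (at s)"
      by (rule DERIV_chain2[OF has_real_derivative_pos_part_power[OF k]]) (auto intro!: derivative_eq_intros)
    from DERIV_cmult[OF this, of "v (x + y)"]
    show "((\<lambda>s. f s y) has_real_derivative f' s y) (at s within {..<W})"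
      unfolding f_def f'_def by (simp add: has_field_derivative_at_within)
  next
    fix s
    show "f s integrable_on cbox (- a) a"
      unfolding f_def by (intro integrable_continuous continuous_intros continuous_on_comp_UNIV[OF v])
  next
    show "continuous_on ({..<W} \<times> cbox (- a) a) (\<lambda>(s, y). f' s y)"
      unfolding f'_def split_beta by (intro continuous_intros continuous_on_comp_UNIV[OF v])
    show "w \<in> {..<W}" by (auto simp: W_def)
  qed simp
  then have "((\<lambda>w. integral (cbox (- a) a) (f w)) has_real_derivative integral (cbox (- a) a) (f' w)) (at w)"
    by (subst (asm) at_within_open) (auto simp: W_def)
  moreover have "integral (cbox (- a) a) (f' w) = real (Suc k) * radial_moment k v x w"
  proof -
    have "f' w = (\<lambda>y. real (Suc k) * (v (x + y) * (max 0 (w - (norm y)\<^sup>2)) ^ k))"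
      by (simp add: f'_def fun_eq_iff)
    then show ?thesis
      using radial_moment_eq_integral[OF v k a, of w x] by (simp add: W_def)
  qed
  ultimately have "((\<lambda>w. integral (cbox (- a) a) (f w)) has_real_derivative real (Suc k) * radial_moment k v x w) (at w)"
    by simp
  then show ?thesis
  proof (rule has_field_derivative_transform_within_open)
    show "open {..<W}" "w \<in> {..<W}" by (auto simp: W_def)
    show "integral (cbox (- a) a) (f s) = radial_moment (Suc k) v x s" if "s \<in> {..<W}" for s
      using radial_moment_eq_integral[OF v _ a, of "Suc k" s x] that unfolding f_def by simp
  qed
qed

lemma radial_moment_nonpos: "w \<le> 0 \<Longrightarrow> k \<ge> 1 \<Longrightarrow> radial_moment k v x w = 0"
proof -
  assume "w \<le> 0" "k \<ge> 1"
  then have "w - (norm y)\<^sup>2 \<le> 0" for y :: 'a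
    using zero_le_power2[of "norm y"] by linarith
  then have "max 0 (w - (norm y)\<^sup>2) ^ k = 0" for y :: 'a
    using \<open>k \<ge> 1\<close> by (simp add: max_absorb1)
  then show ?thesis by (simp add: radial_moment_def)
qed

text \<open>Volume contributes s^m and the kernel s^(2k). The remaining integral is continuous at s
  = 0, which exposes the leading coefficient of the moment there.\<close>

lemma radial_moment_scale:
  fixes v :: "'a::euclidean_space \<Rightarrow> real"
  assumes v: "continuous_on UNIV v" and s: "s > 0" and k: "k \<ge> 1"
  shows "radial_moment k v x (s\<^sup>2) = s ^ (DIM('a) + 2 * k) * (LINT h:cball 0 1|lborel. v (x + s *\<^sub>R h) * bump k 1 h)"
proof -
  have c: "continuous_on UNIV (\<lambda>y. v (x + y) * (max 0 (s\<^sup>2 - (norm y)\<^sup>2)) ^ k)"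
    by (intro continuous_intros continuous_on_comp_UNIV[OF v])
  have b: "(max 0 (s\<^sup>2 - (norm (s *\<^sub>R y))\<^sup>2)) ^ k = s ^ (2 * k) * bump k 1 y" for y :: 'a
  proof -
    have "s\<^sup>2 - (norm (s *\<^sub>R y))\<^sup>2 = s\<^sup>2 * (1 - (norm y)\<^sup>2)" by (simp add: power_mult_distrib algebra_simps)
    then have "max 0 (s\<^sup>2 - (norm (s *\<^sub>R y))\<^sup>2) = s\<^sup>2 * max 0 (1 - (norm y)\<^sup>2)"
      using s by (simp add: max_def zero_le_mult_iff)
    then show ?thesis by (simp add: bump_def power_mult_distrib power_mult)
  qed
  have "radial_moment k v x (s\<^sup>2) = s ^ DIM('a) * (LINT y|lborel. v (x + (0 + s *\<^sub>R y)) * (max 0 (s\<^sup>2 - (norm (0 + s *\<^sub>R y))\<^sup>2)) ^ k)"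
    unfolding radial_moment_def using integral_lborel_affine[OF borel_measurable_continuous_onI[OF c], of s 0] s by simp
  also have "(\<lambda>y. v (x + (0 + s *\<^sub>R y)) * (max 0 (s\<^sup>2 - (norm (0 + s *\<^sub>R y))\<^sup>2)) ^ k)
      = (\<lambda>y. s ^ (2 * k) * (indicator (cball 0 1) y *\<^sub>R (v (x + s *\<^sub>R y) * bump k 1 y)))"
    unfolding add_0 b by (auto simp: fun_eq_iff indicator_def bump_outside[OF _ _ k] not_le)
  also have "(LINT y|lborel. s ^ (2 * k) * (indicator (cball 0 1) y *\<^sub>R (v (x + s *\<^sub>R y) * bump k 1 y)))
     = s ^ (2 * k) * (LINT h:cball 0 1|lborel. v (x + s *\<^sub>R h) * bump k 1 h)"
    unfolding set_lebesgue_integral_def by (rule integral_mult_right_zero)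
  finally show ?thesis by (simp add: power_add mult_ac)
qed

text \<open>The comparison solution H = w^\<nu> times the Bessel series has a Wronskian with the
  moment that vanishes identically, so their quotient is constant; a second solution of the equation
  never has to be discussed.\<close>

lemma radial_moment_3_eq_bessel:
  fixes v :: "'a::euclidean_space \<Rightarrow> real"
  assumes v: "continuous_on UNIV v" and \<mu>: "\<mu> > 0" and W: "W > 0"
    and weak: "\<And>w. 0 < w \<Longrightarrow> w < W \<Longrightarrow> (LINT y|lborel. v (x + y) * bump_laplacian (sqrt w) y) = - \<mu>\<^sup>2 * radial_moment 3 v x w"
  defines "\<nu> \<equiv> real DIM('a) / 2 + 3"
  assumes pos: "\<And>w. 0 < w \<Longrightarrow> w < W \<Longrightarrow> bessel_series \<nu> (\<mu>\<^sup>2 / 4 * w) > 0"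
    and w: "0 < w" "w < W"
  shows "radial_moment 3 v x w = v x * (LINT h:cball (0::'a) 1|lborel. bump 3 1 h) / bessel_series \<nu> 0
    * (w powr \<nu> * bessel_series \<nu> (\<mu>\<^sup>2 / 4 * w))"
proof -
  define m where "m = DIM('a)"
  define c where "c = \<mu>\<^sup>2 / 4"
  have c: "c > 0" using \<mu> by (simp add: c_def)
  have \<nu>: "\<nu> = real m / 2 + 3" "\<nu> > 3" by (simp_all add: \<nu>_def m_def)
  define J where "J k = radial_moment k v x" for k
  define j where "j w = bessel_series \<nu> (c * w)" for w
  define j1 where "j1 w = bessel_series (\<nu> - 1) (c * w)" for w
  have d3: "(J 3 has_real_derivative 3 * J 2 w) (at w)" for w
    using has_real_derivative_radial_moment[OF v, of 2 x w] by (simp add: J_def eval_nat_numeral)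
  have d2: "(J 2 has_real_derivative 2 * J 1 w) (at w)" for w
    using has_real_derivative_radial_moment[OF v, of 1 x w] by (simp add: J_def eval_nat_numeral)
  have dc: "((\<lambda>w. c * w) has_real_derivative c) (at w)" for w
    by (auto intro!: derivative_eq_intros)
  have dj: "(j has_real_derivative - bessel_series (\<nu> + 1) (c * w) * c) (at w)" for w
    unfolding j_def using \<nu> by (intro DERIV_chain2[OF has_real_derivative_bessel_series dc]) simp
  have dj1: "(j1 has_real_derivative - j w * c) (at w)" for w
  proof -
    have "\<nu> - 1 > -1" "\<nu> - 1 + 1 = \<nu>" using \<nu>(2) by simp_all
    then show ?thesis
      using DERIV_chain2[OF has_real_derivative_bessel_series[of "\<nu> - 1"] dc] unfolding j1_def j_def by metis
  qed
  have rec: "c * w * bessel_series (\<nu> + 1) (c * w) = \<nu> * j w - j1 w" for w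
    using bessel_series_recurrence[of \<nu> "c * w"] \<nu> by (simp add: j_def j1_def)
  \<comment> \<open>With y = J 3, y' = 3 J 2 and y'' = 6 J 1 this is w y'' - (\<nu> - 1) y' + c y =
    0. The order \<nu> = m/2 + 3 comes from 24 + 6 m = 12 (\<nu> - 1).\<close>
  have ode: "6 * w * J 1 w - 3 * (\<nu> - 1) * J 2 w + c * J 3 w = 0" if w: "0 < w" "w < W" for w
  proof -
    have b: "bump k (sqrt w) y = (max 0 (w - (norm y)\<^sup>2)) ^ k" for k and y :: 'a
      using w by (simp add: bump_def)
    have i: "integrable lborel (\<lambda>y. v (x + y) * (max 0 (w - (norm y)\<^sup>2)) ^ k)" if k: "k \<ge> 1" for k
    proof (rule integrable_compact_support[of _ "sqrt w"])
      show "continuous_on UNIV (\<lambda>y. v (x + y) * (max 0 (w - (norm y)\<^sup>2)) ^ k)"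
        by (intro continuous_intros continuous_on_comp_UNIV[OF v])
      show "v (x + z) * (max 0 (w - (norm z)\<^sup>2)) ^ k = 0" if "sqrt w < norm z" for z
        using bump_outside[of "sqrt w" z k] that k w by (simp add: b)
    qed
    have "(LINT y|lborel. v (x + y) * bump_laplacian (sqrt w) y) =
       (LINT y|lborel. 24 * w * (v (x + y) * (max 0 (w - (norm y)\<^sup>2)) ^ 1) - (24 + 6 * real m) * (v (x + y) * (max 0 (w - (norm y)\<^sup>2)) ^ 2))"
      using w by (intro Bochner_Integration.integral_cong refl) (simp add: bump_laplacian_def b m_def algebra_simps)
    also have "\<dots> = 24 * w * J 1 w - (24 + 6 * real m) * J 2 w"
      using i[of 1] i[of 2] by (simp add: J_def radial_moment_def)
    finally have "24 * w * J 1 w - (24 + 6 * real m) * J 2 w + 4 * (c * J 3 w) = 0"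
      using weak[OF w] by (simp add: J_def c_def)
    moreover have "24 + 6 * real m = 4 * (3 * (\<nu> - 1))" using \<nu> by simp
    ultimately have "4 * (6 * w * J 1 w - 3 * (\<nu> - 1) * J 2 w + c * J 3 w) = 0"
      by (simp only:) (simp add: algebra_simps)
    then show ?thesis by simp
  qed
  \<comment> \<open>The Wronskian J 3 H' - (J 3)' H divided by w^(\<nu>-1). In this form it is
    differentiable at 0 too, and vanishes there with the moments, so its zero derivative on (0, W)
    makes it vanish throughout.\<close>
  define Q where "Q w = J 3 w * j1 w - 3 * J 2 w * (w * j w)" for w
  define Q' where "Q' w = (3 * J 2 w * j1 w + (- j w * c) * J 3 w)
      - ((3 * (2 * J 1 w)) * (w * j w) + (1 * j w + (- bessel_series (\<nu> + 1) (c * w) * c) * w) * (3 * J 2 w))" for w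
  have dQ: "(Q has_real_derivative Q' w) (at w)" for w
    unfolding Q_def Q'_def by (intro DERIV_diff DERIV_mult DERIV_cmult d2 d3 dj dj1 DERIV_ident)
  have dQ0: "(Q has_real_derivative 0) (at w)" if w: "0 < w" "w < W" for w
  proof (rule DERIV_cong[OF dQ])
    define y where "y = bessel_series (\<nu> + 1) (c * w) * c * w"
    have y: "y = \<nu> * j w - j1 w" using rec[of w] by (simp add: y_def mult_ac)
    have "Q' w = (3 * J 2 w * j1 w + (- j w * c) * J 3 w) - ((3 * (2 * J 1 w)) * (w * j w) + (j w - y) * (3 * J 2 w))"
      by (simp add: Q'_def y_def)
    also have "\<dots> = - j w * (6 * w * J 1 w - 3 * (\<nu> - 1) * J 2 w + c * J 3 w)"
      unfolding y by (simp add: algebra_simps)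
    finally show "Q' w = 0"
      unfolding ode[OF w] by simp
  qed
  have Q0: "Q w = 0" if w: "0 < w" "w < W" for w
  proof -
    have "Q w = Q 0"
    proof (rule DERIV_isconst2[of 0 w])
      show "continuous_on {0..w} Q"
        by (intro continuous_at_imp_continuous_on ballI DERIV_isCont[OF dQ])
    qed (use w dQ0 in auto)
    then show ?thesis by (simp add: Q_def J_def radial_moment_nonpos)
  qed
  define H where "H w = w powr \<nu> * j w" for w
  have dH: "(H has_real_derivative w powr (\<nu> - 1) * j1 w) (at w)" if "w > 0" for w
    unfolding H_def j_def j1_def using \<nu> that c by (intro has_real_derivative_powr_bessel_series) auto
  have H: "H w > 0" if "0 < w" "w < W" for w
    using pos[OF that] that by (simp add: H_def j_def c_def)
  have dR0: "((\<lambda>w. J 3 w / H w) has_real_derivative 0) (at w)" if w: "0 < w" "w < W" for w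
  proof -
    have e: "w powr \<nu> = w * w powr (\<nu> - 1)"
      using w powr_mult_base[of w "\<nu> - 1"] by simp
    have "3 * J 2 w * H w - J 3 w * (w powr (\<nu> - 1) * j1 w) = - (w powr (\<nu> - 1)) * Q w"
      unfolding H_def Q_def e by (simp add: algebra_simps)
    then have "3 * J 2 w * H w - J 3 w * (w powr (\<nu> - 1) * j1 w) = 0" using Q0[OF w] by simp
    moreover have "((\<lambda>w. J 3 w / H w) has_real_derivative (3 * J 2 w * H w - J 3 w * (w powr (\<nu> - 1) * j1 w)) / (H w * H w)) (at w)"
      using H[OF w] by (intro DERIV_divide d3 dH w) simp
    ultimately show ?thesis by simp
  qed
  have dR: "((\<lambda>w. J 3 w / H w) has_real_derivative 0) (at w within {0<..<W})" if "w \<in> {0<..<W}" for w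
    using that by (intro has_field_derivative_at_within[OF dR0]) auto
  have "\<exists>K. \<forall>w\<in>{0<..<W}. J 3 w / H w = K"
    by (rule has_field_derivative_zero_constant[OF convex_real_interval(8) dR])
  then obtain K where K: "\<And>w. 0 < w \<Longrightarrow> w < W \<Longrightarrow> J 3 w / H w = K" by auto
  then have JK: "J 3 w = K * H w" if "0 < w" "w < W" for w
    using H[OF that] K[OF that] by (simp add: field_simps)
  \<comment> \<open>The moment divided by s^(m+6), which is also the power of s contained in
    \<open>H (s\<^sup>2)\<close>. At s = 0 it is v x times the integral of the kernel, and this
    determines K.\<close>
  define N where "N s = (LINT h:cball 0 1|lborel. v (x + s *\<^sub>R h) * bump 3 1 h)" for s
  have cN: "isCont N 0"
    unfolding N_def by (rule isCont_weighted_cball_integral[OF v continuous_on_bump])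
  have NK: "N s = K * j (s\<^sup>2)" if s: "0 < s" "s < sqrt W" for s
  proof -
    have s2: "0 < s\<^sup>2" "s\<^sup>2 < W"
      using s W power_strict_mono[of s "sqrt W" 2] by simp_all
    have "(s\<^sup>2) powr \<nu> = s powr (2 * \<nu>)" using s by (simp add: powr_powr powr_realpow[symmetric] del: powr_numeral)
    also have "2 * \<nu> = real (m + 6)" by (simp add: \<nu>)
    also have "s powr real (m + 6) = s ^ (m + 6)" using s by (intro powr_realpow)
    finally have p: "(s\<^sup>2) powr \<nu> = s ^ (m + 6)" .
    have "s ^ (m + 6) * N s = J 3 (s\<^sup>2)"
      using radial_moment_scale[OF v s(1), of 3 x] by (simp add: J_def N_def m_def)
    also have "\<dots> = s ^ (m + 6) * (K * j (s\<^sup>2))" unfolding JK[OF s2] H_def p by simp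
    finally show ?thesis using s by simp
  qed
  have "(N \<longlongrightarrow> N 0) (at_right 0)" using cN unfolding isCont_def by (rule tendsto_within_subset) simp
  moreover have "((\<lambda>s. K * j (s\<^sup>2)) \<longlongrightarrow> K * j (0\<^sup>2)) (at_right 0)"
  proof -
    have "isCont j (0\<^sup>2)" using dj DERIV_isCont by blast
    then have "isCont (\<lambda>s. j (s\<^sup>2)) 0" by (rule isCont_o2[rotated]) (intro continuous_intros)
    then show ?thesis unfolding isCont_def by (intro tendsto_mult tendsto_const) (rule tendsto_within_subset, auto)
  qed
  moreover have "\<forall>\<^sub>F s in at_right 0. N s = K * j (s\<^sup>2)"
    using eventually_at_right_real[of 0 "sqrt W"] W by (auto elim!: eventually_mono intro: NK)
  ultimately have "N 0 = K * j (0\<^sup>2)"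
    using tendsto_cong[of N "\<lambda>s. K * j (s\<^sup>2)" "at_right 0"]
      tendsto_unique[OF trivial_limit_at_right_real[of "0::real"]] by blast
  moreover have "N 0 = v x * (LINT h:cball (0::'a) 1|lborel. bump 3 1 h)" by (simp add: N_def)
  moreover have "j (0\<^sup>2) = bessel_series \<nu> 0" "bessel_series \<nu> 0 > 0"
    using \<nu> by (simp_all add: j_def bessel_series_0 rGamma_real_pos)
  ultimately have "K = v x * (LINT h:cball (0::'a) 1|lborel. bump 3 1 h) / bessel_series \<nu> 0"
    by (simp add: field_simps)
  then show ?thesis using JK[OF w] by (simp add: J_def H_def j_def c_def)
qed

subsection \<open>Regularity and conclusion\<close>

text \<open>k1 x y is the gradient of k in x. Keeping it as a vector makes continuity easy to state;
  \<open>blinfun_inner_right\<close> converts it into the bounded linear map on which the Leibniz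
  rule operates.\<close>

lemma has_derivative_integral_parameter:
  fixes k :: "'a::euclidean_space \<Rightarrow> 'a \<Rightarrow> real" and k1 :: "'a \<Rightarrow> 'a \<Rightarrow> 'a" and a b :: 'a
  assumes d: "\<And>x y. ((\<lambda>x. k x y) has_derivative (\<lambda>h. k1 x y \<bullet> h)) (at x)"
    and ck: "\<And>x. continuous_on UNIV (k x)"
    and ck1: "continuous_on UNIV (\<lambda>p. k1 (fst p) (snd p))"
  shows "((\<lambda>x. integral (cbox a b) (k x)) has_derivative (\<lambda>h. integral (cbox a b) (\<lambda>y. k1 x y \<bullet> h))) (at x)"
    and "continuous_on UNIV (\<lambda>x. integral (cbox a b) (\<lambda>y. k1 x y \<bullet> h))"
proof -
  have cf: "continuous_on (UNIV \<times> cbox a b) (\<lambda>(x, y). blinfun_inner_right (k1 x y))"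
    unfolding split_beta
    by (intro bounded_linear.continuous_on[OF bounded_linear_blinfun_inner_right] continuous_on_subset[OF ck1]) auto
  have "((\<lambda>x. integral (cbox a b) (k x)) has_derivative integral (cbox a b) (\<lambda>y. blinfun_inner_right (k1 x y))) (at x within UNIV)"
  proof (rule leibniz_rule[OF _ _ cf])
    show "((\<lambda>x. k x y) has_derivative blinfun_apply (blinfun_inner_right (k1 x y))) (at x within UNIV)" for x y
      using d[of y x] by (simp add: blinfun_inner_right.rep_eq)
    show "k x integrable_on cbox a b" for x
      by (intro integrable_continuous continuous_on_subset[OF ck]) auto
  qed auto
  moreover have B: "blinfun_apply (integral (cbox a b) (\<lambda>y. blinfun_inner_right (k1 x y))) h = integral (cbox a b) (\<lambda>y. k1 x y \<bullet> h)" for h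
  proof -
    have "(\<lambda>y. blinfun_inner_right (k1 x y)) integrable_on cbox a b"
    proof (rule integrable_continuous)
      have "continuous_on (cbox a b) (\<lambda>y. k1 (fst (x, y)) (snd (x, y)))"
        by (rule continuous_on_compose2[OF ck1]) (auto intro!: continuous_intros)
      then show "continuous_on (cbox a b) (\<lambda>y. blinfun_inner_right (k1 x y))"
        by (intro bounded_linear.continuous_on[OF bounded_linear_blinfun_inner_right]) simp
    qed
    from blinfun_apply_integral[OF this] show ?thesis by (simp add: blinfun_inner_right.rep_eq)
  qed
  ultimately show "((\<lambda>x. integral (cbox a b) (k x)) has_derivative (\<lambda>h. integral (cbox a b) (\<lambda>y. k1 x y \<bullet> h))) (at x)"
    by (auto intro: has_derivative_eq_rhs simp: fun_eq_iff)
  show "continuous_on UNIV (\<lambda>x. integral (cbox a b) (\<lambda>y. k1 x y \<bullet> h))"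
  proof (rule integral_continuous_on_param)
    show "continuous_on (UNIV \<times> cbox a b) (\<lambda>(x, y). k1 x y \<bullet> h)"
      unfolding split_beta by (intro continuous_intros continuous_on_subset[OF ck1]) auto
  qed
qed

lemma C1_on_integral_parameter:
  fixes k :: "'a::euclidean_space \<Rightarrow> 'a \<Rightarrow> real" and k1 :: "'a \<Rightarrow> 'a \<Rightarrow> 'a" and a b :: 'a
  assumes d: "\<And>x y. ((\<lambda>x. k x y) has_derivative (\<lambda>h. k1 x y \<bullet> h)) (at x)"
    and ck: "\<And>x. continuous_on UNIV (k x)"
    and ck1: "continuous_on UNIV (\<lambda>p. k1 (fst p) (snd p))"
  defines "F \<equiv> \<lambda>x. integral (cbox a b) (k x)"
  shows "partial_deriv h F = (\<lambda>x. integral (cbox a b) (\<lambda>y. k1 x y \<bullet> h))"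
    and "C1_on UNIV F"
proof -
  note D = has_derivative_integral_parameter(1)[OF d ck ck1, where a = a and b = b, folded F_def]
  show p: "partial_deriv h F = (\<lambda>x. integral (cbox a b) (\<lambda>y. k1 x y \<bullet> h))" for h
    unfolding partial_deriv_def using frechet_derivative_at[OF D] by (metis (no_types, lifting) ext)
  show "C1_on UNIV F"
    unfolding C1_on_def p using D has_derivative_integral_parameter(2)[OF d ck ck1]
    by (auto simp: differentiable_def)
qed

section \<open>Differentiating a convolution with a bump\<close>

lemma has_derivative_bump:
  fixes x y :: "'a::euclidean_space"
  assumes "k \<ge> 1"
  shows "((\<lambda>x. bump (Suc k) R (y - x)) has_derivative (\<lambda>h. (2 * real (Suc k) * bump k R (y - x)) *\<^sub>R (y - x) \<bullet> h)) (at x)"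
proof -
  have "((\<lambda>x. R\<^sup>2 - (y - x) \<bullet> (y - x)) has_derivative (\<lambda>h. 2 * ((y - x) \<bullet> h))) (at x)"
    by (auto intro!: derivative_eq_intros simp: inner_commute)
  from DERIV_compose_FDERIV[OF has_real_derivative_pos_part_power[OF assms] this]
  show ?thesis
    unfolding bump_def power2_norm_eq_inner
    by (rule has_derivative_eq_rhs) (auto simp: fun_eq_iff)
qed

text \<open>All derivatives fall on the kernel, so continuity of v is enough. The Laplacian appears
  as the very integral that \<open>weak_equation\<close> evaluates.\<close>

lemma metaharmonic_bump_potential:
  fixes v :: "'a::euclidean_space \<Rightarrow> real" and a b :: 'a and R :: real
  assumes v: "continuous_on UNIV v"
  defines "F \<equiv> \<lambda>x. integral (cbox a b) (\<lambda>y. v y * bump 3 R (y - x))"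
  shows "C2_on UNIV F" and "laplacian F x = integral (cbox a b) (\<lambda>y. v y * bump_laplacian R (y - x))"
proof -
  \<comment> \<open>k1 is the gradient in x of the integrand, l e its component along e, and l1 e
    the gradient of l e. Since x enters as y - x, the signs of first derivatives are
    reversed.\<close>
  define k1 where "k1 x y = v y *\<^sub>R ((6 * bump 2 R (y - x)) *\<^sub>R (y - x))" for x y
  define l where "l e x y = v y * (6 * bump 2 R (y - x) * ((y - x) \<bullet> e))" for e x y
  define l1 where "l1 e x y = v y *\<^sub>R ((24 * bump 1 R (y - x) * ((y - x) \<bullet> e)) *\<^sub>R (y - x) - (6 * bump 2 R (y - x)) *\<^sub>R e)" for e x y
  have cv: "continuous_on UNIV (\<lambda>p::'a \<times> 'a. v (snd p))"
    by (intro continuous_on_comp_UNIV[OF v] continuous_intros)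
  have cb: "continuous_on UNIV (\<lambda>p::'a \<times> 'a. bump k R (snd p - fst p))" for k
    by (intro continuous_on_comp_UNIV[OF continuous_on_bump] continuous_intros)
  have cb': "continuous_on UNIV (\<lambda>y::'a. bump k R (y - x))" for k and x :: 'a
    by (intro continuous_on_comp_UNIV[OF continuous_on_bump] continuous_intros)
  have d1: "((\<lambda>x. v y * bump 3 R (y - x)) has_derivative (\<lambda>h. k1 x y \<bullet> h)) (at x)" for x y
  proof -
    have "((\<lambda>x. bump 3 R (y - x)) has_derivative (\<lambda>h. (6 * bump 2 R (y - x)) *\<^sub>R (y - x) \<bullet> h)) (at x)"
      using has_derivative_bump[of 2 R y x] by (simp add: eval_nat_numeral)
    from has_derivative_mult_right[OF this, of "v y"] show ?thesis
      by (rule has_derivative_eq_rhs) (auto simp: k1_def fun_eq_iff)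
  qed
  have c1: "continuous_on UNIV (\<lambda>p. k1 (fst p) (snd p))"
    unfolding k1_def by (intro continuous_intros cv cb)
  have c0: "continuous_on UNIV (\<lambda>y. v y * bump 3 R (y - x))" for x
    by (intro continuous_intros v cb')
  note F1 = C1_on_integral_parameter[OF d1 c0 c1, where a = a and b = b, folded F_def]
  have pF: "partial_deriv e F = (\<lambda>x. integral (cbox a b) (l e x))" for e
    unfolding F1(1) by (simp add: k1_def l_def[abs_def] mult.assoc)
  have d2: "((\<lambda>x. l e x y) has_derivative (\<lambda>h. l1 e x y \<bullet> h)) (at x)" for e x y
  proof -
    have A: "((\<lambda>x. bump 2 R (y - x)) has_derivative (\<lambda>h. (4 * bump 1 R (y - x)) *\<^sub>R (y - x) \<bullet> h)) (at x)"
      using has_derivative_bump[of 1 R y x] by (simp add: eval_nat_numeral)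
    have B: "((\<lambda>x. (y - x) \<bullet> e) has_derivative (\<lambda>h. - (h \<bullet> e))) (at x)"
      by (auto intro!: derivative_eq_intros)
    from has_derivative_mult_right[OF has_derivative_mult[OF A B], of "6 * v y"]
    have "((\<lambda>x. 6 * v y * (bump 2 R (y - x) * ((y - x) \<bullet> e))) has_derivative (\<lambda>h. l1 e x y \<bullet> h)) (at x)"
      by (rule has_derivative_eq_rhs) (auto simp: l1_def fun_eq_iff inner_diff_left inner_commute algebra_simps)
    then show ?thesis by (simp add: l_def mult_ac)
  qed
  have c2: "continuous_on UNIV (\<lambda>p. l1 e (fst p) (snd p))" for e
    unfolding l1_def by (intro continuous_intros cv cb)
  have c20: "continuous_on UNIV (l e x)" for e x
    unfolding l_def by (intro continuous_intros v cb')
  note F2 = C1_on_integral_parameter[OF d2 c20 c2, where a = a and b = b]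
  show "C2_on UNIV F"
    unfolding C2_on_def pF using F1(2) F2(2) by auto
  have "laplacian F x = (\<Sum>e\<in>Basis. integral (cbox a b) (\<lambda>y. l1 e x y \<bullet> e))"
    unfolding laplacian_def pF F2(1) ..
  also have "\<dots> = integral (cbox a b) (\<lambda>y. \<Sum>e\<in>Basis. l1 e x y \<bullet> e)"
  proof (rule integral_sum[symmetric])
    fix e :: 'a
    have "continuous_on UNIV (\<lambda>y. l1 e x y \<bullet> e)" unfolding l1_def by (intro continuous_intros v cb')
    then show "(\<lambda>y. l1 e x y \<bullet> e) integrable_on cbox a b"
      by (intro integrable_continuous) (auto intro: continuous_on_subset)
  qed simp
  also have "(\<lambda>y. \<Sum>e\<in>Basis. l1 e x y \<bullet> e) = (\<lambda>y. v y * bump_laplacian R (y - x))"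
  proof
    fix y
    define z where "z = y - x"
    have "(\<Sum>e\<in>Basis. l1 e x y \<bullet> e) = (\<Sum>e\<in>Basis. v y * (24 * bump 1 R z * ((z \<bullet> e) * (z \<bullet> e)) - 6 * bump 2 R z))"
      by (intro sum.cong refl) (simp add: l1_def z_def inner_diff_left algebra_simps)
    also have "\<dots> = v y * (24 * bump 1 R z * (\<Sum>e\<in>Basis. (z \<bullet> e) * (z \<bullet> e)) - 6 * (real DIM('a) * bump 2 R z))"
      by (simp only: sum_distrib_left[symmetric] sum_subtractf sum_constant)
    also have "(\<Sum>e\<in>Basis. (z \<bullet> e) * (z \<bullet> e)) = (norm z)\<^sup>2"
      unfolding power2_norm_eq_inner euclidean_inner[of z z] ..
    also have "24 * bump 1 R z * (norm z)\<^sup>2 = 24 * (R\<^sup>2 * bump 1 R z - bump 2 R z)"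
      using bump_Suc[of 1 R z] by (simp add: left_diff_distrib numeral_2_eq_2)
    finally show "(\<Sum>e\<in>Basis. l1 e x y \<bullet> e) = v y * bump_laplacian R (y - x)"
      by (simp add: z_def bump_laplacian_def algebra_simps)
  qed
  finally show "laplacian F x = integral (cbox a b) (\<lambda>y. v y * bump_laplacian R (y - x))" .
qed

section \<open>Locality of differentiability and of the equation\<close>

lemma partial_deriv_cong:
  assumes "open S" "x \<in> S" "\<And>y. y \<in> S \<Longrightarrow> f y = g y"
  shows "partial_deriv b f x = partial_deriv b g x"
proof -
  have "(f has_derivative D) (at x) \<longleftrightarrow> (g has_derivative D) (at x)" for D
    using assms has_derivative_transform_within_open[of f D x UNIV S g] has_derivative_transform_within_open[of g D x UNIV S f]
    by metis
  then show ?thesis unfolding partial_deriv_def frechet_derivative_def by simp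
qed

lemma C1_on_cong:
  assumes "open S" "\<And>y. y \<in> S \<Longrightarrow> f y = g y" "C1_on S f"
  shows "C1_on S g"
  unfolding C1_on_def
proof (intro conjI ballI)
  fix x assume x: "x \<in> S"
  then obtain D where "(f has_derivative D) (at x)" using assms(3) by (auto simp: C1_on_def differentiable_def)
  then have "(g has_derivative D) (at x)" by (rule has_derivative_transform_within_open[OF _ assms(1) x assms(2)])
  then show "g differentiable at x" by (auto simp: differentiable_def)
next
  fix b :: 'a assume "b \<in> Basis"
  then have "continuous_on S (partial_deriv b f)" using assms(3) by (simp add: C1_on_def)
  then show "continuous_on S (partial_deriv b g)"
    by (rule continuous_on_eq) (rule partial_deriv_cong[OF assms(1) _ assms(2)])
qed

lemma C1_on_subset: "C1_on S f \<Longrightarrow> T \<subseteq> S \<Longrightarrow> C1_on T f"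
  unfolding C1_on_def using continuous_on_subset by blast

lemma metaharmonic_on_cong:
  assumes S: "open S" and eq: "\<And>y. y \<in> S \<Longrightarrow> f y = g y" and f: "metaharmonic_on \<mu> S f"
  shows "metaharmonic_on \<mu> S g"
proof -
  have p: "partial_deriv b f y = partial_deriv b g y" if "y \<in> S" for b y
    by (rule partial_deriv_cong[OF S that eq])
  have "laplacian f y = laplacian g y" if "y \<in> S" for y
    unfolding laplacian_def by (intro sum.cong refl partial_deriv_cong[OF S that p])
  moreover have "C2_on S g"
    using f C1_on_cong[OF S eq] C1_on_cong[OF S p] by (auto simp: metaharmonic_on_def C2_on_def)
  ultimately show ?thesis using f eq by (auto simp: metaharmonic_on_def)
qed

lemma C1_on_local:
  assumes "\<And>x. x \<in> D \<Longrightarrow> \<exists>S. open S \<and> x \<in> S \<and> C1_on S f"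
  shows "C1_on D f"
  unfolding C1_on_def
proof (intro conjI ballI continuous_at_imp_continuous_on)
  fix x assume "x \<in> D"
  then obtain S where S: "open S" "x \<in> S" "C1_on S f" using assms by blast
  then show "f differentiable at x" by (simp add: C1_on_def)
  show "isCont (partial_deriv b f) x" if "b \<in> Basis" for b
    using S that by (simp add: C1_on_def continuous_on_eq_continuous_at)
qed

lemma metaharmonic_on_local:
  assumes "\<And>x. x \<in> D \<Longrightarrow> \<exists>S. open S \<and> x \<in> S \<and> metaharmonic_on \<mu> S f"
  shows "metaharmonic_on \<mu> D f"
proof -
  have "C1_on D f" by (rule C1_on_local) (use assms in \<open>unfold metaharmonic_on_def C2_on_def, blast\<close>)
  moreover have "C1_on D (partial_deriv b f)" if "b \<in> Basis" for b
    by (rule C1_on_local) (use assms that in \<open>unfold metaharmonic_on_def C2_on_def, blast\<close>)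
  moreover have "laplacian f x + \<mu>\<^sup>2 * f x = 0" if "x \<in> D" for x
    using assms[OF that] by (auto simp: metaharmonic_on_def)
  ultimately show ?thesis by (simp add: metaharmonic_on_def C2_on_def)
qed

text \<open>The integrands are compared for every p in \<open>ball 0 r\<close>, whether or not p is
  orthogonal to b, so x + p + h p b is only known to lie within 2 r of x and not on the
  sphere.\<close>

lemma sphere_integral_cong:
  fixes u v :: "'a::euclidean_space \<Rightarrow> real"
  assumes "\<And>y. y \<in> cball x (2 * r) \<Longrightarrow> u y = v y"
  shows "sphere_integral u x r = sphere_integral v x r"
proof -
  define b where "b = (SOME b. b \<in> (Basis :: 'a set))"
  have b: "norm b = 1" unfolding b_def by (rule norm_Basis[OF some_Basis])
  have "u (x + p + sqrt (r\<^sup>2 - (norm p)\<^sup>2) *\<^sub>R b) = v (x + p + sqrt (r\<^sup>2 - (norm p)\<^sup>2) *\<^sub>R b) \<and>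
     u (x + p - sqrt (r\<^sup>2 - (norm p)\<^sup>2) *\<^sub>R b) = v (x + p - sqrt (r\<^sup>2 - (norm p)\<^sup>2) *\<^sub>R b)" if p: "p \<in> ball 0 r" for p
  proof -
    let ?t = "sqrt (r\<^sup>2 - (norm p)\<^sup>2)"
    have r: "r \<ge> 0" and n: "norm p \<le> r" using p norm_ge_zero[of p] by (simp_all, linarith)
    have "\<bar>?t\<bar> \<le> r" using r n power_mono[OF n norm_ge_zero, of 2] by (auto intro!: real_le_lsqrt)
    then have t: "norm (?t *\<^sub>R b) \<le> r" using b by simp
    have "norm (p + ?t *\<^sub>R b) \<le> 2 * r" "norm (p - ?t *\<^sub>R b) \<le> 2 * r"
      using t n norm_triangle_ineq[of p "?t *\<^sub>R b"] norm_triangle_ineq4[of p "?t *\<^sub>R b"] by linarith+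
    moreover have "dist x (x + q) = norm q" for q by (simp add: dist_norm)
    ultimately have "x + (p + ?t *\<^sub>R b) \<in> cball x (2 * r)" "x + (p - ?t *\<^sub>R b) \<in> cball x (2 * r)"
      by (simp_all only: mem_cball)
    from assms[OF this(1)] assms[OF this(2)] show ?thesis by (simp add: add.assoc add_diff_eq)
  qed
  then show ?thesis
    unfolding sphere_integral_def Let_def set_lebesgue_integral_def b_def[symmetric]
    by (intro Bochner_Integration.integral_cong refl) (simp add: indicator_def)
qed

text \<open>Relative to V v x the integral is j / j 0 as a function of s = r^2, so the limit is the
  logarithmic derivative of j at 0. By the recursion of Gamma it is -c / (\<nu> + 1), and 4 (\<nu> +
  1) = 2 (m + 2).\<close>

lemma tendsto_cball_difference_of_bessel_identity:
  fixes v :: "'a::euclidean_space \<Rightarrow> real"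
  assumes v: "continuous_on UNIV v" and \<mu>: "\<mu> > 0" and \<rho>: "\<rho> > 0" and D: "DIM('a) \<ge> 2"
    and eq: "\<And>r. 0 < r \<Longrightarrow> r < \<rho> \<Longrightarrow>
           real DIM('a) * bessel_J (real DIM('a) / 2) (\<mu> * r) * sphere_mean v x r
             = \<mu> * r * bessel_J ((real DIM('a) - 2) / 2) (\<mu> * r) * ball_mean v x r"
  defines "V \<equiv> measure lborel (ball (0::'a) 1)"
  shows "((\<lambda>r. (cball_integral v x r - V * v x) / r\<^sup>2) \<longlongrightarrow> - (V * \<mu>\<^sup>2 / (2 * (real DIM('a) + 2))) * v x) (at_right 0)"
proof -
  define \<nu> where "\<nu> = real DIM('a) / 2"
  have \<nu>: "\<nu> > 0" by (simp add: \<nu>_def)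
  define c where "c = \<mu>\<^sup>2 / 4"
  define j where "j s = bessel_series \<nu> (c * s)" for s
  have j0: "j 0 = rGamma (\<nu> + 1)" "j 0 > 0" using \<nu> by (simp_all add: j_def bessel_series_0 rGamma_real_pos)
  obtain \<delta> where \<delta>: "\<delta> > 0" "\<And>r. 0 < r \<Longrightarrow> r < \<delta> \<Longrightarrow> cball_integral v x r = V * v x * j (r\<^sup>2) / j 0"
    using cball_integral_of_bessel_identity[OF v \<mu> \<rho> D eq] unfolding j_def c_def V_def \<nu>_def by auto
  have "((\<lambda>s. c * s) has_real_derivative c) (at 0)" by (auto intro!: derivative_eq_intros)
  then have "(j has_real_derivative - bessel_series (\<nu> + 1) (c * 0) * c) (at 0)"
    unfolding j_def using \<nu> by (intro DERIV_chain2[OF has_real_derivative_bessel_series]) auto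
  then have "((\<lambda>s. (j s - j 0) / s) \<longlongrightarrow> - bessel_series (\<nu> + 1) 0 * c) (at 0)"
    by (simp add: DERIV_def)
  moreover have "filterlim (\<lambda>r::real. r\<^sup>2) (at 0) (at_right 0)"
  proof (rule filterlim_atI)
    show "((\<lambda>r::real. r\<^sup>2) \<longlongrightarrow> 0) (at_right 0)" by (auto intro!: tendsto_eq_intros)
    show "\<forall>\<^sub>F r in at_right 0. (r::real)\<^sup>2 \<noteq> 0" by (auto simp: eventually_at_filter)
  qed
  ultimately have "((\<lambda>r. (j (r\<^sup>2) - j 0) / r\<^sup>2) \<longlongrightarrow> - bessel_series (\<nu> + 1) 0 * c) (at_right 0)"
    by (rule filterlim_compose)
  then have "((\<lambda>r. V * v x / j 0 * ((j (r\<^sup>2) - j 0) / r\<^sup>2)) \<longlongrightarrow> V * v x / j 0 * (- bessel_series (\<nu> + 1) 0 * c)) (at_right 0)"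
    by (intro tendsto_mult tendsto_const)
  moreover have "V * v x / j 0 * (- bessel_series (\<nu> + 1) 0 * c) = - (V * \<mu>\<^sup>2 / (2 * (real DIM('a) + 2))) * v x"
  proof -
    have "j 0 = (\<nu> + 1) * rGamma (\<nu> + 1 + 1)" using rGamma_plus1[of "\<nu> + 1"] j0 by simp
    then have q: "bessel_series (\<nu> + 1) 0 / j 0 = 1 / (\<nu> + 1)"
      using \<nu> rGamma_real_pos[of "\<nu> + 1 + 1"] by (simp add: bessel_series_0)
    have "V * v x / j 0 * (- bessel_series (\<nu> + 1) 0 * c) = - (V * v x * c * (bessel_series (\<nu> + 1) 0 / j 0))"
      by simp
    also have "\<dots> = - (V * \<mu>\<^sup>2 / (4 * (\<nu> + 1)) * v x)" unfolding q by (simp add: c_def)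
    also have "4 * (\<nu> + 1) = 2 * (real DIM('a) + 2)" by (simp add: \<nu>_def)
    finally show ?thesis by simp
  qed
  ultimately have "((\<lambda>r. V * v x / j 0 * ((j (r\<^sup>2) - j 0) / r\<^sup>2)) \<longlongrightarrow> - (V * \<mu>\<^sup>2 / (2 * (real DIM('a) + 2))) * v x) (at_right 0)"
    by (simp only:)
  moreover have "\<forall>\<^sub>F r in at_right 0. V * v x / j 0 * ((j (r\<^sup>2) - j 0) / r\<^sup>2) = (cball_integral v x r - V * v x) / r\<^sup>2"
    using eventually_at_right_real[OF \<delta>(1)]
  proof eventually_elim
    case (elim r)
    then have "cball_integral v x r - V * v x = V * v x / j 0 * (j (r\<^sup>2) - j 0)"
      using \<delta>(2)[of r] j0 by (simp add: right_diff_distrib)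
    then show ?case by simp
  qed
  ultimately show ?thesis by (rule Lim_transform_eventually)
qed

lemma LINT_bump_pos: "(LINT h:cball (0::'a::euclidean_space) 1|lborel. bump k 1 h) > 0"
proof -
  \<comment> \<open>On the ball of radius 1/2 the bump is at least (1 - 1/4)^k.\<close>
  have "0 < measure lborel (ball (0::'a) (1 / 2)) * (3 / 4) ^ k"
    using measure_ball_scale[of "1 / 2" "0::'a"] measure_unit_ball_pos[where 'a='a] by simp
  also have "\<dots> = (LINT h|lborel. indicator (ball (0::'a) (1 / 2)) h * (3 / 4) ^ k)" by simp
  also have "\<dots> \<le> (LINT h|lborel. indicator (cball (0::'a) 1) h *\<^sub>R bump k 1 h)"
  proof (rule integral_mono)
    have "emeasure lborel (ball (0::'a) (1 / 2)) < \<infinity>" using emeasure_lborel_ball_finite[of "0::'a" "1 / 2"] by auto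
    then show "integrable lborel (\<lambda>h. indicat_real (ball (0::'a) (1 / 2)) h * (3 / 4) ^ k)"
      by (intro Bochner_Integration.integrable_mult_left integrable_real_indicator) auto
    show "integrable lborel (\<lambda>h. indicat_real (cball (0::'a) 1) h *\<^sub>R bump k 1 h)"
      by (intro borel_integrable_compact compact_cball continuous_on_bump)
    fix h :: 'a
    have "(3 / 4) ^ k \<le> bump k 1 h" if "norm h < 1 / 2"
    proof -
      have "(norm h)\<^sup>2 \<le> (1 / 2)\<^sup>2" using that by (intro power_mono) auto
      then show ?thesis unfolding bump_def by (intro power_mono) (auto simp: power2_eq_square)
    qed
    then show "indicat_real (ball 0 (1 / 2)) h * (3 / 4) ^ k \<le> indicat_real (cball 0 1) h *\<^sub>R bump k 1 h"
      using bump_nonneg[of k 1 h] by (auto simp: indicator_def)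
  qed
  finally show ?thesis by (simp add: set_lebesgue_integral_def)
qed

lemma metaharmonic_on_ball:
  fixes v :: "'a::euclidean_space \<Rightarrow> real"
  assumes v: "continuous_on UNIV v" and \<mu>: "\<mu> > 0" and \<delta>: "\<delta> > 0"
    and V: "V = measure lborel (ball (0::'a) 1)"
    and L: "\<And>y. y \<in> ball x0 (2 * \<delta>) \<Longrightarrow> ((\<lambda>r. (cball_integral v y r - V * v y) / r\<^sup>2)
       \<longlongrightarrow> - (V * \<mu>\<^sup>2 / (2 * (real DIM('a) + 2))) * v y) (at_right 0)"
  shows "metaharmonic_on \<mu> (ball x0 \<delta>) v"
proof -
  define \<nu> where "\<nu> = real DIM('a) / 2 + 3"
  define c where "c = \<mu>\<^sup>2 / 4"
  have \<nu>: "\<nu> > 0" by (simp add: \<nu>_def add_pos_pos)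
  have j0: "bessel_series \<nu> 0 > 0" using \<nu> by (simp add: bessel_series_0 rGamma_real_pos)
  have cont: "isCont (\<lambda>w. bessel_series \<nu> (c * w)) 0"
    by (rule isCont_o2[where g = "bessel_series \<nu>"]) (use \<nu> in \<open>auto intro!: continuous_intros isCont_bessel_series\<close>)
  have "((\<lambda>w. bessel_series \<nu> (c * w)) \<longlongrightarrow> bessel_series \<nu> 0) (at_right 0)"
    using tendsto_within_subset[OF cont[unfolded isCont_def] subset_UNIV] by simp
  then have "\<forall>\<^sub>F w in at_right 0. bessel_series \<nu> (c * w) > 0"
    using j0 by (rule order_tendstoD)
  then obtain w1 where w1: "w1 > 0" "\<And>w. 0 < w \<Longrightarrow> w < w1 \<Longrightarrow> bessel_series \<nu> (c * w) > 0"
    unfolding eventually_at_right_field by auto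
  \<comment> \<open>Below w1 the Bessel series is positive; below \<delta>^2 the kernel has radius
    less than \<delta>, so that around points of \<open>ball x0 \<delta>\<close> it only sees
    \<open>ball x0 (2 * \<delta>)\<close>.\<close>
  define W where "W = min w1 (\<delta>\<^sup>2)"
  have W: "W > 0" using w1 \<delta> by (simp add: W_def)
  have Wd: "sqrt s < \<delta>" if "s < W" for s
    using that \<delta> real_sqrt_less_mono[of s "\<delta>\<^sup>2"] by (simp add: W_def)
  define w where "w = W / 2"
  have w: "0 < w" "w < W" using W by (simp_all add: w_def)
  define R where "R = sqrt w"
  have R: "0 < R" "R < \<delta>" using w Wd[OF w(2)] by (simp_all add: R_def)
  \<comment> \<open>The factor between v and its moment at the fixed radius R. It does not depend on
    the centre, and it is positive by the choice of W and because the kernel has positive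
    integral.\<close>
  define C where "C = (LINT h:cball (0::'a) 1|lborel. bump 3 1 h) / bessel_series \<nu> 0 * (w powr \<nu> * bessel_series \<nu> (c * w))"
  have C: "C > 0"
    unfolding C_def using LINT_bump_pos[of 3, where 'a='a] j0 w w1(2)[of w] by (simp add: W_def)
  have rm: "radial_moment 3 v x s = (LINT y|lborel. v (x + y) * bump 3 (sqrt s) y)" if "s > 0" for x s
    using that by (simp add: radial_moment_def bump_def)
  have weak: "(LINT y|lborel. v (x + y) * bump_laplacian (sqrt s) y) = - \<mu>\<^sup>2 * radial_moment 3 v x s"
    if x: "x \<in> ball x0 \<delta>" and s: "0 < s" "s < W" for x s
    unfolding rm[OF s(1)]
  proof (rule weak_equation[OF v _ Wd[OF s(2)] V])
    fix y assume "y \<in> ball x \<delta>"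
    then have "y \<in> ball x0 (2 * \<delta>)" using x dist_triangle[of x0 y x] by simp
    then show "((\<lambda>r. (cball_integral v y r - V * v y) / r\<^sup>2) \<longlongrightarrow> - (V * \<mu>\<^sup>2 / (2 * (real DIM('a) + 2))) * v y) (at_right 0)"
      by (rule L)
  qed (use s in simp)
  have moment: "radial_moment 3 v x w = C * v x" if x: "x \<in> ball x0 \<delta>" for x
  proof -
    have "radial_moment 3 v x w = v x * (LINT h:cball (0::'a) 1|lborel. bump 3 1 h) / bessel_series \<nu> 0
      * (w powr \<nu> * bessel_series \<nu> (c * w))"
      unfolding \<nu>_def c_def
      by (rule radial_moment_3_eq_bessel[OF v \<mu> W weak[OF x] _ w])
        (use w1(2) in \<open>auto simp: \<nu>_def c_def W_def\<close>)
    then show ?thesis by (simp add: C_def)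
  qed
  obtain a where a: "cball x0 (2 * \<delta>) \<subseteq> cbox (- a) a"
    using bounded_subset_cbox_symmetric[OF bounded_cball] by blast
  \<comment> \<open>Dividing by C beforehand makes the potential F reproduce v on the ball.\<close>
  define v' where "v' y = v y / C" for y
  have v': "continuous_on UNIV v'" unfolding v'_def using C by (intro continuous_intros v) auto
  define F where "F x = integral (cbox (- a) a) (\<lambda>y. v' y * bump 3 R (y - x))" for x
  have conv: "integral (cbox (- a) a) (\<lambda>y. v' y * g (y - x)) = (LINT y|lborel. v (x + y) * g y) / C"
    if x: "x \<in> ball x0 \<delta>" and g: "continuous_on UNIV g" and g0: "\<And>z. norm z \<ge> R \<Longrightarrow> g z = 0" for x g
  proof -
    have cg: "continuous_on UNIV (\<lambda>y. v' y * g (y - x))"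
      by (intro continuous_intros v' continuous_on_comp_UNIV[OF g])
    have "integral (cbox (- a) a) (\<lambda>y. v' y * g (y - x)) = (LINT y|lborel. v' y * g (y - x))"
    proof (rule LINT_eq_integral_cbox[OF cg, symmetric])
      fix y assume "y \<notin> cbox (- a) a"
      then have "y \<notin> cball x0 (2 * \<delta>)" using a by blast
      then have "dist x0 y > 2 * \<delta>" by simp
      then have "norm (y - x) \<ge> R" using x R dist_triangle[of x0 y x] by (simp add: dist_norm norm_minus_commute)
      then show "v' y * g (y - x) = 0" using g0 by simp
    qed
    also have "\<dots> = (LINT y|lborel. v' (x + 1 *\<^sub>R y) * g (x + 1 *\<^sub>R y - x))"
      using integral_lborel_affine[OF borel_measurable_continuous_onI[OF cg], of 1 x] by simp
    also have "\<dots> = (LINT y|lborel. v (x + y) * g y / C)" by (simp add: v'_def)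
    also have "\<dots> = (LINT y|lborel. v (x + y) * g y) / C" by simp
    finally show ?thesis .
  qed
  have F: "F x = v x" if x: "x \<in> ball x0 \<delta>" for x
  proof -
    have "F x = (LINT y|lborel. v (x + y) * bump 3 R y) / C"
      unfolding F_def using R by (intro conv[OF x continuous_on_bump]) (simp add: bump_outside)
    also have "\<dots> = radial_moment 3 v x w / C" using w by (simp add: rm R_def)
    finally show ?thesis using moment[OF x] C by simp
  qed
  note P = metaharmonic_bump_potential[OF v', where a = "- a" and b = a and R = R, folded F_def]
  have "laplacian F x + \<mu>\<^sup>2 * F x = 0" if x: "x \<in> ball x0 \<delta>" for x
  proof -
    have "laplacian F x = (LINT y|lborel. v (x + y) * bump_laplacian R y) / C"
      unfolding P(2) using R by (intro conv[OF x continuous_on_bump_laplacian]) (simp add: bump_laplacian_def bump_outside)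
    also have "\<dots> = - \<mu>\<^sup>2 * radial_moment 3 v x w / C"
      unfolding R_def weak[OF x w] ..
    also have "\<dots> = - \<mu>\<^sup>2 * v x" using C by (simp add: moment[OF x])
    finally show ?thesis using F[OF x] by simp
  qed
  moreover have "C2_on (ball x0 \<delta>) F"
    using P(1) C1_on_subset[OF _ subset_UNIV] by (auto simp: C2_on_def)
  ultimately have "metaharmonic_on \<mu> (ball x0 \<delta>) F" by (simp add: metaharmonic_on_def)
  with open_ball F show ?thesis by (rule metaharmonic_on_cong)
qed

theorem theorem5:
  fixes D :: "'a::euclidean_space set" and u :: "'a \<Rightarrow> real"
    and \<mu> :: real and \<rho> :: "'a \<Rightarrow> real"
  assumes "DIM('a) \<ge> 2"
    and "open D" and "connected D" and "bounded D"
    and "\<mu> > 0"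
    and "continuous_on D u"
    and "\<And>x. x \<in> D \<Longrightarrow> \<rho> x > 0 \<and> admissible_ball D x (\<rho> x)"
    and "\<And>x r. x \<in> D \<Longrightarrow> 0 < r \<Longrightarrow> r < \<rho> x \<Longrightarrow>
           real DIM('a) * bessel_J (real DIM('a) / 2) (\<mu> * r) * sphere_mean u x r
             = \<mu> * r * bessel_J ((real DIM('a) - 2) / 2) (\<mu> * r) * ball_mean u x r"
  shows "metaharmonic_on \<mu> D u"
proof (rule metaharmonic_on_local)
  fix x0 assume x0: "x0 \<in> D"
  obtain \<rho>0 where \<rho>0: "\<rho>0 > 0" "cball x0 \<rho>0 \<subseteq> D"
    using open_contains_cball[of D] assms(2) x0 by blast
  have uK: "continuous_on (cball x0 \<rho>0) u" using assms(6) \<rho>0(2) by (rule continuous_on_subset)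
  have "bounded (u ` cball x0 \<rho>0)" by (intro compact_imp_bounded compact_continuous_image uK compact_cball)
  then obtain B where "\<forall>y\<in>cball x0 \<rho>0. norm (u y) \<le> B" unfolding bounded_iff by auto
  then have B: "norm (u y) \<le> B" if "y \<in> cball x0 \<rho>0" for y using that by blast
  have "0 \<le> B" using B[of x0] \<rho>0(1) by (auto intro: order_trans[OF norm_ge_zero])
  \<comment> \<open>The analysis above is for functions continuous on the whole space. The claim is
    local, so u may be replaced by a Tietze extension of its restriction to a closed ball in
    D.\<close>
  then obtain v where v: "continuous_on UNIV v" "\<And>y. y \<in> cball x0 \<rho>0 \<Longrightarrow> v y = u y"
  proof -
    have "closedin (top_of_set UNIV) (cball x0 \<rho>0)" by simp
    from uK this \<open>0 \<le> B\<close> B show thesis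
    proof (rule Tietze)
      fix g assume "continuous_on UNIV g" "\<And>y. y \<in> cball x0 \<rho>0 \<Longrightarrow> g y = u y"
      then show thesis by (rule that)
    qed
  qed
  define \<delta> where "\<delta> = \<rho>0 / 2"
  have \<delta>: "\<delta> > 0" "2 * \<delta> = \<rho>0" using \<rho>0(1) by (simp_all add: \<delta>_def)
  have "metaharmonic_on \<mu> (ball x0 \<delta>) v"
  proof (rule metaharmonic_on_ball[OF v(1) assms(5) \<delta>(1) refl])
    fix y assume "y \<in> ball x0 (2 * \<delta>)"
    then have y: "dist x0 y < \<rho>0" by (simp add: \<delta>)
    then have yD: "y \<in> D" using \<rho>0(2) by auto
    \<comment> \<open>Halving the distance to the boundary leaves room for
      \<open>sphere_integral_cong\<close>, which compares u and v on the ball of radius 2 r.\<close>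
    define \<rho>' where "\<rho>' = min (\<rho> y) ((\<rho>0 - dist x0 y) / 2)"
    have \<rho>': "\<rho>' > 0" using assms(7)[OF yD] y by (simp add: \<rho>'_def)
    show "((\<lambda>r. (cball_integral v y r - measure lborel (ball (0::'a) 1) * v y) / r\<^sup>2)
       \<longlongrightarrow> - (measure lborel (ball (0::'a) 1) * \<mu>\<^sup>2 / (2 * (real DIM('a) + 2))) * v y) (at_right 0)"
    proof (rule tendsto_cball_difference_of_bessel_identity[OF v(1) assms(5) \<rho>' assms(1)])
      fix r assume r: "0 < r" "r < \<rho>'"
      have sub: "u z = v z" if "z \<in> cball y (2 * r)" for z
      proof -
        have "dist x0 z \<le> dist x0 y + dist y z" by (rule dist_triangle)
        also have "\<dots> \<le> \<rho>0" using that r(2) by (simp add: \<rho>'_def)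
        finally show ?thesis using v(2)[of z] by simp
      qed
      have "sphere_integral u y r = sphere_integral v y r" using sub by (rule sphere_integral_cong)
      then have "sphere_mean u y r = sphere_mean v y r" by (simp only: sphere_mean_def)
      moreover have "ball_mean u y r = ball_mean v y r"
        unfolding ball_mean_def using r(1)
        by (intro arg_cong2[where f = "(/)"] refl set_lebesgue_integral_cong) (auto intro!: sub)
      ultimately show "real DIM('a) * bessel_J (real DIM('a) / 2) (\<mu> * r) * sphere_mean v y r
             = \<mu> * r * bessel_J ((real DIM('a) - 2) / 2) (\<mu> * r) * ball_mean v y r"
        using assms(8)[OF yD r(1)] r(2) by (simp add: \<rho>'_def)
    qed
  qed
  then have "metaharmonic_on \<mu> (ball x0 \<delta>) u"
    by (rule metaharmonic_on_cong[OF open_ball, rotated]) (use v(2) \<delta> in auto)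
  then show "\<exists>S. open S \<and> x0 \<in> S \<and> metaharmonic_on \<mu> S u"
    using \<delta>(1) by (intro exI[of _ "ball x0 \<delta>"]) auto
qed

end
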